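(* Let $X$ be a concrete fibrant cubeset. Then the following assertions hold. (i) The simplicial set $K^\ast X$ is fibrant, i.e. a Kan complex. (ii) The set of ergodic components of $X$ is canonically isomorphic to the set of connected components of $K^\ast X$, and the isomorphism is natural in $X$. (iii) For all $n\ge 1$ and all vertices $x_0\in X(0)$, the $n$-th structure group of $X$ at $x_0$ is canonically isomorphic (as a group) to the $n$-th simplicial homotopy group $\pi_n(K^\ast X,x_0)$, and the isomorphism is natural in $X$.
   Context: **Cubesets.** The category $\square$ has objects $\{0,1\}^n$, $n\ge 0$, and morphisms the maps $\{0,1\}^n\to\{0,1\}^m$ that are restrictions of affine linear maps $\mathbb Z^n\to\mathbb Z^m$. A cubeset is a presheaf of sets $X$ on $\square$; write $X(n)$ for its value at $\{0,1\}^n$. It is concrete if $X(n)\to X(0)^{\{0,1\}^n}$ (restriction to vertices) is injective for all $n$. The $n$-corner ($n\ge1$) is the union, inside the representable cubeset of $\{0,1\}^n$, of all faces of dimension less than $n$ not containing $(1,\dots,1)$ (equivalently of the faces $[x_j=0]$). A cubeset is fibrant if every map from an $n$-corner to it extends to the $n$-cube, for all $n\geq 1$. **Ergodic components.** For $X$ concrete fibrant, these are the classes of $X(0)$ under the equivalence relation $x\sim y\iff (x,y)\in X(1)$. **Structure groups.** For $X$ a concrete fibrant cubeset, $x_0\in X(0)$, $n\ge1$, let $B_n(X,x_0)$ be the set of $c\in X(n)$ with $c(v)=x_0$ for all $v\ne(1,\dots,1)$. Identify $c\sim d$ iff the configuration $\{0,1\}^{n+1}\to X(0)$ equal to $c$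 on one of the two opposite faces in a coordinate direction and $d$ on the other is in $X(n+1)$. The $n$-th structure group is $B_n(X,x_0)/\!\sim$, with group law: $[c]\cdot[d]=[e]$ iff for suitable representatives there is $q\in X(n+1)$ with $q(1,\dots,1,1,0)=c(1,\dots,1)$, $q(1,\dots,1,0,1)=d(1,\dots,1)$, $q(1,\dots,1,1,1)=e(1,\dots,1)$ and all other values $x_0$. (This is a well-defined abelian group.) **The functor $K^\ast$.** $\mathrm{Sub}[n]$ denotes the set of nonempty subsets of $\{0,\dots,n\}$; $\Delta$ is the simplex category; $\sigma\colon[k]\to[n]$ in $\Delta$ induces $\sigma_\ast\colon\mathrm{Sub}[k]\to\mathrm{Sub}[n]$ by direct image. A formal $k$-cube with labels in $[k]$ is a map $A\colon\{0,1\}^k\to\mathrm{Sub}[k]$. It is degenerable if for every $0\le i<k$, the map $\sigma_{i,\ast}\circ A$ does not depend on the coordinate $x_i$, where $\sigma_i\colon[k]\to[k-1]$ is the degeneracy identifying $i$ and $i+1$ (coordinates are $x_0,\dots,x_{k-1}$). Let $K_n(m)$ be the set of all composites $\sigma_\ast\circ A\circ\phi\colon\{0,1\}^m\to\mathrm{Sub}[n]$ with $\phi\colon\{0,1\}^m\to\{0,1\}^k$ in $\square$, $A$ a degenerable formal $k$-cube, $\sigma\colon[k]\to[n]$ in $\Delta$, $k\ge0$. With precomposition by maps of $\square$ and postcomposition by direct images, $K$ is a cosimplicial cubeset. For a cubeset $X$, $K^\ast X$ is the simplicial set $[n]\mapsto\mathrm{Hom}(K_n,X)$ (Hom of cubesets).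 Since $K_0$ is terminal, $K^\ast_0X=X(0)$, which is how $x_0$ is a vertex of $K^\ast X$. *)

theory Defs
  imports "HOL-Algebra.Group"
begin

section \<open>Presheaves on the cube category and on the simplex category\<close>

text \<open>
  Both index categories are concrete categories whose objects are numbered by the natural
  numbers: object \<open>n\<close> is a set \<open>ob n\<close>, and \<open>mor m n\<close> is a set of extensional
  functions from \<open>ob m\<close> to \<open>ob n\<close>.  If \<open>\<phi> \<in> mor m n\<close>, then \<open>restr X m n \<phi>\<close> is the
  action of \<open>\<phi>\<close>, from \<open>sections X n\<close> to \<open>sections X m\<close>; its values outside
  \<open>sections X n\<close> are irrelevant.  That all the sets \<open>sections X n\<close> live in one type is no
  restriction, since they need not be disjoint or cover the type.
\<close>

record ('p, 'a) psh =
  sections :: "nat \<Rightarrow> 'a set"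
  restr :: "nat \<Rightarrow> nat \<Rightarrow> ('p \<Rightarrow> 'p) \<Rightarrow> 'a \<Rightarrow> 'a"

definition presheaf ::
  "(nat \<Rightarrow> 'p set) \<Rightarrow> (nat \<Rightarrow> nat \<Rightarrow> ('p \<Rightarrow> 'p) set) \<Rightarrow> ('p, 'a) psh \<Rightarrow> bool" where
  "presheaf ob mor X \<longleftrightarrow>
     (\<forall>m n. \<forall>\<phi>\<in>mor m n. \<forall>c\<in>sections X n. restr X m n \<phi> c \<in> sections X m) \<and>
     (\<forall>n. \<forall>c\<in>sections X n. restr X n n (\<lambda>p\<in>ob n. p) c = c) \<and>
     (\<forall>l m n. \<forall>\<psi>\<in>mor l m. \<forall>\<phi>\<in>mor m n. \<forall>c\<in>sections X n.
        restr X l n (compose (ob l) \<phi> \<psi>) c = restr X l m \<psi> (restr X m n \<phi> c))"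

definition psh_hom ::
  "(nat \<Rightarrow> nat \<Rightarrow> ('p \<Rightarrow> 'p) set) \<Rightarrow> ('p, 'a) psh \<Rightarrow> ('p, 'b) psh \<Rightarrow> (nat \<Rightarrow> 'a \<Rightarrow> 'b) set" where
  "psh_hom mor X Y =
     {f. (\<forall>n. f n \<in> sections X n \<rightarrow>\<^sub>E sections Y n) \<and>
         (\<forall>m n. \<forall>\<phi>\<in>mor m n. \<forall>c\<in>sections X n.
            f m (restr X m n \<phi> c) = restr Y m n \<phi> (f n c))}"

definition representable ::
  "(nat \<Rightarrow> 'p set) \<Rightarrow> (nat \<Rightarrow> nat \<Rightarrow> ('p \<Rightarrow> 'p) set) \<Rightarrow> nat \<Rightarrow> ('p, 'p \<Rightarrow> 'p) psh" where
  "representable ob mor n =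
     \<lparr>sections = (\<lambda>m. mor m n), restr = (\<lambda>l m \<psi> \<phi>. compose (ob l) \<phi> \<psi>)\<rparr>"

text \<open>Every map to \<open>X\<close> from the subpresheaf \<open>A\<close> of \<open>B\<close> extends to \<open>B\<close>.\<close>

definition extends_along ::
  "(nat \<Rightarrow> nat \<Rightarrow> ('p \<Rightarrow> 'p) set) \<Rightarrow> ('p, 'b) psh \<Rightarrow> ('p, 'b) psh \<Rightarrow> ('p, 'a) psh \<Rightarrow> bool" where
  "extends_along mor A B X \<longleftrightarrow>
     (\<forall>f\<in>psh_hom mor A X. \<exists>g\<in>psh_hom mor B X. \<forall>m. \<forall>c\<in>sections A m. g m c = f m c)"


section \<open>Cubesets\<close>

definition cube :: "nat \<Rightarrow> (nat \<Rightarrow> int) set" where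
  "cube n = {..<n} \<rightarrow>\<^sub>E {0, 1}"

definition cube_maps :: "nat \<Rightarrow> nat \<Rightarrow> ((nat \<Rightarrow> int) \<Rightarrow> (nat \<Rightarrow> int)) set" where
  "cube_maps m n =
     {\<phi> \<in> cube m \<rightarrow>\<^sub>E cube n.
        \<exists>(a :: nat \<Rightarrow> nat \<Rightarrow> int) (b :: nat \<Rightarrow> int).
          \<forall>x\<in>cube m. \<forall>i<n. \<phi> x i = b i + (\<Sum>j<m. a i j * x j)}"

definition ones :: "nat \<Rightarrow> nat \<Rightarrow> int" where
  "ones n = (\<lambda>i\<in>{..<n}. 1)"

type_synonym 'a cubeset = "(nat \<Rightarrow> int, 'a) psh"

abbreviation cubeset :: "'a cubeset \<Rightarrow> bool" where
  "cubeset \<equiv> presheaf cube cube_maps"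

abbreviation cubeset_hom :: "'a cubeset \<Rightarrow> 'b cubeset \<Rightarrow> (nat \<Rightarrow> 'a \<Rightarrow> 'b) set" where
  "cubeset_hom \<equiv> psh_hom cube_maps"

abbreviation std_cube :: "nat \<Rightarrow> ((nat \<Rightarrow> int) \<Rightarrow> (nat \<Rightarrow> int)) cubeset" where
  "std_cube \<equiv> representable cube cube_maps"

definition vert :: "'a cubeset \<Rightarrow> nat \<Rightarrow> 'a \<Rightarrow> (nat \<Rightarrow> int) \<Rightarrow> 'a" where
  "vert X n c v = restr X 0 n (\<lambda>u\<in>cube 0. v) c"

definition const_cube :: "'a cubeset \<Rightarrow> nat \<Rightarrow> 'a \<Rightarrow> 'a" where
  "const_cube X n x = restr X n 0 (\<lambda>u\<in>cube n. ones 0) x"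

definition concrete :: "'a cubeset \<Rightarrow> bool" where
  "concrete X \<longleftrightarrow> (\<forall>n. inj_on (\<lambda>c. \<lambda>v\<in>cube n. vert X n c v) (sections X n))"

text \<open>The union of the faces \<open>[x\<^sub>j = 0]\<close> inside the representable cubeset.\<close>

definition corner :: "nat \<Rightarrow> ((nat \<Rightarrow> int) \<Rightarrow> (nat \<Rightarrow> int)) cubeset" where
  "corner n = (std_cube n)\<lparr>sections :=
     (\<lambda>m. {\<phi> \<in> cube_maps m n. \<exists>j<n. \<forall>x\<in>cube m. \<phi> x j = 0})\<rparr>"

definition fibrant :: "'a cubeset \<Rightarrow> bool" where
  "fibrant X \<longleftrightarrow> (\<forall>n\<ge>1. extends_along cube_maps (corner n) (std_cube n) X)"

definition concrete_fibrant :: "'a cubeset \<Rightarrow> bool" where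
  "concrete_fibrant X \<longleftrightarrow> cubeset X \<and> concrete X \<and> fibrant X"

text \<open>The configuration \<open>p\<close> of vertices belongs to \<open>X(n)\<close>, viewed as a set of configurations.\<close>

definition is_cube :: "'a cubeset \<Rightarrow> nat \<Rightarrow> ((nat \<Rightarrow> int) \<Rightarrow> 'a) \<Rightarrow> bool" where
  "is_cube X n p \<longleftrightarrow> (\<exists>c\<in>sections X n. \<forall>v\<in>cube n. vert X n c v = p v)"


section \<open>Ergodic components and structure groups\<close>

definition erg_rel :: "'a cubeset \<Rightarrow> ('a \<times> 'a) set" where
  "erg_rel X = {(x, y). x \<in> sections X 0 \<and> y \<in> sections X 0 \<and>
                        is_cube X 1 (\<lambda>v. if v 0 = 0 then x else y)}"

definition erg_components :: "'a cubeset \<Rightarrow> 'a set set" where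
  "erg_components X = sections X 0 // erg_rel X"

definition erg_map ::
  "'a cubeset \<Rightarrow> 'b cubeset \<Rightarrow> (nat \<Rightarrow> 'a \<Rightarrow> 'b) \<Rightarrow> 'a set \<Rightarrow> 'b set" where
  "erg_map X Y f P = erg_rel Y `` (f 0 ` P)"

definition str_cubes :: "'a cubeset \<Rightarrow> nat \<Rightarrow> 'a \<Rightarrow> 'a set" where
  "str_cubes X n x0 = {c \<in> sections X n. \<forall>v\<in>cube n - {ones n}. vert X n c v = x0}"

definition drop_coord :: "nat \<Rightarrow> nat \<Rightarrow> (nat \<Rightarrow> int) \<Rightarrow> (nat \<Rightarrow> int)" where
  "drop_coord n j v = (\<lambda>i\<in>{..<n}. if i < j then v i else v (Suc i))"

text \<open>
  The coordinate direction \<open>j\<close> does not matter, since permutations of the coordinates are maps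
  of cubes.
\<close>

definition str_rel :: "'a cubeset \<Rightarrow> nat \<Rightarrow> 'a \<Rightarrow> ('a \<times> 'a) set" where
  "str_rel X n x0 = {(c, d). c \<in> str_cubes X n x0 \<and> d \<in> str_cubes X n x0 \<and>
     (\<exists>j\<le>n. is_cube X (Suc n) (\<lambda>v. vert X n (if v j = 0 then c else d) (drop_coord n j v)))}"

definition str_prod :: "'a cubeset \<Rightarrow> nat \<Rightarrow> 'a \<Rightarrow> 'a \<Rightarrow> 'a \<Rightarrow> 'a \<Rightarrow> bool" where
  "str_prod X n x0 c d e \<longleftrightarrow>
     is_cube X (Suc n) (\<lambda>v.
       if v = (ones (Suc n))(n := 0) then vert X n c (ones n)
       else if v = (ones (Suc n))(n - 1 := 0) then vert X n d (ones n)
       else if v = ones (Suc n) then vert X n e (ones n)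
       else x0)"

definition str_group :: "'a cubeset \<Rightarrow> nat \<Rightarrow> 'a \<Rightarrow> 'a set monoid" where
  "str_group X n x0 =
     \<lparr>carrier = str_cubes X n x0 // str_rel X n x0,
      mult = (\<lambda>P Q. THE R. R \<in> str_cubes X n x0 // str_rel X n x0 \<and>
                           (\<exists>c\<in>P. \<exists>d\<in>Q. \<exists>e\<in>R. str_prod X n x0 c d e)),
      one = str_rel X n x0 `` {const_cube X n x0}\<rparr>"

definition str_map ::
  "nat \<Rightarrow> 'a cubeset \<Rightarrow> 'b cubeset \<Rightarrow> 'a \<Rightarrow> (nat \<Rightarrow> 'a \<Rightarrow> 'b) \<Rightarrow> 'a set \<Rightarrow> 'b set" where
  "str_map n X Y x0 f P = str_rel Y n (f 0 x0) `` (f n ` P)"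


section \<open>Simplicial sets\<close>

definition simplex :: "nat \<Rightarrow> nat set" where
  "simplex n = {..n}"

definition simplex_maps :: "nat \<Rightarrow> nat \<Rightarrow> (nat \<Rightarrow> nat) set" where
  "simplex_maps m n = {\<sigma> \<in> simplex m \<rightarrow>\<^sub>E simplex n. mono_on (simplex m) \<sigma>}"

type_synonym 's sset = "(nat, 's) psh"

abbreviation simplicial_set :: "'s sset \<Rightarrow> bool" where
  "simplicial_set \<equiv> presheaf simplex simplex_maps"

abbreviation sset_hom :: "'s sset \<Rightarrow> 't sset \<Rightarrow> (nat \<Rightarrow> 's \<Rightarrow> 't) set" where
  "sset_hom \<equiv> psh_hom simplex_maps"

abbreviation std_simplex :: "nat \<Rightarrow> (nat \<Rightarrow> nat) sset" where
  "std_simplex \<equiv> representable simplex simplex_maps"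

definition horn :: "nat \<Rightarrow> nat \<Rightarrow> (nat \<Rightarrow> nat) sset" where
  "horn n k = (std_simplex n)\<lparr>sections :=
     (\<lambda>m. {\<sigma> \<in> simplex_maps m n. \<exists>i\<in>simplex n. i \<noteq> k \<and> i \<notin> \<sigma> ` simplex m})\<rparr>"

definition kan_complex :: "'s sset \<Rightarrow> bool" where
  "kan_complex S \<longleftrightarrow> simplicial_set S \<and>
     (\<forall>n\<ge>1. \<forall>k\<le>n. extends_along simplex_maps (horn n k) (std_simplex n) S)"

text \<open>\<open>sface S n i\<close> is the \<open>i\<close>-th face map from the \<open>n\<close>-simplices, for \<open>n \<ge> 1\<close>.\<close>

definition sface :: "'s sset \<Rightarrow> nat \<Rightarrow> nat \<Rightarrow> 's \<Rightarrow> 's" where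
  "sface S n i s = restr S (n - 1) n (\<lambda>j\<in>simplex (n - 1). if j < i then j else Suc j) s"

definition const_simplex :: "'s sset \<Rightarrow> nat \<Rightarrow> 's \<Rightarrow> 's" where
  "const_simplex S n s = restr S n 0 (\<lambda>j\<in>simplex n. 0) s"

definition conn_rel :: "'s sset \<Rightarrow> ('s \<times> 's) set" where
  "conn_rel S =
     (let E = {(sface S 1 1 e, sface S 1 0 e) | e. e \<in> sections S 1} in (E \<union> E\<inverse>)\<^sup>*)"

definition conn_components :: "'s sset \<Rightarrow> 's set set" where
  "conn_components S = sections S 0 // conn_rel S"

definition conn_map ::
  "'s sset \<Rightarrow> 't sset \<Rightarrow> (nat \<Rightarrow> 's \<Rightarrow> 't) \<Rightarrow> 's set \<Rightarrow> 't set" where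
  "conn_map S T g P = conn_rel T `` (g 0 ` P)"

text \<open>
  The simplicial homotopy groups of a Kan complex, in the combinatorial form of Kan and May
  (\<^emph>\<open>Simplicial Objects in Algebraic Topology\<close>, I.3-4).
\<close>

definition spheres :: "'s sset \<Rightarrow> nat \<Rightarrow> 's \<Rightarrow> 's set" where
  "spheres S n s0 =
     {s \<in> sections S n. \<forall>i\<le>n. sface S n i s = const_simplex S (n - 1) s0}"

definition homotopy_rel :: "'s sset \<Rightarrow> nat \<Rightarrow> 's \<Rightarrow> ('s \<times> 's) set" where
  "homotopy_rel S n s0 = {(s, t). s \<in> spheres S n s0 \<and> t \<in> spheres S n s0 \<and>
     (\<exists>w\<in>sections S (Suc n). sface S (Suc n) n w = s \<and> sface S (Suc n) (Suc n) w = t \<and>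
        (\<forall>i<n. sface S (Suc n) i w = const_simplex S n s0))}"

definition homotopy_prod :: "'s sset \<Rightarrow> nat \<Rightarrow> 's \<Rightarrow> 's \<Rightarrow> 's \<Rightarrow> 's \<Rightarrow> bool" where
  "homotopy_prod S n s0 s t u \<longleftrightarrow>
     (\<exists>w\<in>sections S (Suc n). sface S (Suc n) (n - 1) w = s \<and>
        sface S (Suc n) (Suc n) w = t \<and> sface S (Suc n) n w = u \<and>
        (\<forall>i<n - 1. sface S (Suc n) i w = const_simplex S n s0))"

definition homotopy_group :: "'s sset \<Rightarrow> nat \<Rightarrow> 's \<Rightarrow> 's set monoid" where
  "homotopy_group S n s0 =
     \<lparr>carrier = spheres S n s0 // homotopy_rel S n s0,
      mult = (\<lambda>P Q. THE R. R \<in> spheres S n s0 // homotopy_rel S n s0 \<and>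
                           (\<exists>s\<in>P. \<exists>t\<in>Q. \<exists>u\<in>R. homotopy_prod S n s0 s t u)),
      one = homotopy_rel S n s0 `` {const_simplex S n s0}\<rparr>"

definition homotopy_map ::
  "nat \<Rightarrow> 's sset \<Rightarrow> 't sset \<Rightarrow> 's \<Rightarrow> (nat \<Rightarrow> 's \<Rightarrow> 't) \<Rightarrow> 's set \<Rightarrow> 't set" where
  "homotopy_map n S T s0 g P = homotopy_rel T n (g 0 s0) `` (g n ` P)"


section \<open>The cosimplicial cubeset \<open>K\<close> and the functor it represents\<close>

definition Sub :: "nat \<Rightarrow> nat set set" where
  "Sub n = {A. A \<noteq> {} \<and> A \<subseteq> simplex n}"

definition degen :: "nat \<Rightarrow> nat \<Rightarrow> nat" where
  "degen i j = (if j \<le> i then j else j - 1)"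

definition degenerable :: "nat \<Rightarrow> ((nat \<Rightarrow> int) \<Rightarrow> nat set) \<Rightarrow> bool" where
  "degenerable k A \<longleftrightarrow> A \<in> cube k \<rightarrow>\<^sub>E Sub k \<and>
     (\<forall>i<k. \<forall>x\<in>cube k. \<forall>y\<in>cube k. (\<forall>j<k. j \<noteq> i \<longrightarrow> x j = y j) \<longrightarrow>
        degen i ` A x = degen i ` A y)"

definition K :: "nat \<Rightarrow> ((nat \<Rightarrow> int) \<Rightarrow> nat set) cubeset" where
  "K n =
     \<lparr>sections = (\<lambda>m. {(\<lambda>x\<in>cube m. \<sigma> ` A (\<phi> x)) | k \<sigma> A \<phi>.
                        \<phi> \<in> cube_maps m k \<and> degenerable k A \<and> \<sigma> \<in> simplex_maps k n}),
      restr = (\<lambda>l m \<psi> c. compose (cube l) c \<psi>)\<rparr>"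

definition K_push ::
  "nat \<Rightarrow> (nat \<Rightarrow> nat) \<Rightarrow> ((nat \<Rightarrow> int) \<Rightarrow> nat set) \<Rightarrow> ((nat \<Rightarrow> int) \<Rightarrow> nat set)" where
  "K_push m \<sigma> c = (\<lambda>x\<in>cube m. \<sigma> ` c x)"

type_synonym 'a Kstar_simplex = "nat \<Rightarrow> ((nat \<Rightarrow> int) \<Rightarrow> nat set) \<Rightarrow> 'a"

definition Kstar :: "'a cubeset \<Rightarrow> 'a Kstar_simplex sset" where
  "Kstar X =
     \<lparr>sections = (\<lambda>n. cubeset_hom (K n) X),
      restr = (\<lambda>k n \<sigma> f m. \<lambda>c\<in>sections (K k) m. f m (K_push m \<sigma> c))\<rparr>"

definition Kstar_map ::
  "(nat \<Rightarrow> 'a \<Rightarrow> 'b) \<Rightarrow> nat \<Rightarrow> 'a Kstar_simplex \<Rightarrow> 'b Kstar_simplex" where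
  "Kstar_map f n s m = (\<lambda>c\<in>sections (K n) m. f m (s m c))"

text \<open>The bijection from \<open>X(0)\<close> to the vertices of \<open>K\<^sup>*X\<close>.\<close>

definition Kstar_vertex :: "'a cubeset \<Rightarrow> 'a \<Rightarrow> 'a Kstar_simplex" where
  "Kstar_vertex X x m = (\<lambda>c\<in>sections (K 0) m. const_cube X m x)"

end

theory Submission
  imports Defs "HOL-Library.Infinite_Set"
begin

text \<open>
  A map from \<open>K n\<close> to \<open>X\<close> amounts to a labelling of the nonempty subsets of \<open>{..n}\<close> by
  points of \<open>X\<close>.  If no two elements of \<open>P\<close> are neighbours in \<open>T\<close>, then removing the elements of
  \<open>P\<close> from \<open>T\<close> independently of each other describes a degenerable formal cube, and the
  labelling has to turn it into a cube of \<open>X\<close>.  These conditions are also sufficient: in an arbitrary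
  degenerable cube the relevant coordinates decide about single elements, and gluing reduces it
  to cubes of this kind.

  A horn leaves open the labels of \<open>{..n}\<close> and \<open>{..n} - {k}\<close> only.  The two parity classes of
  \<open>{..n}\<close> are sets without neighbours; their conditions on the labelling are met by filling a
  corner each, and all others follow because an element of \<open>P\<close> can be exchanged for its neighbour
  in \<open>T\<close>.

  An \<open>n\<close>-simplex with all faces trivial is determined by its label \<open>a\<close> of \<open>{..n}\<close>, which can be any
  point such that the \<open>n\<close>-cube with last vertex \<open>a\<close> and all others \<open>x0\<close> lies in \<open>X\<close>.  So both
  groups are quotients of the same set of points, and in both cases the relation and the
  product can be read off cubes in which only two or four values differ from \<open>x0\<close>.
\<close>

text \<open>The workhorse is a subdivided cube: if values on a grid with three points per direction
  are such that every small cube around the centre lies in \<open>X\<close>, then the outermost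
  values form a cube. Suitable grids yield symmetry and transitivity of \<open>rel\<close>, the
  comparison of two fillings of a corner, and the reduction of degenerable cubes.

  The obstacle is that a coordinate of a formal cube sits in the gap between two neighbouring
  labels, may change only these two, and cannot make both disappear. Hence removing an inner element
  of \<open>T\<close> takes two coordinates, an end element one, and the relation between the labels
  of \<open>T\<close> and \<open>T - {p}\<close> has a strength, \<open>wt T p\<close>. Exchanging
  \<open>p\<close> for its neighbour \<open>q\<close> means obtaining one edge of a square from the
  other three, which works only if none of these is weaker. This is why elements are moved towards
  \<open>k\<close>: their new place is then never an end of \<open>{..n}\<close>.

  Parity classes are used because every gap of \<open>{..n}\<close> touches exactly one of their
  elements: the condition is a cube of full dimension \<open>n\<close> in which, after exchanging
  presence and absence of some elements, the open label is the last vertex alone.\<close>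

section \<open>Cubes with Boolean coordinates\<close>

text \<open>The possible coordinates of a map in the cube category, with 0 and 1 read as truth values.\<close>

definition lit :: "(('i \<Rightarrow> bool) \<Rightarrow> bool) \<Rightarrow> bool" where
  "lit h \<longleftrightarrow> (\<exists>b. h = (\<lambda>_. b)) \<or> (\<exists>j. h = (\<lambda>z. z j)) \<or> (\<exists>j. h = (\<lambda>z. \<not> z j))"

lemma lit_const [simp]: "lit (\<lambda>_. b)"
  unfolding lit_def by (intro disjI1 exI[of _ b] refl)

lemma lit_coord [simp]: "lit (\<lambda>z. z j)"
  unfolding lit_def by (rule disjI2, rule disjI1, rule exI[of _ j], rule refl)

lemma lit_neg [simp]: "lit (\<lambda>z. \<not> z j)"
  unfolding lit_def by (rule disjI2, rule disjI2, rule exI[of _ j], rule refl)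

lemma lit_cases [consumes 1, case_names const coord neg]:
  assumes "lit h"
  obtains b where "h = (\<lambda>_. b)" | j where "h = (\<lambda>z. z j)" | j where "h = (\<lambda>z. \<not> z j)"
  using assms unfolding lit_def by (elim disjE exE)

lemma lit_not: "lit h \<Longrightarrow> lit (\<lambda>z. \<not> h z)"
  by (erule lit_cases) (simp_all only: lit_const lit_coord lit_neg not_not)

lemma lit_comp: "lit h \<Longrightarrow> (\<And>i. lit (s i)) \<Longrightarrow> lit (\<lambda>z. h (\<lambda>i. s i z))"
  by (erule lit_cases) (simp_all add: lit_not)

lemma lit_if: "(c \<Longrightarrow> lit h) \<Longrightarrow> (\<not> c \<Longrightarrow> lit h') \<Longrightarrow> lit (\<lambda>z. if c then h z else h' z)"
  by (cases c) auto

lemma lit_conj [simp]: "lit h \<Longrightarrow> lit (\<lambda>z. c \<and> h z)" "lit h \<Longrightarrow> lit (\<lambda>z. h z \<and> c)"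
  by (cases c; simp)+

lemma lit_imp [simp]: "lit h \<Longrightarrow> lit (\<lambda>z. c \<longrightarrow> h z)"
  by (cases c) auto

text \<open>The literals \<open>h i\<close> play the part of a map of the cube category into the
  n-cube, so that \<open>g\<close> is the pullback of \<open>p\<close> along it. The type
  \<open>'i\<close> may be infinite, since only \<open>h i\<close> with \<open>i < n\<close> is
  evaluated.\<close>

definition represents ::
  "'a cubeset \<Rightarrow> nat \<Rightarrow> ((nat \<Rightarrow> int) \<Rightarrow> 'a) \<Rightarrow> (nat \<Rightarrow> ('i \<Rightarrow> bool) \<Rightarrow> bool) \<Rightarrow> (('i \<Rightarrow> bool) \<Rightarrow> 'a) \<Rightarrow> bool" where
  "represents X n p h g \<longleftrightarrow> is_cube X n p \<and> (\<forall>i. lit (h i)) \<and>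
     (\<forall>z. g z = p (\<lambda>i\<in>{..<n}. of_bool (h i z)))"

text \<open>Cubes are handled as functions of Boolean coordinates indexed by an arbitrary type; only finitely
  many coordinates matter, and relabelling them needs no renumbering.\<close>

definition cubic :: "'a cubeset \<Rightarrow> (('i \<Rightarrow> bool) \<Rightarrow> 'a) \<Rightarrow> bool" where
  "cubic X g \<longleftrightarrow> (\<exists>n p h. represents X n p h g)"

lemma representsD:
  assumes "represents X n p h g"
  shows "is_cube X n p" "lit (h i)" "g z = p (\<lambda>i\<in>{..<n}. of_bool (h i z))"
  using assms by (simp_all only: represents_def)

definition supported :: "'i set \<Rightarrow> (('i \<Rightarrow> bool) \<Rightarrow> 'b) \<Rightarrow> bool" where
  "supported J g \<longleftrightarrow> (\<forall>z z'. (\<forall>j\<in>J. z j = z' j) \<longrightarrow> g z = g z')"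

lemma supportedD: "supported J g \<Longrightarrow> (\<And>j. j \<in> J \<Longrightarrow> z j = z' j) \<Longrightarrow> g z = g z'"
  unfolding supported_def by blast

lemma is_cube_cong: "(\<And>v. v \<in> cube n \<Longrightarrow> p v = q v) \<Longrightarrow> is_cube X n p \<longleftrightarrow> is_cube X n q"
  unfolding is_cube_def by simp

lemma cube_0: "cube 0 = {\<lambda>_. undefined}"
  by (simp add: cube_def)

lemma point_map: "v \<in> cube n \<Longrightarrow> (\<lambda>u\<in>cube 0. v) \<in> cube_maps 0 n"
  unfolding cube_maps_def by (auto intro!: exI[of _ v])

lemma id_map: "(\<lambda>x\<in>cube n. x) \<in> cube_maps n n"
proof -
  have "\<forall>x\<in>cube n. \<forall>i<n. x i = 0 + (\<Sum>j<n. (if i = j then 1 else 0) * x j)"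
    by (auto simp: if_distrib[of "\<lambda>t. t * _"] sum.delta cong: if_cong)
  then show ?thesis
    unfolding cube_maps_def
    by (auto intro!: exI[of _ "\<lambda>i j. if i = j then 1 else 0"] exI[of _ "\<lambda>_. 0"])
qed

text \<open>Literals are the 0/1-valued affine functions b, x j and 1 - x j. A literal may mention a
  coordinate outside the n-cube; the guard \<open>j < n\<close> reads such a coordinate as
  false.\<close>

lemma lit_map:
  assumes "\<And>i. lit (h i)"
  shows "(\<lambda>v\<in>cube n. \<lambda>i\<in>{..<m}. of_bool (h i (\<lambda>j. j < n \<and> v j = 1))) \<in> cube_maps n m"
proof -
  have "\<exists>a b. \<forall>x\<in>cube n. of_bool (h i (\<lambda>j. j < n \<and> x j = 1)) = b + (\<Sum>j<n. a j * x j)" for i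
  proof -
    have bit: "x j = 0 \<or> x j = 1" if "x \<in> cube n" "j < n" for x j
      using that by (auto simp: cube_def)
    show ?thesis using assms[of i]
    proof (cases rule: lit_cases)
      case (const b)
      then show ?thesis by (intro exI[of _ "\<lambda>_. 0"] exI[of _ "of_bool b"]) auto
    next
      case (coord j)
      have "of_bool (j < n \<and> x j = 1) = 0 + (\<Sum>k<n. (if k = j then 1 else 0) * x k)"
        if "x \<in> cube n" for x
        using bit[OF that, of j]
        by (auto simp: if_distrib[of "\<lambda>t. t * _"] sum.delta' sum.delta cong: if_cong)
      then show ?thesis using coord
        by (intro exI[of _ "\<lambda>k. if k = j then 1 else 0"] exI[of _ 0]) auto
    next
      case (neg j)
      have "of_bool (\<not> (j < n \<and> x j = 1)) = 1 + (\<Sum>k<n. (if k = j then -1 else 0) * x k)"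
        if "x \<in> cube n" for x
        using bit[OF that, of j]
        by (auto simp: if_distrib[of "\<lambda>t. t * _"] sum.delta' sum.delta cong: if_cong)
      then show ?thesis using neg
        by (intro exI[of _ "\<lambda>k. if k = j then -1 else 0"] exI[of _ 1]) auto
    qed
  qed
  then obtain a b where "\<And>i. \<forall>x\<in>cube n. of_bool (h i (\<lambda>j. j < n \<and> x j = 1)) = b i + (\<Sum>j<n. a i j * x j)"
    by metis
  then show ?thesis unfolding cube_maps_def
    by (auto simp: cube_def intro!: exI[of _ a] exI[of _ b])
qed

lemma compose_cube_maps:
  assumes cmp: "\<phi> \<in> cube_maps m k" "\<psi> \<in> cube_maps l m"
  shows "compose (cube l) \<phi> \<psi> \<in> cube_maps l k"
proof -
  obtain a b where 1: "\<forall>x\<in>cube m. \<forall>i<k. \<phi> x i = b i + (\<Sum>j<m. a i j * x j)"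
    using cmp(1) by (auto simp: cube_maps_def)
  obtain a' b' where 2: "\<forall>x\<in>cube l. \<forall>i<m. \<psi> x i = b' i + (\<Sum>j<l. a' i j * x j)"
    using cmp(2) by (auto simp: cube_maps_def)
  have mem: "\<phi> \<in> cube m \<rightarrow> cube k" "\<psi> \<in> cube l \<rightarrow> cube m" using cmp by (auto simp: cube_maps_def)
  have "compose (cube l) \<phi> \<psi> x i = (b i + (\<Sum>j<m. a i j * b' j)) + (\<Sum>j<l. (\<Sum>t<m. a i t * a' t j) * x j)"
    if "x \<in> cube l" "i < k" for x i
  proof -
    have "\<psi> x \<in> cube m" using mem that by blast
    then have "compose (cube l) \<phi> \<psi> x i = b i + (\<Sum>t<m. a i t * (b' t + (\<Sum>j<l. a' t j * x j)))"
      using that 1 2 by (simp add: compose_def)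
    also have "\<dots> = b i + (\<Sum>t<m. a i t * b' t) + (\<Sum>t<m. \<Sum>j<l. a i t * a' t j * x j)"
      by (simp add: distrib_left sum.distrib sum_distrib_left mult.assoc)
    also have "(\<Sum>t<m. \<Sum>j<l. a i t * a' t j * x j) = (\<Sum>j<l. (\<Sum>t<m. a i t * a' t j) * x j)"
      by (subst sum.swap) (simp add: sum_distrib_right)
    finally show ?thesis .
  qed
  moreover have "compose (cube l) \<phi> \<psi> \<in> cube l \<rightarrow>\<^sub>E cube k"
    using mem by (auto simp: compose_def)
  ultimately show ?thesis unfolding cube_maps_def
    by (intro CollectI conjI exI[of _ "\<lambda>i j. \<Sum>t<m. a i t * a' t j"] exI[of _ "\<lambda>i. b i + (\<Sum>j<m. a i j * b' j)"]) auto
qed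

section \<open>Concrete fibrant cubesets: sections as configurations of vertices, and corner
  filling\<close>

locale cfcubeset =
  fixes X :: "'a cubeset"
  assumes cf: "concrete_fibrant X"
begin

abbreviation cub :: "(('i \<Rightarrow> bool) \<Rightarrow> 'a) \<Rightarrow> bool" where "cub \<equiv> cubic X"

lemma cs: "cubeset X" and conc: "concrete X" and fib: "fibrant X"
  using cf by (auto simp: concrete_fibrant_def)

lemma restr_in: "\<phi> \<in> cube_maps m n \<Longrightarrow> c \<in> sections X n \<Longrightarrow> restr X m n \<phi> c \<in> sections X m"
  using cs unfolding presheaf_def by blast

lemma restr_id: "c \<in> sections X n \<Longrightarrow> restr X n n (\<lambda>p\<in>cube n. p) c = c"
  using cs unfolding presheaf_def by blast

lemma restr_comp: "\<psi> \<in> cube_maps l m \<Longrightarrow> \<phi> \<in> cube_maps m n \<Longrightarrow> c \<in> sections X n \<Longrightarrow>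
   restr X l n (compose (cube l) \<phi> \<psi>) c = restr X l m \<psi> (restr X m n \<phi> c)"
  using cs unfolding presheaf_def by blast

lemma vert_restr:
  assumes "\<phi> \<in> cube_maps m n" "c \<in> sections X n" "v \<in> cube m"
  shows "vert X m (restr X m n \<phi> c) v = vert X n c (\<phi> v)"
proof -
  have "compose (cube 0) \<phi> (\<lambda>u\<in>cube 0. v) = (\<lambda>u\<in>cube 0. \<phi> v)"
    by (auto simp: compose_def)
  then show ?thesis
    using restr_comp[OF point_map[OF assms(3)] assms(1,2)] by (simp add: vert_def)
qed

lemma vert_in: "c \<in> sections X n \<Longrightarrow> v \<in> cube n \<Longrightarrow> vert X n c v \<in> sections X 0"
  unfolding vert_def by (intro restr_in point_map)

lemma section_eqI:
  assumes "c \<in> sections X n" "d \<in> sections X n" "\<And>v. v \<in> cube n \<Longrightarrow> vert X n c v = vert X n d v"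
  shows "c = d"
proof (rule inj_onD[OF conc[unfolded concrete_def, rule_format, of n]])
  show "(\<lambda>v\<in>cube n. vert X n c v) = (\<lambda>v\<in>cube n. vert X n d v)"
    using assms(3) by (auto simp: restrict_def)
qed (use assms in auto)

lemma vert_0: "c \<in> sections X 0 \<Longrightarrow> u \<in> cube 0 \<Longrightarrow> vert X 0 c u = c"
proof -
  assume a: "c \<in> sections X 0" "u \<in> cube 0"
  then have "(\<lambda>_\<in>cube 0. u) = (\<lambda>p\<in>cube 0. p)" by (auto simp: cube_0)
  then show ?thesis using restr_id[OF a(1)] by (simp add: vert_def)
qed

lemma is_cube_comp:
  assumes "is_cube X m p" "\<phi> \<in> cube_maps n m"
  shows "is_cube X n (\<lambda>v. p (\<phi> v))"
proof -
  obtain c where c: "c \<in> sections X m" "\<forall>v\<in>cube m. vert X m c v = p v"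
    using assms(1) by (auto simp: is_cube_def)
  have "\<phi> v \<in> cube m" if "v \<in> cube n" for v
    using assms(2) that by (auto simp: cube_maps_def)
  then show ?thesis unfolding is_cube_def
    using c assms(2) by (intro bexI[of _ "restr X n m \<phi> c"]) (auto simp: vert_restr restr_in)
qed

lemma is_cube_in: "is_cube X n p \<Longrightarrow> v \<in> cube n \<Longrightarrow> p v \<in> sections X 0"
  unfolding is_cube_def using vert_in by metis

lemma is_cube_0: "is_cube X 0 p \<longleftrightarrow> p (\<lambda>_. undefined) \<in> sections X 0"
  unfolding is_cube_def using vert_0 by (auto simp: cube_0)

text \<open>Fibrancy speaks of presheaf maps out of the corner. A configuration that is a cube on
  every face [x_j = 0] defines such a map by choosing sections; concreteness makes them unique, so
  naturality can be tested at the vertices.\<close>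

lemma corner_is_cube:
  assumes n: "1 \<le> n" and faces: "\<And>j. j < n \<Longrightarrow> is_cube X n (\<lambda>v. p (v(j := 0)))"
  shows "\<exists>q. is_cube X n q \<and> (\<forall>v\<in>cube n. (\<exists>j<n. v j = 0) \<longrightarrow> q v = p v)"
proof -
  define P where "P m \<phi> c \<longleftrightarrow> c \<in> sections X m \<and> (\<forall>x\<in>cube m. vert X m c x = p (\<phi> x))" for m \<phi> c
  have ex: "\<exists>c. P m \<phi> c" if \<phi>: "\<phi> \<in> sections (corner n) m" for m \<phi>
  proof -
    obtain j where j: "\<phi> \<in> cube_maps m n" "j < n" "\<forall>x\<in>cube m. \<phi> x j = 0"
      using \<phi> by (auto simp: corner_def)
    have "is_cube X m (\<lambda>v. p ((\<phi> v)(j := 0)))"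
      using is_cube_comp[OF faces[OF j(2)] j(1)] .
    moreover have "(\<phi> v)(j := 0) = \<phi> v" if "v \<in> cube m" for v
      using j(3) that by (auto simp: fun_upd_idem)
    ultimately show ?thesis by (auto simp: P_def is_cube_def)
  qed
  define f where "f m = (\<lambda>\<phi>\<in>sections (corner n) m. SOME c. P m \<phi> c)" for m
  have fP: "P m \<phi> (f m \<phi>)" if "\<phi> \<in> sections (corner n) m" for m \<phi>
    using someI_ex[OF ex[OF that]] that by (simp add: f_def)
  have "f \<in> cubeset_hom (corner n) X"
    unfolding psh_hom_def
  proof (intro CollectI conjI allI ballI)
    fix m show "f m \<in> sections (corner n) m \<rightarrow>\<^sub>E sections X m"
    proof (rule PiE_I)
      show "f m x \<in> sections X m" if "x \<in> sections (corner n) m" for x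
        using fP[OF that] by (simp add: P_def)
    qed (simp add: f_def)
  next
    fix l m \<psi> \<phi> assume \<psi>: "\<psi> \<in> cube_maps l m" and \<phi>: "\<phi> \<in> sections (corner n) m"
    have c: "compose (cube l) \<phi> \<psi> \<in> sections (corner n) l"
    proof -
      obtain j where j: "\<phi> \<in> cube_maps m n" "j < n" "\<forall>x\<in>cube m. \<phi> x j = 0"
        using \<phi> by (auto simp: corner_def)
      have "compose (cube l) \<phi> \<psi> x j = 0" if "x \<in> cube l" for x
        using j(3) \<psi> that by (auto simp: compose_def cube_maps_def)
      then show ?thesis using compose_cube_maps[OF j(1) \<psi>] j(2) by (auto simp: corner_def)
    qed
    have "f l (compose (cube l) \<phi> \<psi>) = restr X l m \<psi> (f m \<phi>)"
    proof (rule section_eqI)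
      show "f l (compose (cube l) \<phi> \<psi>) \<in> sections X l" using fP[OF c] by (simp add: P_def)
      show "restr X l m \<psi> (f m \<phi>) \<in> sections X l" using fP[OF \<phi>] \<psi> by (simp add: P_def restr_in)
      fix v assume "v \<in> cube l"
      moreover have "\<psi> v \<in> cube m" using \<psi> \<open>v \<in> cube l\<close> by (auto simp: cube_maps_def)
      ultimately show "vert X l (f l (compose (cube l) \<phi> \<psi>)) v = vert X l (restr X l m \<psi> (f m \<phi>)) v"
        using fP[OF c] fP[OF \<phi>] \<psi> by (auto simp: P_def vert_restr compose_def)
    qed
    then show "f l (restr (corner n) l m \<psi> \<phi>) = restr X l m \<psi> (f m \<phi>)"
      by (simp add: corner_def representable_def)
  qed
  then obtain g where g: "g \<in> cubeset_hom (std_cube n) X"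
      "\<And>m c. c \<in> sections (corner n) m \<Longrightarrow> g m c = f m c"
    using fib[unfolded fibrant_def extends_along_def, rule_format, OF n] by metis
  \<comment> \<open>By Yoneda the extension is given by a single section, its value at the identity
    of the n-cube.\<close>
  define c where "c = g n (\<lambda>x\<in>cube n. x)"
  have ids: "(\<lambda>x\<in>cube n. x) \<in> sections (std_cube n) n" by (simp add: representable_def id_map)
  have c: "c \<in> sections X n" using g(1) ids unfolding c_def psh_hom_def by auto
  have "vert X n c v = p v" if v: "v \<in> cube n" "j < n" "v j = 0" for v j
  proof -
    have \<phi>: "(\<lambda>u\<in>cube 0. v) \<in> sections (corner n) 0"
      using v by (auto simp: corner_def point_map)
    have "vert X n c v = g 0 (restr (std_cube n) 0 n (\<lambda>u\<in>cube 0. v) (\<lambda>x\<in>cube n. x))"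
      using g(1) ids point_map[OF v(1)] unfolding c_def vert_def psh_hom_def by auto
    also have "restr (std_cube n) 0 n (\<lambda>u\<in>cube 0. v) (\<lambda>x\<in>cube n. x) = (\<lambda>u\<in>cube 0. v)"
      using v by (auto simp: representable_def compose_def)
    also have "g 0 (\<lambda>u\<in>cube 0. v) = f 0 (\<lambda>u\<in>cube 0. v)" using g(2)[OF \<phi>] .
    also have "\<dots> = p v" using fP[OF \<phi>] vert_0[of "f 0 (\<lambda>u\<in>cube 0. v)"] by (auto simp: P_def cube_0 restrict_def)
    finally show ?thesis .
  qed
  then show ?thesis using c by (intro exI[of _ "vert X n c"]) (auto simp: is_cube_def)
qed

end

lemma is_cube_cubic:
  assumes "is_cube X n p" "\<And>i. lit (h i)"
  shows "cubic X (\<lambda>z. p (\<lambda>i\<in>{..<n}. of_bool (h i z)))"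
  unfolding cubic_def represents_def
proof (intro exI conjI allI)
  show "is_cube X n p" by fact
  show "lit (h i)" for i by fact
qed (rule refl)

context cfcubeset
begin

lemma cub_subst:
  assumes "cub g" "\<And>i. lit (s i)"
  shows "cub (\<lambda>z. g (\<lambda>i. s i z))"
proof -
  obtain n p h where r: "represents X n p h g"
    using assms(1) unfolding cubic_def by blast
  note g = representsD[OF r]
  show ?thesis unfolding cubic_def represents_def
  proof (intro exI conjI allI)
    show "is_cube X n p" by fact
    show "lit (\<lambda>z. h i (\<lambda>j. s j z))" for i by (rule lit_comp[OF g(2) assms(2)])
    show "g (\<lambda>i. s i z) = p (\<lambda>i\<in>{..<n}. of_bool (h i (\<lambda>j. s j z)))" for z by (rule g(3))
  qed
qed

lemma cub_is_cube:
  assumes "cub (g :: (nat \<Rightarrow> bool) \<Rightarrow> 'a)"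
  shows "is_cube X n (\<lambda>v. g (\<lambda>i. i < n \<and> v i = 1))"
proof -
  obtain m p h where r: "represents X m p h g"
    using assms(1) unfolding cubic_def by blast
  note g = representsD[OF r]
  show ?thesis using is_cube_comp[OF g(1) lit_map[OF g(2)], of n]
    by (rule iffD1[OF is_cube_cong, rotated]) (simp add: g(3))
qed

lemma cub_const: "x \<in> sections X 0 \<Longrightarrow> cub (\<lambda>_. x)"
  using is_cube_cubic[of X 0 "\<lambda>_. x" "\<lambda>_ _. True"] by (simp add: is_cube_0)

lemma cub_in:
  assumes "cub g" shows "g z \<in> sections X 0"
proof -
  obtain n p h where r: "represents X n p h g"
    using assms unfolding cubic_def by blast
  note g = representsD[OF r]
  show ?thesis unfolding g(3) by (rule is_cube_in[OF g(1)]) (auto simp: cube_def)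
qed

lemma cub_support:
  fixes g :: "('i \<Rightarrow> bool) \<Rightarrow> 'a"
  assumes "cub g" obtains J where "finite J" "supported J g"
proof -
  obtain n p h where r: "represents X n p h g"
    using assms unfolding cubic_def by blast
  note g = representsD[OF r]
  have "\<exists>J. finite J \<and> supported J (h i)" for i
    using g(2)[of i]
  proof (cases rule: lit_cases)
    case (const b)
    then show ?thesis by (intro exI[of _ "{}"]) (simp add: supported_def)
  next
    case (coord j)
    then show ?thesis by (intro exI[of _ "{j}"]) (simp add: supported_def)
  next
    case (neg j)
    then show ?thesis by (intro exI[of _ "{j}"]) (simp add: supported_def)
  qed
  then obtain J where J: "\<And>i. finite (J i)" "\<And>i. supported (J i) (h i)" by metis
  show thesis
  proof
    show "finite (\<Union>i<n. J i)" using J by auto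
    show "supported (\<Union>i<n. J i) g"
      unfolding supported_def g(3)
    proof (intro allI impI arg_cong[where f = p] restrict_ext)
      fix z z' :: "'i \<Rightarrow> bool" and i assume "\<forall>j\<in>\<Union>i<n. J i. z j = z' j" "i \<in> {..<n}"
      then show "of_bool (h i z) = of_bool (h i z')"
        using supportedD[OF J(2)[of i], of z z'] by auto
    qed
  qed
qed

section \<open>Extension over faces, gluing and subdivision of Boolean cubes\<close>

lemma corner_cub:
  assumes I: "finite I" "I \<noteq> {}" and g: "supported I g" "\<And>i. i \<in> I \<Longrightarrow> cub (\<lambda>z. g (z(i := False)))"
  shows "\<exists>g'. cub g' \<and> (\<forall>z. (\<exists>i\<in>I. \<not> z i) \<longrightarrow> g' z = g z)"
proof -
  define n where "n = card I"
  have n: "1 \<le> n" using I by (simp add: n_def Suc_leI card_gt_0_iff)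
  obtain e where e: "bij_betw e {..<n} I"
    using ex_bij_betw_nat_finite[OF I(1)] unfolding n_def atLeast0LessThan by blast
  define d where "d = inv_into {..<n} e"
  have de: "d (e k) = k" if "k < n" for k
    using e that by (simp add: d_def bij_betw_def inv_into_f_f)
  have ed: "e (d i) = i" "d i < n" if "i \<in> I" for i
    using e that unfolding d_def by (auto simp: bij_betw_def f_inv_into_f intro: inv_into_into[of _ e "{..<n}", simplified])
  define p where "p v = g (\<lambda>i. i \<in> I \<and> v (d i) = (1::int))" for v
  have "is_cube X n (\<lambda>v. p (v(j := 0)))" if j: "j < n" for j
  proof -
    have "e j \<in> I" using e j by (auto simp: bij_betw_def)
    then have "cub (\<lambda>w :: nat \<Rightarrow> bool. g ((\<lambda>i. i \<in> I \<and> w (d i))(e j := False)))"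
      using cub_subst[OF g(2)[of "e j"], of "\<lambda>i w. i \<in> I \<and> w (d i)"] by simp
    from cub_is_cube[OF this, of n] show ?thesis
    proof (rule iffD1[OF is_cube_cong, rotated])
      fix v :: "nat \<Rightarrow> int"
      have "(\<lambda>i. i \<in> I \<and> d i < n \<and> v (d i) = 1)(e j := False) = (\<lambda>i. i \<in> I \<and> (v(j := 0)) (d i) = 1)"
        using ed de j by (auto simp: fun_eq_iff)
      then show "g ((\<lambda>i. i \<in> I \<and> d i < n \<and> v (d i) = 1)(e j := False)) = p (v(j := 0))"
        by (simp add: p_def)
    qed
  qed
  from corner_is_cube[OF n this] obtain q where q: "is_cube X n q"
      "\<And>v. v \<in> cube n \<Longrightarrow> \<exists>j<n. v j = 0 \<Longrightarrow> q v = p v" by metis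
  show ?thesis
  proof (intro exI conjI allI impI)
    show "cub (\<lambda>z. q (\<lambda>k\<in>{..<n}. of_bool (z (e k))))" by (rule is_cube_cubic[OF q(1)]) simp
    fix z assume "\<exists>i\<in>I. \<not> z i"
    then obtain i where i: "i \<in> I" "\<not> z i" by blast
    have "q (\<lambda>k\<in>{..<n}. of_bool (z (e k))) = p (\<lambda>k\<in>{..<n}. of_bool (z (e k)))"
    proof (rule q(2))
      show "(\<lambda>k\<in>{..<n}. of_bool (z (e k))) \<in> cube n" by (auto simp: cube_def)
      show "\<exists>j<n. (\<lambda>k\<in>{..<n}. of_bool (z (e k))) j = (0::int)"
        using i ed[OF i(1)] by (intro exI[of _ "d i"]) auto
    qed
    also have "\<dots> = g z" unfolding p_def
      by (rule supportedD[OF g(1)]) (use ed in auto)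
    finally show "q (\<lambda>k\<in>{..<n}. of_bool (z (e k))) = g z" .
  qed
qed

text \<open>Extension face by face: a smallest \<open>V\<close> outside \<open>D\<close> has all its
  proper subsets in \<open>D\<close>, so the corner below it is given and can be filled. Then
  \<open>V\<close> joins \<open>D\<close>.\<close>

lemma downset_extension:
  assumes I: "finite I" and D: "D \<subseteq> Pow I" "{} \<in> D" "\<And>U V. V \<in> D \<Longrightarrow> U \<subseteq> V \<Longrightarrow> U \<in> D"
    and g: "\<And>V. V \<in> D \<Longrightarrow> cub (\<lambda>z. g (\<lambda>i. z i \<and> i \<in> V))"
  shows "\<exists>g'. cub g' \<and> (\<forall>V\<in>D. g' (\<lambda>i. i \<in> V) = g (\<lambda>i. i \<in> V))"
  using D g
proof (induction "card (Pow I - D)" arbitrary: D g rule: less_induct)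
  case less
  have fin: "finite (Pow I - D)" using I by simp
  show ?case
  proof (cases "I \<in> D")
    case True
    then show ?thesis using less.prems(1) less.prems(4)[OF True]
      by (intro exI[of _ "\<lambda>z. g (\<lambda>i. z i \<and> i \<in> I)"]) (auto intro!: arg_cong[where f = g])
  next
    case False
    then have "Pow I - D \<noteq> {}" by auto
    then obtain V where V: "V \<in> Pow I - D" "\<And>U. U \<in> Pow I - D \<Longrightarrow> card V \<le> card U"
      using ex_has_least_nat[of "\<lambda>U. U \<in> Pow I - D" _ card] by (metis ex_in_conv)
    have VI: "V \<subseteq> I" "V \<notin> D" "finite V" "V \<noteq> {}"
      using V(1) less.prems(2) I by (auto intro: finite_subset)
    have sub: "U \<in> D" if "U \<subset> V" for U
    proof (rule ccontr)
      assume "U \<notin> D"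
      then have "card V \<le> card U" using that VI by (intro V(2)) auto
      then show False using psubset_card_mono[OF VI(3) that] by simp
    qed
    have "\<exists>h. cub h \<and> (\<forall>z. (\<exists>i\<in>V. \<not> z i) \<longrightarrow> h z = g (\<lambda>i. z i \<and> i \<in> V))"
    proof (rule corner_cub[OF VI(3,4)])
      show "supported V (\<lambda>z. g (\<lambda>i. z i \<and> i \<in> V))"
        unfolding supported_def by (auto intro!: arg_cong[where f = g])
      fix i assume i: "i \<in> V"
      have "cub (\<lambda>z. g (\<lambda>j. z j \<and> j \<in> V - {i}))" using i by (intro less.prems(4) sub) auto
      moreover have "(\<lambda>j. z j \<and> j \<in> V - {i}) = (\<lambda>j. (z(i := False)) j \<and> j \<in> V)" for z by auto
      ultimately show "cub (\<lambda>z. g (\<lambda>j. (z(i := False)) j \<and> j \<in> V))" by simp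
    qed
    then obtain h where h: "cub h" "\<And>z. \<exists>i\<in>V. \<not> z i \<Longrightarrow> h z = g (\<lambda>i. z i \<and> i \<in> V)" by blast
    \<comment> \<open>Only the value at the vertex \<open>V\<close> changes. No face in
      \<open>D\<close> contains this vertex, so the cubes already present are untouched.\<close>
    define k where "k = g((\<lambda>i. i \<in> V) := h (\<lambda>i. i \<in> V))"
    have kD: "k (\<lambda>i. z i \<and> i \<in> U) = g (\<lambda>i. z i \<and> i \<in> U)" if "U \<in> D" for z U
    proof -
      have "(\<lambda>i. z i \<and> i \<in> U) \<noteq> (\<lambda>i. i \<in> V)"
      proof
        assume a: "(\<lambda>i. z i \<and> i \<in> U) = (\<lambda>i. i \<in> V)"
        have "V \<subseteq> U" using fun_cong[OF a] by auto
        then show False using less.prems(3)[OF that] VI by auto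
      qed
      then show ?thesis by (simp add: k_def)
    qed
    have kV: "k (\<lambda>i. z i \<and> i \<in> V) = h (\<lambda>i. z i \<and> i \<in> V)" for z
    proof (cases "\<forall>i\<in>V. z i")
      case True
      then have "(\<lambda>i. z i \<and> i \<in> V) = (\<lambda>i. i \<in> V)" by auto
      then show ?thesis by (simp add: k_def)
    next
      case False
      then have "(\<lambda>i. z i \<and> i \<in> V) \<noteq> (\<lambda>i. i \<in> V)" by (metis (full_types))
      moreover have "h (\<lambda>i. z i \<and> i \<in> V) = g (\<lambda>i. z i \<and> i \<in> V)"
        using h(2)[of "\<lambda>i. z i \<and> i \<in> V"] False by auto
      ultimately show ?thesis by (simp add: k_def)
    qed
    have "\<exists>g'. cub g' \<and> (\<forall>U\<in>insert V D. g' (\<lambda>i. i \<in> U) = k (\<lambda>i. i \<in> U))"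
    proof (rule less.hyps)
      show "card (Pow I - insert V D) < card (Pow I - D)"
        using V(1) by (intro psubset_card_mono fin) auto
      show "insert V D \<subseteq> Pow I" "{} \<in> insert V D" using less.prems VI by auto
      show "U \<in> insert V D" if "W \<in> insert V D" "U \<subseteq> W" for U W
        using that sub[of U] less.prems(3)[of W U] by blast
      show "cub (\<lambda>z. k (\<lambda>i. z i \<and> i \<in> U))" if "U \<in> insert V D" for U
      proof (cases "U = V")
        case True
        show ?thesis unfolding True kV by (rule cub_subst[OF h(1)]) simp
      next
        case False
        then show ?thesis using that less.prems(4)[of U] by (simp add: kD)
      qed
    qed
    moreover have "k (\<lambda>i. i \<in> U) = g (\<lambda>i. i \<in> U)" if "U \<in> D" for U
      using kD[OF that, of "\<lambda>_. True"] by simp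
    ultimately show ?thesis by auto
  qed
qed

text \<open>Direction \<open>i\<close> is split into two coordinates, \<open>Some i\<close> for
  \<open>g1\<close> and \<open>None\<close> for \<open>g2\<close>; the common face is where both are
  false. The two cubes live on a downset of sets that never contain both. After the extension the
  opposite faces are read off by setting \<open>Some i\<close> to \<open>z i\<close> and
  \<open>None\<close> to its negation.\<close>

lemma glue:
  assumes g: "cub g1" "cub g2" and eq: "\<And>z. g1 (z(i := False)) = g2 (z(i := False))"
  shows "cub (\<lambda>z. if z i then g1 (z(i := True)) else g2 (z(i := True)))"
proof -
  obtain J1 where J1: "finite J1" "supported J1 g1" using cub_support[OF g(1)] .
  obtain J2 where J2: "finite J2" "supported J2 g2" using cub_support[OF g(2)] .
  define J where "J = insert i (J1 \<union> J2)"
  define I where "I = insert None (Some ` J)"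
  define D where "D = {V \<in> Pow I. \<not> (None \<in> V \<and> Some i \<in> V)}"
  define G where "G z = (if z None then g2 ((\<lambda>j. z (Some j))(i := True)) else g1 (\<lambda>j. z (Some j)))" for z
  have "\<exists>G'. cub G' \<and> (\<forall>V\<in>D. G' (\<lambda>i. i \<in> V) = G (\<lambda>i. i \<in> V))"
  proof (rule downset_extension)
    show "finite I" using J1 J2 by (simp add: I_def J_def)
    show "D \<subseteq> Pow I" "{} \<in> D" by (auto simp: D_def)
    show "U \<in> D" if "V \<in> D" "U \<subseteq> V" for U V using that by (auto simp: D_def)
    fix V assume V: "V \<in> D"
    show "cub (\<lambda>z. G (\<lambda>i. z i \<and> i \<in> V))"
    proof (cases "None \<in> V")
      case True
      then have i: "Some i \<notin> V" using V by (auto simp: D_def)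
      have "G (\<lambda>i. z i \<and> i \<in> V) = g2 (\<lambda>j. if j = i then z None else z (Some j) \<and> Some j \<in> V)" for z
      proof (cases "z None")
        case zN: True
        then have "(\<lambda>j. z (Some j) \<and> Some j \<in> V)(i := True) = (\<lambda>j. if j = i then z None else z (Some j) \<and> Some j \<in> V)"
          by auto
        then show ?thesis using True zN by (simp add: G_def)
      next
        case zN: False
        have "(\<lambda>j. z (Some j) \<and> Some j \<in> V) = (\<lambda>j. z (Some j) \<and> Some j \<in> V)(i := False)"
          using i by (simp add: fun_eq_iff)
        then have "g1 (\<lambda>j. z (Some j) \<and> Some j \<in> V) = g2 ((\<lambda>j. z (Some j) \<and> Some j \<in> V)(i := False))"
          using eq by metis
        also have "(\<lambda>j. z (Some j) \<and> Some j \<in> V)(i := False) = (\<lambda>j. if j = i then z None else z (Some j) \<and> Some j \<in> V)"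
          using zN by auto
        finally show ?thesis using zN by (simp add: G_def)
      qed
      moreover have "cub (\<lambda>z. g2 (\<lambda>j. if j = i then z None else z (Some j) \<and> Some j \<in> V))"
        by (rule cub_subst[OF g(2)], rule lit_if) simp_all
      ultimately show ?thesis by simp
    next
      case False
      then have "G (\<lambda>i. z i \<and> i \<in> V) = g1 (\<lambda>j. z (Some j) \<and> Some j \<in> V)" for z
        by (simp add: G_def)
      moreover have "cub (\<lambda>z. g1 (\<lambda>j. z (Some j) \<and> Some j \<in> V))"
        by (rule cub_subst[OF g(1)]) simp
      ultimately show ?thesis by simp
    qed
  qed
  then obtain G' where G': "cub G'" "\<And>V. V \<in> D \<Longrightarrow> G' (\<lambda>i. i \<in> V) = G (\<lambda>i. i \<in> V)" by blast
  \<comment> \<open>The conjunct \<open>j \<in> J\<close> keeps the chosen set inside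
    \<open>I\<close>, where \<open>D\<close> lives; values do not change because \<open>J\<close>
    supports both cubes.\<close>
  define s where "s k z = (case k of None \<Rightarrow> \<not> z i | Some j \<Rightarrow> z j \<and> j \<in> J)" for k z
  have "cub (\<lambda>z. G' (\<lambda>k. s k z))"
  proof (rule cub_subst[OF G'(1)])
    show "lit (\<lambda>z. s k z)" for k by (cases k) (simp_all add: s_def)
  qed
  moreover have "G' (\<lambda>k. s k z) = (if z i then g1 (z(i := True)) else g2 (z(i := True)))" for z
  proof -
    have "{k. s k z} \<in> D" by (auto simp: D_def s_def I_def J_def split: option.splits)
    from G'(2)[OF this] have "G' (\<lambda>k. s k z) = G (\<lambda>k. s k z)" by simp
    also have "\<dots> = (if z i then g1 (z(i := True)) else g2 (z(i := True)))"
      by (auto simp: G_def s_def J_def intro!: supportedD[OF J1(2)] supportedD[OF J2(2)] split: if_splits)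
    finally show ?thesis .
  qed
  ultimately show ?thesis by simp
qed

text \<open>Each coordinate of the cube is a path through a middle point \<open>None\<close>; the halves are glued there,
  one direction at a time.\<close>

lemma tricube:
  assumes M: "finite M"
    and W: "\<And>\<eta>. cub (\<lambda>z. W (\<lambda>i. if i \<in> M then (if z i then Some (\<eta> i) else None) else Some (z i)))"
  shows "cub (\<lambda>z. W (\<lambda>i. Some (z i)))"
  using M W
proof (induction M rule: finite_induct)
  case (insert k M)
  show ?case
  proof (rule insert.IH)
    fix \<eta>
    define g where "g \<eta> z = W (\<lambda>i. if i \<in> insert k M then (if z i then Some (\<eta> i) else None) else Some (z i))" for \<eta> z
    have "cub (\<lambda>z. if z k then g (\<eta>(k := True)) (z(k := True)) else g (\<eta>(k := False)) (z(k := True)))"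
    proof (rule glue)
      have "cub (\<lambda>z. g \<eta> z)" for \<eta> unfolding g_def by (rule insert.prems)
      then show "cub (g (\<eta>(k := True)))" "cub (g (\<eta>(k := False)))" by blast+
      show "g (\<eta>(k := True)) (z(k := False)) = g (\<eta>(k := False)) (z(k := False))" for z
        unfolding g_def by (rule arg_cong[where f = W]) auto
    qed
    moreover have "(if z k then g (\<eta>(k := True)) (z(k := True)) else g (\<eta>(k := False)) (z(k := True)))
       = W (\<lambda>i. if i \<in> M then (if z i then Some (\<eta> i) else None) else Some (z i))" for z
      unfolding g_def using insert.hyps by (auto intro!: arg_cong[where f = W])
    ultimately show "cub (\<lambda>z. W (\<lambda>i. if i \<in> M then (if z i then Some (\<eta> i) else None) else Some (z i)))"
      by simp
  qed
qed simp

end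

section \<open>Relations between parallel cubes\<close>

text \<open>The extra directions \<open>Inl k\<close> form a d-cube of copies of \<open>F\<close>
  with \<open>G\<close> at its last vertex. For \<open>d = 0\<close> only \<open>G\<close> is left,
  which is why most rules ask for \<open>1 \<le> d\<close>.\<close>

definition rel :: "'a cubeset \<Rightarrow> nat \<Rightarrow> (('i \<Rightarrow> bool) \<Rightarrow> 'a) \<Rightarrow> (('i \<Rightarrow> bool) \<Rightarrow> 'a) \<Rightarrow> bool" where
  "rel X d F G \<longleftrightarrow> cubic X (\<lambda>z :: nat + 'i \<Rightarrow> bool.
     if \<forall>k<d. z (Inl k) then G (\<lambda>i. z (Inr i)) else F (\<lambda>i. z (Inr i)))"

text \<open>For \<open>d = 1\<close> this is membership in the same ergodic component. For larger
  \<open>d\<close> it is the relation of index \<open>d - 1\<close> in the tower of equivalence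
  relations known from nilspaces.\<close>

definition eqv :: "'a cubeset \<Rightarrow> nat \<Rightarrow> 'a \<Rightarrow> 'a \<Rightarrow> bool" where
  "eqv X d a b \<longleftrightarrow> cubic X (\<lambda>z :: nat \<Rightarrow> bool. if \<forall>k<d. z k then b else a)"

context cfcubeset
begin

lemma cub_subst_eq:
  assumes "cub g" "\<And>i. lit (s i)" "\<And>z. g (\<lambda>i. s i z) = g' z"
  shows "cub g'"
proof -
  have "(\<lambda>z. g (\<lambda>i. s i z)) = g'" using assms(3) by (rule ext)
  with cub_subst[of g s, OF assms(1,2)] show ?thesis by (rule subst[rotated])
qed

lemma tricube_eq:
  assumes "finite M"
    and "\<And>\<eta>. cub (\<lambda>z. W (\<lambda>i. if i \<in> M then (if z i then Some (\<eta> i) else None) else Some (z i)))"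
    and "\<And>z. W (\<lambda>i. Some (z i)) = g z"
  shows "cub g"
proof -
  have "(\<lambda>z. W (\<lambda>i. Some (z i))) = g" using assms(3) by (rule ext)
  with tricube[of M W, OF assms(1,2)] show ?thesis by (rule subst[rotated])
qed

text \<open>A subdivided cube in the \<open>d\<close> extra directions: the value is
  \<open>F\<close> as soon as one direction is at the middle, and then the small cube at the corner
  \<eta> is exactly the relation between \<open>F\<close> and \<open>G \<eta>\<close>. So every
  vertex of the d-cube may carry its own partner of \<open>F\<close>.\<close>

lemma rel_any:
  assumes G: "\<And>\<eta>. rel X d F (G \<eta>)"
  shows "cub (\<lambda>z. G (\<lambda>k. k < d \<and> z (Inl k)) (\<lambda>i. z (Inr i)))"
proof (rule tricube_eq)
  let ?M = "Inl ` {..<d}"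
  show "finite ?M" by simp
  define W where "W y = (if \<forall>k<d. y (Inl k) \<noteq> None
     then G (\<lambda>k. k < d \<and> y (Inl k) = Some True) (\<lambda>i. y (Inr i) = Some True)
     else F (\<lambda>i. y (Inr i) = Some True))" for y
  show "cub (\<lambda>z. W (\<lambda>i. if i \<in> ?M then (if z i then Some (\<eta> i) else None) else Some (z i)))" for \<eta>
  proof -
    have "W (\<lambda>i. if i \<in> ?M then (if z i then Some (\<eta> i) else None) else Some (z i))
      = (if \<forall>k<d. z (Inl k) then G (\<lambda>k. k < d \<and> \<eta> (Inl k)) (\<lambda>i. z (Inr i)) else F (\<lambda>i. z (Inr i)))" for z
    proof (cases "\<forall>k<d. z (Inl k)")
      case True
      then have "(\<lambda>k. k < d \<and> (if Inl k \<in> ?M then (if z (Inl k) then Some (\<eta> (Inl k)) else None) else Some (z (Inl k))) = Some True)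
        = (\<lambda>k. k < d \<and> \<eta> (Inl k))" by (auto simp: fun_eq_iff)
      with True show ?thesis by (auto simp: W_def image_iff)
    next
      case False
      then show ?thesis by (auto simp: W_def image_iff)
    qed
    then show ?thesis using G[of "\<lambda>k. k < d \<and> \<eta> (Inl k)"] by (simp add: rel_def)
  qed
  show "W (\<lambda>i. Some (z i)) = G (\<lambda>k. k < d \<and> z (Inl k)) (\<lambda>i. z (Inr i))" for z
    by (simp add: W_def)
qed

lemma rel_cub:
  assumes "rel X d F G" "1 \<le> d"
  shows "cub F" "cub G"
proof -
  have l: "lit (\<lambda>z. case x of Inl k \<Rightarrow> b | Inr i \<Rightarrow> z i)" for b and x :: "nat + 'b"
    by (cases x) simp_all
  show "cub F"
    by (rule cub_subst_eq[OF assms(1)[unfolded rel_def], of "\<lambda>x z. case x of Inl k \<Rightarrow> False | Inr i \<Rightarrow> z i"])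
      (use l assms(2) in auto)
  show "cub G"
    by (rule cub_subst_eq[OF assms(1)[unfolded rel_def], of "\<lambda>x z. case x of Inl k \<Rightarrow> True | Inr i \<Rightarrow> z i"])
      (use l in auto)
qed

lemma rel_refl: "cub F \<Longrightarrow> rel X d F F"
  unfolding rel_def by (rule cub_subst_eq[of F "\<lambda>i z. z (Inr i)"]) simp_all

text \<open>With \<open>F\<close> as centre, \<open>rel_any\<close> lets each vertex carry
  \<open>F\<close> or \<open>G\<close>: \<open>F\<close> is put at the last one and \<open>G\<close>
  at all others.\<close>

lemma rel_sym:
  assumes "rel X d F G" "1 \<le> d"
  shows "rel X d G F"
proof -
  have "rel X d F (if \<forall>k<d. \<eta> k then F else G)" for \<eta>
    using assms(1) rel_refl[OF rel_cub(1)[OF assms]] by simp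
  from rel_any[of d F "\<lambda>\<eta>. if \<forall>k<d. \<eta> k then F else G", OF this]
  show ?thesis unfolding rel_def by (rule cub_subst_eq[where s = "\<lambda>i z. z i"]) auto
qed

text \<open>Now \<open>G\<close> is the centre, being related to \<open>H\<close> and, by symmetry,
  to \<open>F\<close>: \<open>rel_any\<close> puts \<open>H\<close> at the last vertex and
  \<open>F\<close> at all others.\<close>

lemma rel_trans:
  assumes "rel X d F G" "rel X d G H" "1 \<le> d"
  shows "rel X d F H"
proof -
  have "rel X d G (if \<forall>k<d. \<eta> k then H else F)" for \<eta>
    using assms(2) rel_sym[OF assms(1,3)] by simp
  from rel_any[of d G "\<lambda>\<eta>. if \<forall>k<d. \<eta> k then H else F", OF this]
  show ?thesis unfolding rel_def by (rule cub_subst_eq[where s = "\<lambda>i z. z i"]) auto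
qed

text \<open>Holding the coordinates from \<open>d'\<close> on at true leaves a face in which only
  the first \<open>d'\<close> directions decide.\<close>

lemma rel_mono:
  assumes "rel X d F G" "d' \<le> d"
  shows "rel X d' F G"
  unfolding rel_def
proof (rule cub_subst_eq[OF assms(1)[unfolded rel_def],
      where s = "\<lambda>x z. case x of Inl k \<Rightarrow> k < d' \<longrightarrow> z (Inl k) | Inr i \<Rightarrow> z (Inr i)"])
  show "lit (\<lambda>z. case x of Inl k \<Rightarrow> k < d' \<longrightarrow> z (Inl k) | Inr i \<Rightarrow> z (Inr i))" for x :: "nat + 'b"
    by (cases x) simp_all
qed (use assms(2) in auto)

text \<open>The extra directions are moved from \<open>Inl k\<close> to coordinates of the index
  type itself, where the families of labels have them.\<close>

lemma rel_iff:
  assumes E: "finite E" "card E = d" and F: "supported (- E) F" "supported (- E) G"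
  shows "rel X d F G \<longleftrightarrow> cub (\<lambda>z. if \<forall>e\<in>E. z e then G z else F z)"
proof -
  obtain b where b: "bij_betw b {..<d} E"
    using ex_bij_betw_nat_finite[OF E(1)] E(2) unfolding atLeast0LessThan by blast
  define c where "c = inv_into {..<d} b"
  have cb: "c (b k) = k" if "k < d" for k
    using b that by (simp add: c_def bij_betw_def inv_into_f_f)
  have bc: "b (c e) = e" "c e < d" if "e \<in> E" for e
    using b that unfolding c_def by (auto simp: bij_betw_def f_inv_into_f intro: inv_into_into[of _ b "{..<d}", simplified])
  show ?thesis
  proof
    assume "rel X d F G"
    then show "cub (\<lambda>z. if \<forall>e\<in>E. z e then G z else F z)"
      unfolding rel_def
    proof (rule cub_subst_eq[where s = "\<lambda>x z. case x of Inl k \<Rightarrow> z (b k) | Inr i \<Rightarrow> z i"])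
      show "lit (\<lambda>z. case x of Inl k \<Rightarrow> z (b k) | Inr i \<Rightarrow> z i)" for x by (cases x) simp_all
      fix z
      have "(\<forall>k<d. z (b k)) = (\<forall>e\<in>E. z e)" using b unfolding bij_betw_def by auto
      then show "(if \<forall>k<d. case Inl k of Inl k \<Rightarrow> z (b k) | Inr i \<Rightarrow> z i
             then G (\<lambda>i. case Inr i of Inl k \<Rightarrow> z (b k) | Inr i \<Rightarrow> z i)
             else F (\<lambda>i. case Inr i of Inl k \<Rightarrow> z (b k) | Inr i \<Rightarrow> z i)) =
            (if \<forall>e\<in>E. z e then G z else F z)" by simp
    qed
  next
    assume "cub (\<lambda>z. if \<forall>e\<in>E. z e then G z else F z)"
    then show "rel X d F G"
      unfolding rel_def
    proof (rule cub_subst_eq[where s = "\<lambda>e z. if e \<in> E then z (Inl (c e)) else z (Inr e)"])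
      show "lit (\<lambda>z. if e \<in> E then z (Inl (c e)) else z (Inr e))" for e by (rule lit_if) simp_all
      fix z :: "nat + 'b \<Rightarrow> bool"
      have "(\<forall>k<d. z (Inl k)) = (\<forall>e\<in>E. z (Inl (c e)))"
        using bc cb b unfolding bij_betw_def by (metis imageI lessThan_iff)
      moreover have "G (\<lambda>e. if e \<in> E then z (Inl (c e)) else z (Inr e)) = G (\<lambda>i. z (Inr i))"
        by (rule supportedD[OF F(2)]) simp
      moreover have "F (\<lambda>e. if e \<in> E then z (Inl (c e)) else z (Inr e)) = F (\<lambda>i. z (Inr i))"
        by (rule supportedD[OF F(1)]) simp
      ultimately show "(if \<forall>e\<in>E. if e \<in> E then z (Inl (c e)) else z (Inr e)
           then G (\<lambda>e. if e \<in> E then z (Inl (c e)) else z (Inr e))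
           else F (\<lambda>e. if e \<in> E then z (Inl (c e)) else z (Inr e))) =
           (if \<forall>k<d. z (Inl k) then G (\<lambda>i. z (Inr i)) else F (\<lambda>i. z (Inr i)))" by auto
    qed
  qed
qed

text \<open>Constant families ignore the \<open>Inr\<close> coordinates, so \<open>'i\<close> is
  arbitrary and all rules for \<open>rel\<close> carry over to points.\<close>

lemma eqv_rel: "eqv X d a b \<longleftrightarrow> rel X d (\<lambda>_ :: 'i \<Rightarrow> bool. a) (\<lambda>_. b)"
proof
  assume "eqv X d a b"
  then show "rel X d (\<lambda>_ :: 'i \<Rightarrow> bool. a) (\<lambda>_. b)"
    unfolding rel_def eqv_def by (rule cub_subst_eq[where s = "\<lambda>k z. z (Inl k)"]) auto
next
  assume "rel X d (\<lambda>_ :: 'i \<Rightarrow> bool. a) (\<lambda>_. b)"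
  then show "eqv X d a b"
    unfolding rel_def eqv_def
  proof (rule cub_subst_eq[where s = "\<lambda>x z. case x of Inl k \<Rightarrow> z k | Inr i \<Rightarrow> True"])
    show "lit (\<lambda>z. case x of Inl k \<Rightarrow> z k | Inr i \<Rightarrow> True)" for x :: "nat + 'i"
      by (cases x) simp_all
  qed auto
qed

lemma eqv_refl: "a \<in> sections X 0 \<Longrightarrow> eqv X d a a"
  unfolding eqv_def using cub_const by simp

lemma eqv_in:
  assumes "eqv X d a b"
  shows "b \<in> sections X 0" "1 \<le> d \<Longrightarrow> a \<in> sections X 0"
  using cub_in[OF assms[unfolded eqv_def], of "\<lambda>_. True"] cub_in[OF assms[unfolded eqv_def], of "\<lambda>_. False"]
  by (auto split: if_splits)

lemma eqv_sym: "eqv X d a b \<Longrightarrow> 1 \<le> d \<Longrightarrow> eqv X d b a"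
  unfolding eqv_rel[where 'i = nat] by (rule rel_sym)

lemma eqv_trans: "eqv X d a b \<Longrightarrow> eqv X d b c \<Longrightarrow> 1 \<le> d \<Longrightarrow> eqv X d a c"
  unfolding eqv_rel[where 'i = nat] by (rule rel_trans)

lemma eqv_mono: "eqv X d a b \<Longrightarrow> d' \<le> d \<Longrightarrow> eqv X d' a b"
  unfolding eqv_rel[where 'i = nat] by (rule rel_mono)

lemma eqv_iff:
  fixes E :: "'i set"
  assumes "finite E" "card E = d"
  shows "eqv X d a b \<longleftrightarrow> cub (\<lambda>z. if \<forall>e\<in>E. z e then b else a)"
  using rel_iff[OF assms, of "\<lambda>_. a" "\<lambda>_. b"] eqv_rel[where 'i = 'i, of d a b]
  by (simp add: supported_def)

text \<open>The directions of \<open>rel_any\<close> are renamed by a bijection with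
  \<open>E\<close>, and surplus ones are held at false. This allows coordinates of labels to control
  the choice directly.\<close>

lemma rel_any_coords:
  assumes E: "finite E" "card E \<le> d" and F: "\<And>\<eta>. rel X d F (G \<eta>)"
    and E': "\<And>e. e \<in> E \<Longrightarrow> lit (s e)" and r: "\<And>i. lit (r i)"
  shows "cub (\<lambda>z. G (\<lambda>e. e \<in> E \<and> s e z) (\<lambda>i. r i z))"
proof -
  obtain b where b: "bij_betw b {..<card E} E"
    using ex_bij_betw_nat_finite[OF E(1)] unfolding atLeast0LessThan by blast
  define c where "c = inv_into {..<card E} b"
  have bc: "b (c e) = e" "c e < card E" if "e \<in> E" for e
    using b that unfolding c_def by (auto simp: bij_betw_def f_inv_into_f intro: inv_into_into[of _ b "{..<card E}", simplified])
  have bE: "b k \<in> E" if "k < card E" for k using b that by (auto simp: bij_betw_def)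
  have "cub (\<lambda>z. G (\<lambda>e. e \<in> E \<and> c e < d \<and> z (Inl (c e))) (\<lambda>i. z (Inr i)))"
    using rel_any[of d F "\<lambda>\<eta>. G (\<lambda>e. e \<in> E \<and> \<eta> (c e))", OF F] by simp
  then show ?thesis
  proof (rule cub_subst_eq[where s = "\<lambda>x z. case x of Inl k \<Rightarrow> k < card E \<and> s (b k) z | Inr i \<Rightarrow> r i z"])
    show "lit (\<lambda>z. case x of Inl k \<Rightarrow> k < card E \<and> s (b k) z | Inr i \<Rightarrow> r i z)" for x
      using E'[OF bE] r by (cases x; cases "projl x < card E") simp_all
    show "G (\<lambda>e. e \<in> E \<and> c e < d \<and> (case Inl (c e) of Inl k \<Rightarrow> k < card E \<and> s (b k) z | Inr i \<Rightarrow> r i z))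
         (\<lambda>i. case Inr i of Inl k \<Rightarrow> k < card E \<and> s (b k) z | Inr i \<Rightarrow> r i z)
        = G (\<lambda>e. e \<in> E \<and> s e z) (\<lambda>i. r i z)" for z
    proof -
      have "(\<lambda>e. e \<in> E \<and> c e < d \<and> c e < card E \<and> s (b (c e)) z) = (\<lambda>e. e \<in> E \<and> s e z)"
        using bc E(2) by (auto simp: fun_eq_iff dest: bc(2) intro: less_le_trans)
      then show ?thesis by simp
    qed
  qed
qed

text \<open>On the grid the middle point counts as true. The small cube at the last vertex then
  shows only \<open>e\<close> and the old top value, which is the hypothesis on \<open>e\<close>;
  each other small cube is a face of \<open>g\<close>, reflected in the remaining
  directions.\<close>

lemma replace_top:
  assumes g: "cub (g :: (nat \<Rightarrow> bool) \<Rightarrow> 'a)" "supported {..<d} g" and e: "eqv X d (g (\<lambda>_. True)) e"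
  shows "cub (\<lambda>z. if \<forall>i<d. z i then e else g z)"
proof (rule tricube_eq)
  show "finite {..<d}" by simp
  define W where "W y = (if \<forall>i<d. y i = Some True then e else g (\<lambda>k. y k \<noteq> Some False))" for y
  show "cub (\<lambda>z. W (\<lambda>i. if i \<in> {..<d} then (if z i then Some (\<eta> i) else None) else Some (z i)))" for \<eta>
  proof (cases "\<forall>i<d. \<eta> i")
    case True
    have "W (\<lambda>i. if i \<in> {..<d} then (if z i then Some (\<eta> i) else None) else Some (z i))
        = (if \<forall>i<d. z i then e else g (\<lambda>_. True))" for z
      unfolding W_def using True by (auto intro!: supportedD[OF g(2)])
    then show ?thesis using e by (simp add: eqv_def)
  next
    case False
    have "W (\<lambda>i. if i \<in> {..<d} then (if z i then Some (\<eta> i) else None) else Some (z i))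
        = g (\<lambda>k. if k < d then if \<eta> k then True else \<not> z k else z k)" for z
    proof -
      have "(\<lambda>k. (if k \<in> {..<d} then (if z k then Some (\<eta> k) else None) else Some (z k)) \<noteq> Some False)
         = (\<lambda>k. if k < d then if \<eta> k then True else \<not> z k else z k)" by (auto simp: fun_eq_iff)
      then show ?thesis unfolding W_def using False by auto
    qed
    moreover have "cub (\<lambda>z. g (\<lambda>k. if k < d then if \<eta> k then True else \<not> z k else z k))"
      by (rule cub_subst[OF g(1)]) (intro lit_if lit_const lit_coord lit_neg)
    ultimately show ?thesis by simp
  qed
  show "W (\<lambda>i. Some (z i)) = (if \<forall>i<d. z i then e else g z)" for z by (auto simp: W_def)
qed

text \<open>Reflecting the directions in which \<open>w\<close> is false turns \<open>w\<close> into
  the last vertex.\<close>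

lemma replace_vertex:
  assumes g: "cub (g :: (nat \<Rightarrow> bool) \<Rightarrow> 'a)" "supported {..<d} g" and e: "eqv X d (g w) e"
  shows "cub (\<lambda>z. if \<forall>i<d. z i = w i then e else g z)"
proof -
  have l: "lit (\<lambda>z :: nat \<Rightarrow> bool. z i = w i)" for i by (cases "w i") simp_all
  have "cub (\<lambda>z. if \<forall>i<d. z i then e else g (\<lambda>i. z i = w i))"
  proof (rule replace_top)
    show "cub (\<lambda>z. g (\<lambda>i. z i = w i))" by (rule cub_subst[OF g(1) l])
    show "supported {..<d} (\<lambda>z. g (\<lambda>i. z i = w i))"
      unfolding supported_def by (auto intro!: supportedD[OF g(2)])
    show "eqv X d (g (\<lambda>i. True = w i)) e" using e by simp
  qed
  then show ?thesis
  proof (rule cub_subst_eq[where s = "\<lambda>i z. z i = w i"])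
    show "lit (\<lambda>z. z i = w i)" for i :: nat by (rule l)
  next
    have "(\<lambda>i. (z i = w i) = w i) = z" for z :: "nat \<Rightarrow> bool" by (auto simp: fun_eq_iff)
    then show "(if \<forall>i<d. z i = w i then e else g (\<lambda>i. (z i = w i) = w i)) = (if \<forall>i<d. z i = w i then e else g z)" for z
      by (simp only:)
  qed
qed

text \<open>The common corner of \<open>g\<close> and \<open>h\<close> is put into the middle of the
  grid. The small cube at the last vertex is \<open>h\<close>, all others are \<open>g\<close>, and
  the outer vertices show only the two fillings.\<close>

lemma eqv_completions:
  assumes g: "cub (g :: (nat \<Rightarrow> bool) \<Rightarrow> 'a)" "supported {..<d} g"
    and h: "cub h" "supported {..<d} h"
    and eq: "\<And>z i. i < d \<Longrightarrow> \<not> z i \<Longrightarrow> g z = h z"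
  shows "eqv X d (g (\<lambda>_. True)) (h (\<lambda>_. True))"
  unfolding eqv_def
proof (rule tricube_eq)
  show "finite {..<d}" by simp
  define W where "W y = (if \<forall>i<d. y i \<noteq> None
     then if \<forall>i<d. y i = Some True then h (\<lambda>_. True) else g (\<lambda>_. True)
     else g (\<lambda>k. y k \<noteq> None))" for y :: "nat \<Rightarrow> bool option"
  show "cub (\<lambda>z. W (\<lambda>i. if i \<in> {..<d} then (if z i then Some (\<eta> i) else None) else Some (z i)))" for \<eta>
  proof (cases "\<forall>i<d. \<eta> i")
    case True
    have "W (\<lambda>i. if i \<in> {..<d} then (if z i then Some (\<eta> i) else None) else Some (z i)) = h z" for z
    proof (cases "\<forall>i<d. z i")
      case all: True
      then show ?thesis unfolding W_def using True by (auto intro!: supportedD[OF h(2)])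
    next
      case False
      then obtain i where "i < d" "\<not> z i" by blast
      from eq[of i z, OF this] False show ?thesis
        unfolding W_def by (auto intro!: supportedD[OF g(2)] elim!: subst)
    qed
    then show ?thesis using h(1) by simp
  next
    case False
    have "W (\<lambda>i. if i \<in> {..<d} then (if z i then Some (\<eta> i) else None) else Some (z i)) = g z" for z
      unfolding W_def using False by (auto intro!: supportedD[OF g(2)])
    then show ?thesis using g(1) by simp
  qed
  show "W (\<lambda>i. Some (z i)) = (if \<forall>i<d. z i then h (\<lambda>_. True) else g (\<lambda>_. True))" for z by (simp add: W_def)
qed

end

section \<open>Labellings of subsets\<close>

text \<open>The coordinates \<open>(j, False)\<close> and \<open>(j, True)\<close> together decide whether the element \<open>j\<close> of \<open>T\<close> is
  removed; each of them exists only if \<open>T\<close> has elements on that side of \<open>j\<close>, because degeneracies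
  duplicate an element only next to another one.\<close>

definition inc :: "nat set \<Rightarrow> (nat \<times> bool) set" where
  "inc T = {(j, b). if b then \<exists>t\<in>T. j < t else \<exists>t\<in>T. t < j}"

text \<open>An element of \<open>P\<close> without any coordinate in \<open>A\<close> is removed at
  every vertex; this case does occur for degenerable cubes.\<close>

definition fam :: "(nat set \<Rightarrow> 'a) \<Rightarrow> nat set \<Rightarrow> (nat \<times> bool) set \<Rightarrow> nat set \<Rightarrow> (nat \<times> bool \<Rightarrow> bool) \<Rightarrow> 'a" where
  "fam f P A T z = f (T - {j \<in> P. \<forall>b. (j, b) \<in> A \<longrightarrow> z (j, b)})"

text \<open>Properness keeps the remaining label set nonempty. The separating \<open>t\<close> may
  itself belong to \<open>P\<close>: the clause only has to fail for two elements that are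
  neighbours in \<open>T\<close>.\<close>

definition indep :: "nat set \<Rightarrow> nat set \<Rightarrow> bool" where
  "indep T P \<longleftrightarrow> P \<subseteq> T \<and> P \<noteq> T \<and> (\<forall>p\<in>P. \<forall>q\<in>P. p < q \<longrightarrow> (\<exists>t\<in>T. p < t \<and> t < q))"

definition cond :: "'a cubeset \<Rightarrow> (nat set \<Rightarrow> 'a) \<Rightarrow> nat set \<Rightarrow> nat set \<Rightarrow> bool" where
  "cond X f T P \<longleftrightarrow> cubic X (fam f P (inc T) T)"

definition K_labelling :: "'a cubeset \<Rightarrow> nat \<Rightarrow> (nat set \<Rightarrow> 'a) \<Rightarrow> bool" where
  "K_labelling X n f \<longleftrightarrow> (\<forall>T\<in>Sub n. \<forall>P. indep T P \<longrightarrow> cond X f T P)"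

lemma fam_cong: "(\<And>j b. j \<in> P \<Longrightarrow> (j, b) \<in> A \<longleftrightarrow> (j, b) \<in> A') \<Longrightarrow> fam f P A = fam f P A'"
  unfolding fam_def fun_eq_iff by (intro allI arg_cong[where f = f]) auto

lemma fam_insert:
  assumes "p \<notin> R" and "\<And>j b. j \<in> R \<Longrightarrow> (j, b) \<in> A' \<longleftrightarrow> (j, b) \<in> A"
  shows "fam f (insert p R) A' T z = (if \<forall>e\<in>{p} \<times> {b. (p, b) \<in> A'}. z e
    then fam f R A (T - {p}) z else fam f R A T z)"
  unfolding fam_def using assms by (auto intro!: arg_cong[where f = f])

lemma fam_supported: "p \<notin> R \<Longrightarrow> supported (- ({p} \<times> B)) (fam f R A S)"
  unfolding supported_def fam_def by (intro allI impI arg_cong[where f = f]) fastforce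

context cfcubeset
begin

text \<open>The coordinates of \<open>p\<close> influence nothing else, so they can serve as the
  extra directions of \<open>rel\<close>: if all of them are true, then \<open>p\<close> is
  gone.\<close>

lemma fam_rel:
  assumes "p \<notin> R" and "\<And>j b. j \<in> R \<Longrightarrow> (j, b) \<in> A' \<longleftrightarrow> (j, b) \<in> A"
  shows "cub (fam f (insert p R) A' T) \<longleftrightarrow>
    rel X (card {b. (p, b) \<in> A'}) (fam f R A T) (fam f R A (T - {p}))"
proof -
  have "rel X (card {b. (p, b) \<in> A'}) (fam f R A T) (fam f R A (T - {p})) \<longleftrightarrow>
    cub (\<lambda>z. if \<forall>e\<in>{p} \<times> {b. (p, b) \<in> A'}. z e then fam f R A (T - {p}) z else fam f R A T z)"
    by (rule rel_iff) (use assms(1) fam_supported in \<open>auto simp: card_cartesian_product_singleton\<close>)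
  moreover have "fam f (insert p R) A' T = (\<lambda>z. if \<forall>e\<in>{p} \<times> {b. (p, b) \<in> A'}. z e
      then fam f R A (T - {p}) z else fam f R A T z)"
    by (rule ext) (rule fam_insert[OF assms])
  ultimately show ?thesis by simp
qed

lemma fam_subst:
  assumes "cub (fam f P A T)" "\<And>e. lit (s e)"
    and "\<And>z. f (T - {j \<in> P. \<forall>b. (j, b) \<in> A \<longrightarrow> s (j, b) z}) = g z"
  shows "cub g"
  by (rule cub_subst_eq[OF assms(1), where s = s]) (simp_all add: fam_def assms(2,3))

text \<open>Degenerable cubes may also remove two neighbours \<open>p < q\<close>. Since a
  coordinate in \<open>A\<close> points at a neighbour that stays, only the outer coordinates
  \<open>(p, False)\<close> and \<open>(q, True)\<close> are then in use. Keeping one of the two in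
  place frees the inner coordinate for the other, so induction gives relations of weight 2, and
  \<open>rel_any\<close> with two directions combines them.\<close>

lemma fam_active:
  assumes "finite T" "P \<subseteq> T" "P \<noteq> T"
    and right: "\<And>j. j \<in> P \<Longrightarrow> (j, True) \<in> A \<Longrightarrow> \<exists>t\<in>T - P. j < t \<and> (\<forall>u\<in>T. \<not> (j < u \<and> u < t))"
    and left: "\<And>j. j \<in> P \<Longrightarrow> (j, False) \<in> A \<Longrightarrow> \<exists>t\<in>T - P. t < j \<and> (\<forall>u\<in>T. \<not> (t < u \<and> u < j))"
    and f: "\<And>T' P'. T' \<subseteq> T \<Longrightarrow> indep T' P' \<Longrightarrow> cond X f T' P'"
  shows "cub (fam f P A T)"
  using assms
proof (induction "card T + card P" arbitrary: T P A rule: less_induct)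
  case less
  note prems = less.prems
  have finP: "finite P" using prems(1,2) by (rule rev_finite_subset)
  consider j where "j \<in> P" "\<And>b. (j, b) \<notin> A"
    | "indep T P" | p q where "p \<in> P" "q \<in> P" "p < q" "\<And>t. t \<in> T \<Longrightarrow> \<not> (p < t \<and> t < q)"
      "\<And>j. j \<in> P \<Longrightarrow> \<exists>b. (j, b) \<in> A"
    using prems(2,3) unfolding indep_def by blast
  then show ?case
  proof cases
    \<comment> \<open>Having no coordinate, \<open>j\<close> is removed at every vertex and can be
      taken out of \<open>T\<close> beforehand.\<close>
    case (1 j)
    have "cub (fam f (P - {j}) A (T - {j}))"
    proof (rule less.hyps)
      have "card (T - {j}) < card T" "card (P - {j}) \<le> card P"
        using 1 prems(1,2) finP by (auto intro: psubset_card_mono card_mono)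
      then show "card (T - {j}) + card (P - {j}) < card T + card P" by simp
      show "finite (T - {j})" "P - {j} \<subseteq> T - {j}" "P - {j} \<noteq> T - {j}" using prems(1,2,3) 1 by auto
      show "\<exists>t\<in>T - {j} - (P - {j}). i < t \<and> (\<forall>u\<in>T - {j}. \<not> (i < u \<and> u < t))"
        if "i \<in> P - {j}" "(i, True) \<in> A" for i
        using prems(4)[of i] that 1(1) by blast
      show "\<exists>t\<in>T - {j} - (P - {j}). t < i \<and> (\<forall>u\<in>T - {j}. \<not> (t < u \<and> u < i))"
        if "i \<in> P - {j}" "(i, False) \<in> A" for i
        using prems(5)[of i] that 1(1) by blast
      show "cond X f T' P'" if "T' \<subseteq> T - {j}" "indep T' P'" for T' P' using that by (intro prems(6)) auto
    qed
    moreover have "fam f (P - {j}) A (T - {j}) = fam f P A T"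
      unfolding fam_def fun_eq_iff using 1 by (auto intro!: arg_cong[where f = f])
    ultimately show ?thesis by simp
  next
    case 2
    have "(j, b) \<in> inc T" if "j \<in> P" "(j, b) \<in> A" for j b
      using prems(4)[of j] prems(5)[of j] that by (cases b) (auto simp: inc_def)
    then have eq: "f (T - {j \<in> P. \<forall>b. (j, b) \<in> inc T \<longrightarrow> (j, b) \<in> A \<longrightarrow> z (j, b)}) = fam f P A T z" for z
      unfolding fam_def by (auto intro!: arg_cong[where f = f])
    have "cub (fam f P (inc T) T)" using prems(6)[OF subset_refl 2] by (simp add: cond_def)
    then show ?thesis by (rule fam_subst[where s = "\<lambda>e z. e \<in> A \<longrightarrow> z e"]) (use eq in simp_all)
  next
    case (3 p q)
    define R where "R = P - {p, q}"
    have P: "P = insert p (insert q R)" "p \<notin> R" "q \<notin> R" "p \<noteq> q" "p \<in> T" "q \<in> T" "R \<subseteq> T"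
      using 3 prems(2) by (auto simp: R_def)
    have nopT: "(p, True) \<notin> A"
    proof
      assume "(p, True) \<in> A"
      then obtain t where "t \<in> T - P" "p < t" "\<forall>u\<in>T. \<not> (p < u \<and> u < t)" using prems(4) 3 by blast
      then show False using 3(2,3,4) P(6) by (metis DiffE linorder_neqE_nat)
    qed
    have noqF: "(q, False) \<notin> A"
    proof
      assume "(q, False) \<in> A"
      then obtain t where "t \<in> T - P" "t < q" "\<forall>u\<in>T. \<not> (t < u \<and> u < q)" using prems(5) 3 by blast
      then show False using 3(1,3,4) P(5) by (metis DiffE linorder_neqE_nat)
    qed
    have pF: "(p, False) \<in> A" and qT: "(q, True) \<in> A" using 3(5) 3(1,2) nopT noqF by (metis (full_types))+
    obtain l where l: "l \<in> T - P" "l < p" "\<forall>u\<in>T. \<not> (l < u \<and> u < p)" using prems(5)[OF 3(1) pF] by blast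
    obtain r where r: "r \<in> T - P" "q < r" "\<forall>u\<in>T. \<not> (q < u \<and> u < r)" using prems(4)[OF 3(2) qT] by blast
    have "insert p R \<subset> P" "insert q R \<subset> P" unfolding P(1) using P(2-4) by auto
    then have cards: "card (insert p R) < card P" "card (insert q R) < card P"
      "card (T - {p}) \<le> card T"
      using finP prems(1) by (auto intro: psubset_card_mono card_mono)
    have Tp: "rel X 2 (fam f R A T) (fam f R A (T - {p}))"
    proof -
      have "cub (fam f (insert p R) (insert (p, True) A) T)"
      proof (rule less.hyps)
        show "card T + card (insert p R) < card T + card P" using cards by simp
        show "finite T" "insert p R \<subseteq> T" "insert p R \<noteq> T" using prems P by auto
        show "\<exists>t\<in>T - insert p R. i < t \<and> (\<forall>u\<in>T. \<not> (i < u \<and> u < t))"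
          if "i \<in> insert p R" "(i, True) \<in> insert (p, True) A" for i
        proof (cases "i = p")
          case True
          then show ?thesis using 3(3,4) P by (intro bexI[of _ q]) auto
        next
          case False
          then show ?thesis using that prems(4)[of i] P by blast
        qed
        show "\<exists>t\<in>T - insert p R. t < i \<and> (\<forall>u\<in>T. \<not> (t < u \<and> u < i))"
          if "i \<in> insert p R" "(i, False) \<in> insert (p, True) A" for i
          using that prems(5)[of i] P by blast
      qed (use prems in blast)
      moreover have "{b. (p, b) \<in> insert (p, True) A} = UNIV" using pF by (auto simp: set_eq_iff all_bool_eq)
      ultimately show ?thesis
        using fam_rel[of p R "insert (p, True) A" A f T] P by (auto simp: card_UNIV_bool)
    qed
    have q: "rel X 2 (fam f R A S) (fam f R A (S - {q}))" if S: "S = T \<or> S = T - {p}" for S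
    proof -
      have "cub (fam f (insert q R) (insert (q, False) A) S)"
      proof (rule less.hyps)
        show "card S + card (insert q R) < card T + card P" using cards S by auto
        show "finite S" "insert q R \<subseteq> S" "insert q R \<noteq> S" using prems P S l(1) by auto
        show "\<exists>t\<in>S - insert q R. i < t \<and> (\<forall>u\<in>S. \<not> (i < u \<and> u < t))"
          if "i \<in> insert q R" "(i, True) \<in> insert (q, False) A" for i
          using that prems(4)[of i] P S by blast
        show "\<exists>t\<in>S - insert q R. t < i \<and> (\<forall>u\<in>S. \<not> (t < u \<and> u < i))"
          if "i \<in> insert q R" "(i, False) \<in> insert (q, False) A" for i
        proof (cases "i = q")
          case True
          from S show ?thesis
          proof
            assume "S = T"
            then show ?thesis using True 3(3,4) P by (intro bexI[of _ p]) auto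
          next
            \<comment> \<open>Once \<open>p\<close> is gone, the left neighbour of \<open>q\<close>
              is the former left neighbour \<open>l\<close> of \<open>p\<close>, which
              stays.\<close>
            assume "S = T - {p}"
            moreover have "\<not> (l < u \<and> u < q)" if "u \<in> T - {p}" for u
              using that l(3) 3(4)[of u] by (metis DiffE insertCI linorder_neqE_nat)
            ultimately show ?thesis using True l 3(3) P by (intro bexI[of _ l]) auto
          qed
        next
          case False
          then show ?thesis using that prems(5)[of i] P S by blast
        qed
      qed (use prems S in blast)
      moreover have "{b. (q, b) \<in> insert (q, False) A} = UNIV" using qT by (auto simp: set_eq_iff all_bool_eq)
      ultimately show ?thesis
        using fam_rel[of q R "insert (q, False) A" A f S] P by (auto simp: card_UNIV_bool)
    qed
    \<comment> \<open>All four outcomes are related to the one in which both elements stay; for the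
      removal of both, transitivity through \<open>T - {p}\<close> is used.\<close>
    define G where "G \<eta> = (if \<eta> p then if \<eta> q then fam f R A (T - {p} - {q}) else fam f R A (T - {p})
       else if \<eta> q then fam f R A (T - {q}) else fam f R A T)" for \<eta>
    have "rel X 2 (fam f R A T) (G \<eta>)" for \<eta>
      using Tp q[of T] rel_trans[OF Tp q[of "T - {p}"]] rel_refl[OF rel_cub(1)[OF Tp]] by (auto simp: G_def)
    then have "cub (\<lambda>z. G (\<lambda>e. e \<in> {p, q} \<and> z (e, e = q)) (\<lambda>i. z i))"
      by (intro rel_any_coords[where d = 2 and F = "fam f R A T"]) (simp_all add: P(4))
    moreover have "G (\<lambda>e. e \<in> {p, q} \<and> z (e, e = q)) (\<lambda>i. z i) = fam f P A T z" for z
    proof -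
      have "(\<forall>b. (p, b) \<in> A \<longrightarrow> z (p, b)) = z (p, False)" "(\<forall>b. (q, b) \<in> A \<longrightarrow> z (q, b)) = z (q, True)"
        using pF nopT qT noqF by (metis (full_types))+
      then have "{j \<in> P. \<forall>b. (j, b) \<in> A \<longrightarrow> z (j, b)} = (if z (p, False) then {p} else {}) \<union> (if z (q, True) then {q} else {})
         \<union> {j \<in> R. \<forall>b. (j, b) \<in> A \<longrightarrow> z (j, b)}"
        unfolding P(1) by auto
      then show ?thesis using P(4) by (auto simp: fam_def G_def intro!: arg_cong[where f = f])
    qed
    ultimately show ?thesis by simp
  qed
qed

end

section \<open>Degenerable formal cubes\<close>

lemma supported_shrink:
  assumes "finite I" "supported I Q" "\<And>i z b. i \<in> I - J \<Longrightarrow> Q (z(i := b)) = Q z"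
  shows "supported J Q"
  unfolding supported_def
proof (intro allI impI)
  fix z z' :: "'a \<Rightarrow> bool" assume eq: "\<forall>j\<in>J. z j = z' j"
  have "Q (\<lambda>i. if i \<in> D then z' i else z i) = Q z" if "D \<subseteq> I - J" for D
    using finite_subset[OF that finite_Diff[OF assms(1)]] that
  proof (induction D rule: finite_induct)
    case (insert d D)
    have "(\<lambda>i. if i \<in> insert d D then z' i else z i) = (\<lambda>i. if i \<in> D then z' i else z i)(d := z' d)"
      by (auto simp: fun_eq_iff)
    then show ?case using insert assms(3)[of d] by simp
  qed simp
  from this[of "I - J"] have "Q z = Q (\<lambda>i. if i \<in> I - J then z' i else z i)" by simp
  also have "\<dots> = Q z'" by (rule supportedD[OF assms(2)]) (use eq in auto)
  finally show "Q z = Q z'" .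
qed

lemma simplex_maps_mono: "\<sigma> \<in> simplex_maps k n \<Longrightarrow> i \<le> j \<Longrightarrow> j \<le> k \<Longrightarrow> \<sigma> i \<le> \<sigma> j"
  by (auto simp: simplex_maps_def simplex_def mono_on_def)

lemma Sub_image: "\<sigma> \<in> simplex_maps k n \<Longrightarrow> S \<in> Sub k \<Longrightarrow> \<sigma> ` S \<in> Sub n"
  by (force simp: simplex_maps_def simplex_def Sub_def)

text \<open>Only \<open>i\<close> and \<open>Suc i\<close> are identified by \<open>degen i\<close>:
  any other element survives, and one of the pair can at most turn into the other.\<close>

lemma degen_step:
  assumes "degen i ` A = degen i ` A'" "a \<in> A"
  shows "\<exists>a'\<in>A'. a = a' \<or> a \<in> {i, Suc i} \<and> a' \<in> {i, Suc i}"
proof -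
  obtain a' where a': "a' \<in> A'" "degen i a = degen i a'" using assms by blast
  then show ?thesis by (intro bexI[OF _ a'(1)]) (auto simp: degen_def split: if_splits)
qed

context cfcubeset
begin

text \<open>Coordinate \<open>i\<close> can affect only the labels \<open>\<sigma> i\<close> and
  \<open>\<sigma> (Suc i)\<close>, and whether one of them is present does not depend on it. It is
  called active if one of two distinct labels is present at all vertices; other coordinates have no
  effect. For each vertex \<eta> the labels absent there can be removed under the control of the
  active coordinates, which is a cube by \<open>fam_active\<close>. These cubes are the small cubes
  of a grid whose outer vertices are the wanted ones.\<close>

lemma degenerable_image_cub:
  assumes f: "K_labelling X n f" and A: "degenerable k A" and \<sigma>: "\<sigma> \<in> simplex_maps k n"
  shows "cub (\<lambda>z. f (\<sigma> ` A (\<lambda>i\<in>{..<k}. of_bool (z i))))"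
proof -
  define B where "B z = \<sigma> ` A (\<lambda>i\<in>{..<k}. of_bool (z i))" for z
  define T where "T = \<sigma> ` {..k}"
  have T: "finite T" "T \<in> Sub n"
    using \<sigma> by (auto simp: T_def Sub_def simplex_maps_def simplex_def)
  have incube: "(\<lambda>i\<in>{..<k}. of_bool (z i)) \<in> cube k" for z by (auto simp: cube_def)
  have ASub: "A (\<lambda>i\<in>{..<k}. of_bool (z i)) \<in> Sub k" for z
    using A incube[of z] by (auto simp: degenerable_def)
  have B: "B z \<subseteq> T" "B z \<noteq> {}" for z
    using ASub[of z] by (auto simp: B_def T_def Sub_def simplex_def)
  have mono: "\<sigma> i \<le> \<sigma> j" if "i \<le> j" "j \<le> k" for i j using simplex_maps_mono[OF \<sigma> that] .
  have step: "\<exists>a'\<in>A (\<lambda>i\<in>{..<k}. of_bool (z' i)). a = a' \<or> a \<in> {i, Suc i} \<and> a' \<in> {i, Suc i}"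
    if "i < k" "\<And>j. j \<noteq> i \<Longrightarrow> z j = z' j" "a \<in> A (\<lambda>i\<in>{..<k}. of_bool (z i))" for i z z' a
  proof (rule degen_step[OF _ that(3)])
    show "degen i ` A (\<lambda>i\<in>{..<k}. of_bool (z i)) = degen i ` A (\<lambda>i\<in>{..<k}. of_bool (z' i))"
      using A that(1,2) incube unfolding degenerable_def by simp
  qed
  have local: "t \<in> B (z(i := b)) \<longleftrightarrow> t \<in> B z" if "i < k" "t \<notin> {\<sigma> i, \<sigma> (Suc i)}" for i z b t
  proof -
    have "t \<in> B w'" if w: "t \<in> B w" "\<And>j. j \<noteq> i \<Longrightarrow> w j = w' j" for w w'
    proof -
      obtain a where a: "a \<in> A (\<lambda>i\<in>{..<k}. of_bool (w i))" "t = \<sigma> a" using w(1) by (auto simp: B_def)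
      show ?thesis using step[OF \<open>i < k\<close> w(2) a(1)] \<open>t \<notin> _\<close> a(2) by (auto simp: B_def)
    qed
    from this[of z "z(i := b)"] this[of "z(i := b)" z] show ?thesis by auto
  qed
  have meet: "B z \<inter> {\<sigma> i, \<sigma> (Suc i)} \<noteq> {} \<Longrightarrow> B (z(i := b)) \<inter> {\<sigma> i, \<sigma> (Suc i)} \<noteq> {}"
    if "i < k" for i z b
  proof -
    assume "B z \<inter> {\<sigma> i, \<sigma> (Suc i)} \<noteq> {}"
    then obtain a where a: "a \<in> A (\<lambda>i\<in>{..<k}. of_bool (z i))" "\<sigma> a \<in> {\<sigma> i, \<sigma> (Suc i)}"
      by (auto simp: B_def)
    have "\<exists>a'\<in>A (\<lambda>j\<in>{..<k}. of_bool ((z(i := b)) j)). a = a' \<or> a \<in> {i, Suc i} \<and> a' \<in> {i, Suc i}"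
      by (rule step[OF that _ a(1)]) simp
    then obtain a' where "a' \<in> A (\<lambda>j\<in>{..<k}. of_bool ((z(i := b)) j))" "\<sigma> a' \<in> {\<sigma> i, \<sigma> (Suc i)}"
      using a(2) by auto
    then show ?thesis unfolding B_def by blast
  qed
  have single: "B (z(i := b)) = B z" if "i < k" "\<sigma> i = \<sigma> (Suc i)" for i z b
  proof -
    have "B w \<subseteq> B w'" if w: "\<And>j. j \<noteq> i \<Longrightarrow> w j = w' j" for w w'
    proof
      fix t assume "t \<in> B w"
      then obtain a where a: "a \<in> A (\<lambda>i\<in>{..<k}. of_bool (w i))" "t = \<sigma> a" by (auto simp: B_def)
      obtain a' where a': "a' \<in> A (\<lambda>i\<in>{..<k}. of_bool (w' i))" "a = a' \<or> a \<in> {i, Suc i} \<and> a' \<in> {i, Suc i}"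
        using step[OF \<open>i < k\<close> w a(1)] by blast
      have "t = \<sigma> a'" using a'(2) a(2) \<open>\<sigma> i = _\<close> by auto
      then show "t \<in> B w'" using a'(1) unfolding B_def by blast
    qed
    from this[of z "z(i := b)"] this[of "z(i := b)" z] show ?thesis by auto
  qed
  define near where "near t = {i. i < k \<and> t \<in> {\<sigma> i, \<sigma> (Suc i)}}" for t
  have sup0: "supported {..<k} B"
    unfolding supported_def B_def by (auto intro!: arg_cong[where f = "\<lambda>x. \<sigma> ` A x"])
  have near: "supported (near t) (\<lambda>z. t \<in> B z)" for t
  proof (rule supported_shrink[of "{..<k}"])
    show "supported {..<k} (\<lambda>z. t \<in> B z)" using sup0 by (auto simp: supported_def)
  qed (auto simp: near_def local)
  define act where "act = {i. i < k \<and> \<sigma> i < \<sigma> (Suc i) \<and> (\<forall>z. B z \<inter> {\<sigma> i, \<sigma> (Suc i)} \<noteq> {})}"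
  text \<open>If the two labels that coordinate \<open>i\<close> can change are once absent together, then each
    of them can be decided while the other one is absent, hence without \<open>z i\<close>.\<close>
  have inactive: "B (z(i := b)) = B z" if i: "i < k" "i \<notin> act" for i z b
  proof (cases "\<sigma> i = \<sigma> (Suc i)")
    case True
    then show ?thesis using single i by blast
  next
    case False
    then have lt: "\<sigma> i < \<sigma> (Suc i)" using mono[of i "Suc i"] i by simp
    then obtain z0 where z0: "B z0 \<inter> {\<sigma> i, \<sigma> (Suc i)} = {}" using i by (auto simp: act_def)
    have z0': "B (z0(i := b)) \<inter> {\<sigma> i, \<sigma> (Suc i)} = {}" for b
      using meet[OF i(1), of "z0(i := b)" "z0 i"] z0 by auto
    have right: "j \<ge> i" if "j \<in> near (\<sigma> (Suc i))" for j
    proof (rule ccontr)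
      assume "\<not> i \<le> j"
      then have "\<sigma> (Suc j) \<le> \<sigma> i" "\<sigma> j \<le> \<sigma> i" using i mono by auto
      then show False using that lt by (auto simp: near_def)
    qed
    have left: "j \<le> i" if "j \<in> near (\<sigma> i)" for j
    proof (rule ccontr)
      assume "\<not> j \<le> i"
      moreover have "j < k" using that by (simp add: near_def)
      ultimately have "\<sigma> (Suc i) \<le> \<sigma> j" "\<sigma> j \<le> \<sigma> (Suc j)" using mono by auto
      then show False using that lt by (auto simp: near_def)
    qed
    have q: "\<sigma> (Suc i) \<notin> B w" if "\<And>j. j > i \<Longrightarrow> w j = z0 j" for w
    proof -
      have "(\<sigma> (Suc i) \<in> B w) = (\<sigma> (Suc i) \<in> B (z0(i := w i)))"
        by (rule supportedD[OF near]) (use that right in \<open>force simp: order_le_less\<close>)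
      then show ?thesis using z0' by auto
    qed
    have p: "\<sigma> i \<notin> B w" if "\<And>j. j < i \<Longrightarrow> w j = z0 j" for w
    proof -
      have "(\<sigma> i \<in> B w) = (\<sigma> i \<in> B (z0(i := w i)))"
        by (rule supportedD[OF near]) (use that left in \<open>force simp: order_le_less\<close>)
      then show ?thesis using z0' by auto
    qed
    have pp: "\<sigma> i \<in> B (w(i := b))" if "\<sigma> i \<in> B w" for w b
    proof -
      define u where "u = (\<lambda>j. if j > i then z0 j else w j)"
      have "(\<sigma> i \<in> B w) = (\<sigma> i \<in> B u)" "(\<sigma> i \<in> B (w(i := b))) = (\<sigma> i \<in> B (u(i := b)))"
        by (rule supportedD[OF near], use left in \<open>force simp: u_def\<close>)+
      moreover have "\<sigma> (Suc i) \<notin> B (u(i := b))" by (rule q) (auto simp: u_def)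
      ultimately show ?thesis using that meet[OF i(1), of u b] by auto
    qed
    have qq: "\<sigma> (Suc i) \<in> B (w(i := b))" if "\<sigma> (Suc i) \<in> B w" for w b
    proof -
      define u where "u = (\<lambda>j. if j < i then z0 j else w j)"
      have "(\<sigma> (Suc i) \<in> B w) = (\<sigma> (Suc i) \<in> B u)" "(\<sigma> (Suc i) \<in> B (w(i := b))) = (\<sigma> (Suc i) \<in> B (u(i := b)))"
        by (rule supportedD[OF near], use right in \<open>force simp: u_def\<close>)+
      moreover have "\<sigma> i \<notin> B (u(i := b))" by (rule p) (auto simp: u_def)
      ultimately show ?thesis using that meet[OF i(1), of u b] by auto
    qed
    have "t \<in> B (z(i := b)) \<longleftrightarrow> t \<in> B z" for t
      using local[OF i(1), of t z b] pp[of z b] pp[of "z(i := b)" "z i"] qq[of z b] qq[of "z(i := b)" "z i"]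
      by (cases "t \<in> {\<sigma> i, \<sigma> (Suc i)}") auto
    then show ?thesis by blast
  qed
  have sup: "supported (act \<inter> near t) (\<lambda>z. t \<in> B z)" for t
  proof (rule supported_shrink[OF _ near[of t]])
    show "finite (near t)" by (simp add: near_def)
    show "(t \<in> B (z(i := b))) = (t \<in> B z)" if "i \<in> near t - act \<inter> near t" for i z b
      using inactive[of i z b] that by (auto simp: near_def)
  qed
  \<comment> \<open>The small cube at \<eta>: starting from \<open>T\<close>, labels that are absent
    in \<open>B \<eta>\<close> are taken away.\<close>
  have cube_P: "cub (\<lambda>z. f (T - {t \<in> T - B \<eta>. \<forall>i\<in>act. t \<in> {\<sigma> i, \<sigma> (Suc i)} \<longrightarrow> z i}))" for \<eta>
  proof -
    \<comment> \<open>Coordinate \<open>i\<close> is the right coordinate of its lower label and the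
      left one of its upper label, both reading the same \<open>z i\<close>. As one of the two
      labels belongs to \<open>B \<eta>\<close>, at most one of them is ever removed, and the label
      across the gap stays, as \<open>fam_active\<close> demands.\<close>
    define Inc where "Inc = {(\<sigma> i, True) | i. i \<in> act} \<union> {(\<sigma> (Suc i), False) | i. i \<in> act}"
    have inj1: "i = j" if "i \<in> act" "j \<in> act" "\<sigma> i = \<sigma> j" for i j
    proof (rule ccontr)
      assume "i \<noteq> j"
      then consider "Suc i \<le> j" | "Suc j \<le> i" by linarith
      then show False
        using that mono[of "Suc i" j] mono[of "Suc j" i] by cases (auto simp: act_def)
    qed
    have inj2: "i = j" if "i \<in> act" "j \<in> act" "\<sigma> (Suc i) = \<sigma> (Suc j)" for i j
    proof (rule ccontr)
      assume "i \<noteq> j"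
      then consider "Suc i \<le> j" | "Suc j \<le> i" by linarith
      then show False
        using that mono[of "Suc i" j] mono[of "Suc j" i] by cases (auto simp: act_def)
    qed
    have between: "\<not> (\<sigma> i < u \<and> u < \<sigma> (Suc i))" if iu: "i \<in> act" "u \<in> T" for i u
    proof -
      obtain j where j: "j \<le> k" "u = \<sigma> j" using iu by (auto simp: T_def)
      show ?thesis using mono[of j i] mono[of "Suc i" j] j iu(1) by (cases "j \<le> i") (auto simp: act_def)
    qed
    have inT: "\<sigma> i \<in> T" "\<sigma> (Suc i) \<in> T" if "i \<in> act" for i using that by (auto simp: act_def T_def)
    have one: "\<sigma> i \<in> B \<eta> \<or> \<sigma> (Suc i) \<in> B \<eta>" if "i \<in> act" for i using that by (auto simp: act_def)
    have lt: "\<sigma> i < \<sigma> (Suc i)" if "i \<in> act" for i using that by (auto simp: act_def)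
    have "cub (fam f (T - B \<eta>) Inc T)"
    proof (rule fam_active[OF T(1)])
      show "T - B \<eta> \<subseteq> T" "T - B \<eta> \<noteq> T" using B[of \<eta>] by auto
      show "\<exists>t\<in>T - (T - B \<eta>). j < t \<and> (\<forall>u\<in>T. \<not> (j < u \<and> u < t))"
        if j: "j \<in> T - B \<eta>" "(j, True) \<in> Inc" for j
      proof -
        obtain i where i: "i \<in> act" "j = \<sigma> i" using j(2) by (auto simp: Inc_def)
        then show ?thesis using one[OF i(1)] inT[OF i(1)] lt[OF i(1)] between[OF i(1)] j(1)
          by (intro bexI[of _ "\<sigma> (Suc i)"]) auto
      qed
      show "\<exists>t\<in>T - (T - B \<eta>). t < j \<and> (\<forall>u\<in>T. \<not> (t < u \<and> u < j))"
        if j: "j \<in> T - B \<eta>" "(j, False) \<in> Inc" for j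
      proof -
        obtain i where i: "i \<in> act" "j = \<sigma> (Suc i)" using j(2) by (auto simp: Inc_def)
        then show ?thesis using one[OF i(1)] inT[OF i(1)] lt[OF i(1)] between[OF i(1)] j(1)
          by (intro bexI[of _ "\<sigma> i"]) auto
      qed
      show "cond X f T' P'" if "T' \<subseteq> T" "indep T' P'" for T' P'
      proof -
        have "T' \<noteq> {}" using that(2) by (auto simp: indep_def)
        then have "T' \<in> Sub n" using that(1) T(2) by (auto simp: Sub_def)
        then show ?thesis using f that(2) by (simp add: K_labelling_def)
      qed
    qed
    then show ?thesis
    proof (rule fam_subst[where s = "\<lambda>e z. z (THE i. i \<in> act \<and> (if snd e then \<sigma> i else \<sigma> (Suc i)) = fst e)"])
      fix z
      have 1: "(THE i. i \<in> act \<and> \<sigma> i = \<sigma> j) = j" if "j \<in> act" for j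
        using that inj1 by (intro the_equality) auto
      have 2: "(THE i. i \<in> act \<and> \<sigma> (Suc i) = \<sigma> (Suc j)) = j" if "j \<in> act" for j
        using that inj2 by (intro the_equality) auto
      have "(\<forall>b. (t, b) \<in> Inc \<longrightarrow> z (THE i. i \<in> act \<and> (if b then \<sigma> i else \<sigma> (Suc i)) = t))
         \<longleftrightarrow> (\<forall>i\<in>act. t \<in> {\<sigma> i, \<sigma> (Suc i)} \<longrightarrow> z i)" for t
        unfolding Inc_def by (auto simp: 1 2 all_bool_eq)
      then show "f (T - {j \<in> T - B \<eta>. \<forall>b. (j, b) \<in> Inc \<longrightarrow>
          z (THE i. i \<in> act \<and> (if snd (j, b) then \<sigma> i else \<sigma> (Suc i)) = fst (j, b))})
        = f (T - {t \<in> T - B \<eta>. \<forall>i\<in>act. t \<in> {\<sigma> i, \<sigma> (Suc i)} \<longrightarrow> z i})" by simp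
    qed simp
  qed
  have "cub (\<lambda>z. f (B z))"
  proof (rule tricube_eq)
    show "finite act" by (simp add: act_def)
    \<comment> \<open>A label with an active coordinate still at the middle is kept; otherwise
      \<open>B\<close> decides.\<close>
    define W where "W y = f (T - {t \<in> T. (\<forall>i\<in>act. t \<in> {\<sigma> i, \<sigma> (Suc i)} \<longrightarrow> y i \<noteq> None) \<and>
        t \<notin> B (\<lambda>i. y i = Some True)})" for y
    show "cub (\<lambda>z. W (\<lambda>i. if i \<in> act then (if z i then Some (\<eta> i) else None) else Some (z i)))" for \<eta>
    proof -
      have "W (\<lambda>i. if i \<in> act then (if z i then Some (\<eta> i) else None) else Some (z i))
        = f (T - {t \<in> T - B \<eta>. \<forall>i\<in>act. t \<in> {\<sigma> i, \<sigma> (Suc i)} \<longrightarrow> z i})" for z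
      proof -
        define y where "y = (\<lambda>i. if i \<in> act then (if z i then Some (\<eta> i) else None) else Some (z i))"
        have "(t \<in> B (\<lambda>i. y i = Some True)) = (t \<in> B \<eta>)"
          if "\<forall>i\<in>act. t \<in> {\<sigma> i, \<sigma> (Suc i)} \<longrightarrow> z i" for t
          by (rule supportedD[OF sup]) (use that in \<open>auto simp: near_def y_def\<close>)
        moreover have "(\<forall>i\<in>act. t \<in> {\<sigma> i, \<sigma> (Suc i)} \<longrightarrow> y i \<noteq> None) \<longleftrightarrow>
            (\<forall>i\<in>act. t \<in> {\<sigma> i, \<sigma> (Suc i)} \<longrightarrow> z i)" for t
          by (auto simp: y_def)
        ultimately have "{t \<in> T. (\<forall>i\<in>act. t \<in> {\<sigma> i, \<sigma> (Suc i)} \<longrightarrow> y i \<noteq> None) \<and> t \<notin> B (\<lambda>i. y i = Some True)}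
          = {t \<in> T - B \<eta>. \<forall>i\<in>act. t \<in> {\<sigma> i, \<sigma> (Suc i)} \<longrightarrow> z i}" by blast
        then have "W y = f (T - {t \<in> T - B \<eta>. \<forall>i\<in>act. t \<in> {\<sigma> i, \<sigma> (Suc i)} \<longrightarrow> z i})"
          unfolding W_def by (simp only:)
        then show ?thesis by (simp only: y_def)
      qed
      then show ?thesis using cube_P by simp
    qed
    show "W (\<lambda>i. Some (z i)) = f (B z)" for z
      unfolding W_def using B(1)[of z] by (intro arg_cong[where f = f]) auto
  qed
  then show ?thesis by (simp add: B_def)
qed

lemma degenerable_image_is_cube:
  assumes "K_labelling X n f" "degenerable k A" "\<sigma> \<in> simplex_maps k n"
  shows "is_cube X k (\<lambda>v. f (\<sigma> ` A v))"
proof (rule iffD1[OF is_cube_cong cub_is_cube[OF degenerable_image_cub[OF assms]]])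
  fix v assume "v \<in> cube k"
  then have "(\<lambda>i\<in>{..<k}. of_bool (i < k \<and> v i = 1)) = v" by (auto simp: cube_def fun_eq_iff PiE_iff extensional_def)
  then show "f (\<sigma> ` A (\<lambda>i\<in>{..<k}. of_bool (i < k \<and> v i = 1))) = f (\<sigma> ` A v)" by simp
qed

end

section \<open>Maps from \<open>K n\<close> as labellings\<close>

definition val :: "'a Kstar_simplex \<Rightarrow> nat set \<Rightarrow> 'a" where
  "val s S = s 0 (\<lambda>u\<in>cube 0. S)"

lemma id_simplex_map: "(\<lambda>j\<in>simplex n. j) \<in> simplex_maps n n"
  by (auto simp: simplex_maps_def mono_on_def)

lemma compose_simplex_maps:
  assumes "\<tau> \<in> simplex_maps l n" "\<sigma> \<in> simplex_maps k l"
  shows "compose (simplex k) \<tau> \<sigma> \<in> simplex_maps k n"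
proof -
  have "\<sigma> j \<in> simplex l" if "j \<in> simplex k" for j using assms(2) that by (auto simp: simplex_maps_def)
  then show ?thesis using assms unfolding simplex_maps_def mono_on_def compose_def by auto
qed

lemma K_I: "\<phi> \<in> cube_maps m k \<Longrightarrow> degenerable k A \<Longrightarrow> \<sigma> \<in> simplex_maps k n \<Longrightarrow>
    (\<lambda>x\<in>cube m. \<sigma> ` A (\<phi> x)) \<in> sections (K n) m"
  unfolding K_def by auto

lemma K_E:
  assumes "c \<in> sections (K n) m"
  obtains k \<sigma> A \<phi> where "c = (\<lambda>x\<in>cube m. \<sigma> ` A (\<phi> x))" "\<phi> \<in> cube_maps m k" "degenerable k A"
    "\<sigma> \<in> simplex_maps k n"
proof -
  from assms have "\<exists>k \<sigma> A \<phi>. c = (\<lambda>x\<in>cube m. \<sigma> ` A (\<phi> x)) \<and> \<phi> \<in> cube_maps m k \<and> degenerable k A \<and>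
      \<sigma> \<in> simplex_maps k n" by (simp add: K_def)
  then obtain k \<sigma> A \<phi> where c: "c = (\<lambda>x\<in>cube m. \<sigma> ` A (\<phi> x)) \<and> \<phi> \<in> cube_maps m k \<and>
      degenerable k A \<and> \<sigma> \<in> simplex_maps k n" by (elim exE)
  show thesis
    by (rule that[of \<sigma> A \<phi> k]) (use c in simp_all)
qed

lemma K_degenerable: "degenerable k A \<Longrightarrow> \<sigma> \<in> simplex_maps k n \<Longrightarrow> (\<lambda>x\<in>cube k. \<sigma> ` A x) \<in> sections (K n) k"
  using K_I[OF id_map, of k A \<sigma> n] by (simp cong: restrict_cong)

lemma K_const:
  assumes "S \<in> Sub n" shows "(\<lambda>u\<in>cube m. S) \<in> sections (K n) m"
proof -
  have "(\<lambda>x\<in>cube m. \<lambda>i\<in>{..<n}. of_bool False) \<in> cube_maps m n"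
    using lit_map[of "\<lambda>_ _. False" m n] by simp
  moreover have "degenerable n (\<lambda>x\<in>cube n. S)" using assms by (auto simp: degenerable_def)
  ultimately have "(\<lambda>x\<in>cube m. (\<lambda>j\<in>simplex n. j) ` (\<lambda>x\<in>cube n. S) ((\<lambda>x\<in>cube m. \<lambda>i\<in>{..<n}. of_bool False) x)) \<in> sections (K n) m"
    by (rule K_I[OF _ _ id_simplex_map])
  moreover have "(\<lambda>j\<in>simplex n. j) ` S = S" using assms by (force simp: Sub_def)
  moreover have "(\<lambda>x\<in>cube n. S) (\<lambda>i\<in>{..<n}. of_bool False) = S" by (simp add: cube_def)
  ultimately show ?thesis by (simp cong: restrict_cong)
qed

lemma K_value: "c \<in> sections (K n) m \<Longrightarrow> v \<in> cube m \<Longrightarrow> c v \<in> Sub n"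
proof (erule K_E)
  fix k \<sigma> A \<phi> assume c: "c = (\<lambda>x\<in>cube m. \<sigma> ` A (\<phi> x))" "\<phi> \<in> cube_maps m k" "degenerable k A"
    "\<sigma> \<in> simplex_maps k n" and v: "v \<in> cube m"
  then have "A (\<phi> v) \<in> Sub k" by (auto simp: cube_maps_def degenerable_def)
  then show "c v \<in> Sub n" using Sub_image[OF c(4)] v c(1) by simp
qed

lemma K_restr_in:
  assumes "\<psi> \<in> cube_maps l m" "c \<in> sections (K n) m"
  shows "compose (cube l) c \<psi> \<in> sections (K n) l"
  using assms(2)
proof (rule K_E)
  fix k \<sigma> A \<phi> assume c: "c = (\<lambda>x\<in>cube m. \<sigma> ` A (\<phi> x))" "\<phi> \<in> cube_maps m k" "degenerable k A"
    "\<sigma> \<in> simplex_maps k n"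
  have "\<psi> x \<in> cube m" if "x \<in> cube l" for x using assms(1) that by (auto simp: cube_maps_def)
  then have "compose (cube l) c \<psi> = (\<lambda>x\<in>cube l. \<sigma> ` A (compose (cube l) \<phi> \<psi> x))"
    by (auto simp: c(1) compose_def fun_eq_iff)
  then show ?thesis using K_I[OF compose_cube_maps[OF c(2) assms(1)] c(3,4)] by simp
qed

lemma K_push_in:
  assumes "\<tau> \<in> simplex_maps l n" "c \<in> sections (K l) m"
  shows "K_push m \<tau> c \<in> sections (K n) m"
  using assms(2)
proof (rule K_E)
  fix k \<sigma> A \<phi> assume c: "c = (\<lambda>x\<in>cube m. \<sigma> ` A (\<phi> x))" "\<phi> \<in> cube_maps m k" "degenerable k A"
    "\<sigma> \<in> simplex_maps k l"
  have "A (\<phi> x) \<subseteq> simplex k" if "x \<in> cube m" for x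
    using c(2,3) that by (auto simp: cube_maps_def degenerable_def Sub_def)
  then have "K_push m \<tau> c = (\<lambda>x\<in>cube m. compose (simplex k) \<tau> \<sigma> ` A (\<phi> x))"
    unfolding K_push_def c(1) compose_def by (force simp: fun_eq_iff)
  then show ?thesis using K_I[OF c(2,3) compose_simplex_maps[OF assms(1) c(4)]] by simp
qed

lemma ex_enumeration:
  assumes "finite (T :: nat set)" "T \<noteq> {}"
  obtains k \<sigma> where "\<sigma> \<in> extensional {..k}" "\<sigma> ` {..k} = T" "strict_mono_on {..k} \<sigma>" "card T = Suc k"
proof -
  obtain r where r: "strict_mono_on {..<card T} r" "\<forall>n<card T. r n \<in> T"
    using finite_enumerate[OF assms(1)] by blast
  obtain k where k: "card T = Suc k" using assms by (metis card_gt_0_iff gr0_conv_Suc)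
  have "inj_on r {..<card T}" using r(1) by (rule strict_mono_on_imp_inj_on)
  then have "r ` {..<card T} = T"
    using r(2) assms(1) by (intro card_subset_eq) (auto simp: card_image)
  then have "r ` {..k} = T" by (simp add: k lessThan_Suc_atMost)
  moreover have "strict_mono_on {..k} (restrict r {..k})"
    using r(1) k by (auto simp: strict_mono_on_def)
  ultimately show thesis using k
    by (intro that[where \<sigma> = "restrict r {..k}" and k = k]) auto
qed

lemma enumeration_map:
  assumes "T \<in> Sub n" "\<sigma> \<in> extensional {..k}" "\<sigma> ` {..k} = T" "\<And>i j. i < j \<Longrightarrow> j \<le> k \<Longrightarrow> \<sigma> i < \<sigma> j"
  shows "\<sigma> \<in> simplex_maps k n"
proof -
  have "\<sigma> i \<le> \<sigma> j" if "i \<le> j" "j \<le> k" for i j using assms(4)[of i j] that by (cases "i = j") auto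
  then show ?thesis
    using assms(1-3) by (auto simp: simplex_maps_def Sub_def simplex_def mono_on_def PiE_iff)
qed

text \<open>Coordinate \<open>i\<close> influences only \<open>i\<close> and \<open>Suc i\<close>.
  One of these lies outside \<open>P\<close> and is never removed, so after their identification the
  pair is present at every vertex.\<close>

lemma degenerable_formal:
  assumes P: "P \<subseteq> {..k}" "P \<noteq> {..k}" "\<And>j. j \<in> P \<Longrightarrow> Suc j \<notin> P"
    and N: "\<And>x y j. j \<in> P \<Longrightarrow> (\<And>i. i < k \<Longrightarrow> i = j \<or> Suc i = j \<Longrightarrow> x i = y i) \<Longrightarrow> N x j \<Longrightarrow> N y j"
  shows "degenerable k (\<lambda>x\<in>cube k. {..k} - {j \<in> P. N x j})"
  unfolding degenerable_def
proof (intro conjI allI ballI impI)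
  show "(\<lambda>x\<in>cube k. {..k} - {j \<in> P. N x j}) \<in> cube k \<rightarrow>\<^sub>E Sub k"
    using P(1,2) by (auto simp: Sub_def simplex_def)
  fix i x y assume i: "i < k" and xy: "x \<in> cube k" "y \<in> cube k" "\<forall>j<k. j \<noteq> i \<longrightarrow> x j = y j"
  have sub: "degen i ` ({..k} - {j \<in> P. N x j}) \<subseteq> degen i ` ({..k} - {j \<in> P. N y j})"
    if xy: "\<forall>j<k. j \<noteq> i \<longrightarrow> x j = y j" for x y
  proof (rule image_subsetI)
    fix a assume a: "a \<in> {..k} - {j \<in> P. N x j}"
    show "degen i a \<in> degen i ` ({..k} - {j \<in> P. N y j})"
    proof (cases "a \<in> {i, Suc i}")
      case True
      have "i \<notin> P \<or> Suc i \<notin> P" using P(3) by blast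
      moreover have "degen i i = i" "degen i (Suc i) = i" by (simp_all add: degen_def)
      ultimately show ?thesis using True i by (intro image_eqI[of _ _ "if i \<notin> P then i else Suc i"]) auto
    next
      case False
      have "a \<notin> P \<or> \<not> N y a"
      proof (rule ccontr)
        assume "\<not> (a \<notin> P \<or> \<not> N y a)"
        then have "N x a" using xy False by (intro N[of a y x]) auto
        then show False using a \<open>\<not> (a \<notin> P \<or> \<not> N y a)\<close> by blast
      qed
      then show ?thesis using a by blast
    qed
  qed
  show "degen i ` (\<lambda>x\<in>cube k. {..k} - {j \<in> P. N x j}) x = degen i ` (\<lambda>x\<in>cube k. {..k} - {j \<in> P. N x j}) y"
    using sub[of x y] sub[of y x] xy by (simp add: subset_antisym)
qed

context cfcubeset
begin

lemma hom_in: "s \<in> cubeset_hom (K n) X \<Longrightarrow> c \<in> sections (K n) m \<Longrightarrow> s m c \<in> sections X m"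
  unfolding psh_hom_def by auto

lemma hom_vert:
  assumes s: "s \<in> cubeset_hom (K n) X" and c: "c \<in> sections (K n) m" and v: "v \<in> cube m"
  shows "vert X m (s m c) v = val s (c v)"
proof -
  have "vert X m (s m c) v = s 0 (restr (K n) 0 m (\<lambda>u\<in>cube 0. v) c)"
    using s c point_map[OF v] unfolding vert_def psh_hom_def by auto
  also have "restr (K n) 0 m (\<lambda>u\<in>cube 0. v) c = (\<lambda>u\<in>cube 0. c v)"
    by (rule ext) (simp add: K_def compose_def restrict_def)
  finally show ?thesis by (simp only: val_def)
qed

lemma val_in: "s \<in> cubeset_hom (K n) X \<Longrightarrow> S \<in> Sub n \<Longrightarrow> val s S \<in> sections X 0"
  unfolding val_def by (intro hom_in K_const)

lemma hom_eqI:
  assumes s: "s \<in> cubeset_hom (K n) X" and t: "t \<in> cubeset_hom (K n) X"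
    and eq: "\<And>S. S \<in> Sub n \<Longrightarrow> val s S = val t S"
  shows "s = t"
proof (intro ext)
  fix m c
  show "s m c = t m c"
  proof (cases "c \<in> sections (K n) m")
    case True
    show ?thesis
    proof (rule section_eqI)
      show "s m c \<in> sections X m" "t m c \<in> sections X m" using hom_in s t True by blast+
      show "vert X m (s m c) v = vert X m (t m c) v" if "v \<in> cube m" for v
        using hom_vert[OF s True that] hom_vert[OF t True that] eq[OF K_value[OF True that]] by simp
    qed
  next
    case False
    moreover have "s m \<in> extensional (sections (K n) m)" "t m \<in> extensional (sections (K n) m)"
      using s t unfolding psh_hom_def by (auto simp: PiE_iff)
    ultimately show ?thesis by (simp add: extensional_def)
  qed
qed

text \<open>The section over a cube of \<open>K n\<close> is prescribed by its vertices. It exists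
  by the reduction of degenerable cubes, and concreteness makes the choice natural.\<close>

lemma hom_of_labelling:
  assumes f: "K_labelling X n f"
  obtains s where "s \<in> cubeset_hom (K n) X" "\<And>S. S \<in> Sub n \<Longrightarrow> val s S = f S"
proof -
  define Q where "Q m c d \<longleftrightarrow> d \<in> sections X m \<and> (\<forall>v\<in>cube m. vert X m d v = f (c v))" for m c d
  have ex: "\<exists>d. Q m c d" if "c \<in> sections (K n) m" for m c
    using that
  proof (rule K_E)
    fix k \<sigma> A \<phi> assume c: "c = (\<lambda>x\<in>cube m. \<sigma> ` A (\<phi> x))" "\<phi> \<in> cube_maps m k" "degenerable k A"
      "\<sigma> \<in> simplex_maps k n"
    have "is_cube X m (\<lambda>v. f (\<sigma> ` A (\<phi> v)))"
      by (rule is_cube_comp[OF degenerable_image_is_cube[OF f c(3,4)] c(2)])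
    then show ?thesis unfolding is_cube_def Q_def c(1) by auto
  qed
  define s where "s m = (\<lambda>c\<in>sections (K n) m. SOME d. Q m c d)" for m
  have sQ: "Q m c (s m c)" if "c \<in> sections (K n) m" for m c
    using someI_ex[OF ex[OF that]] that by (simp add: s_def)
  have hom: "s \<in> cubeset_hom (K n) X"
    unfolding psh_hom_def
  proof (intro CollectI conjI allI ballI)
    fix m show "s m \<in> sections (K n) m \<rightarrow>\<^sub>E sections X m"
    proof (rule PiE_I)
      show "s m c \<in> sections X m" if "c \<in> sections (K n) m" for c using sQ[OF that] by (simp add: Q_def)
    qed (simp add: s_def)
  next
    fix l m \<psi> c assume \<psi>: "\<psi> \<in> cube_maps l m" and c: "c \<in> sections (K n) m"
    have c': "compose (cube l) c \<psi> \<in> sections (K n) l" using K_restr_in[OF \<psi> c] .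
    have "s l (compose (cube l) c \<psi>) = restr X l m \<psi> (s m c)"
    proof (rule section_eqI)
      show "s l (compose (cube l) c \<psi>) \<in> sections X l" using sQ[OF c'] by (simp add: Q_def)
      show "restr X l m \<psi> (s m c) \<in> sections X l" using sQ[OF c] \<psi> by (simp add: Q_def restr_in)
      fix v assume v: "v \<in> cube l"
      then have "\<psi> v \<in> cube m" using \<psi> by (auto simp: cube_maps_def)
      then show "vert X l (s l (compose (cube l) c \<psi>)) v = vert X l (restr X l m \<psi> (s m c)) v"
        using sQ[OF c'] sQ[OF c] \<psi> v by (auto simp: Q_def vert_restr compose_def)
    qed
    then show "s l (restr (K n) l m \<psi> c) = restr X l m \<psi> (s m c)" by (simp add: K_def)
  qed
  show thesis
  proof (rule that[OF hom])
    fix S assume S: "S \<in> Sub n"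
    have "s 0 (\<lambda>u\<in>cube 0. S) \<in> sections X 0" "vert X 0 (s 0 (\<lambda>u\<in>cube 0. S)) (\<lambda>_. undefined) = f S"
      using sQ[OF K_const[OF S, of 0]] by (auto simp: Q_def cube_0 restrict_def)
    then show "val s S = f S" using vert_0[of "s 0 (\<lambda>u\<in>cube 0. S)" "\<lambda>_. undefined"]
      by (simp add: val_def cube_0 restrict_def)
  qed
qed

lemma hom_degenerable:
  assumes "s \<in> cubeset_hom (K n) X" "degenerable k A" "\<sigma> \<in> simplex_maps k n"
  shows "is_cube X k (\<lambda>v. val s (\<sigma> ` A v))"
  unfolding is_cube_def
  by (rule bexI[of _ "s k (\<lambda>x\<in>cube k. \<sigma> ` A x)"])
    (simp_all add: hom_vert[OF assms(1)] hom_in[OF assms(1)] K_degenerable[OF assms(2,3)])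

lemma hom_formal:
  assumes s: "s \<in> cubeset_hom (K n) X" and \<sigma>: "\<sigma> \<in> simplex_maps k n"
    and P: "P \<subseteq> {..k}" "P \<noteq> {..k}" "\<And>j. j \<in> P \<Longrightarrow> Suc j \<notin> P"
    and N: "\<And>x y j. j \<in> P \<Longrightarrow> (\<And>i. i < k \<Longrightarrow> i = j \<or> Suc i = j \<Longrightarrow> x i = y i) \<Longrightarrow> N x j \<Longrightarrow> N y j"
  shows "is_cube X k (\<lambda>v. val s (\<sigma> ` ({..k} - {j \<in> P. N v j})))"
proof -
  have "is_cube X k (\<lambda>v. val s (\<sigma> ` (\<lambda>x\<in>cube k. {..k} - {j \<in> P. N x j}) v))"
    by (intro hom_degenerable[OF s _ \<sigma>] degenerable_formal) (use P N in blast)+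
  then show ?thesis by (rule iffD1[OF is_cube_cong, rotated]) simp
qed

text \<open>After enumerating \<open>T\<close>, the set \<open>P\<close> has no two consecutive
  positions, so the removal of its elements is a degenerable formal cube with one coordinate for
  each gap.\<close>

lemma hom_labelling:
  assumes s: "s \<in> cubeset_hom (K n) X"
  shows "K_labelling X n (val s)"
  unfolding K_labelling_def
proof (intro ballI allI impI)
  fix T P assume T: "T \<in> Sub n" and P: "indep T P"
  have "finite T" "T \<noteq> {}" using T by (auto simp: Sub_def simplex_def finite_subset)
  then obtain k \<sigma> where e: "\<sigma> \<in> extensional {..k}" "\<sigma> ` {..k} = T" "strict_mono_on {..k} \<sigma>"
    "card T = Suc k" by (rule ex_enumeration)
  have "\<sigma> i < \<sigma> j" if "i < j" "j \<le> k" for i j using e(3) that by (auto simp: strict_mono_on_def)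
  note \<sigma> = e(1,2) this
  have iff: "\<sigma> i < \<sigma> j \<longleftrightarrow> i < j" if "i \<le> k" "j \<le> k" for i j
    using \<sigma>(3)[of i j] \<sigma>(3)[of j i] that by (metis less_asym linorder_neqE_nat)
  define P' where "P' = {j. j \<le> k \<and> \<sigma> j \<in> P}"
  have adj: "\<sigma> (Suc i) \<notin> P" if i: "i < k" "\<sigma> i \<in> P" for i
  proof
    assume Suc: "\<sigma> (Suc i) \<in> P"
    have "\<sigma> i < \<sigma> (Suc i)" using \<sigma>(3)[of i "Suc i"] i by simp
    then have "\<exists>t\<in>T. \<sigma> i < t \<and> t < \<sigma> (Suc i)"
      using P i(2) Suc unfolding indep_def by blast
    then obtain u where "u \<le> k" "\<sigma> i < \<sigma> u" "\<sigma> u < \<sigma> (Suc i)" unfolding \<sigma>(2)[symmetric] by auto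
    then show False using iff[of i u] iff[of u "Suc i"] i by auto
  qed
  have "is_cube X k (\<lambda>v. val s (\<sigma> ` ({..k} - {j \<in> P'. \<forall>i<k. i = j \<or> Suc i = j \<longrightarrow> v i = 1})))"
  proof (rule hom_formal[OF s])
    show "\<sigma> \<in> simplex_maps k n" using enumeration_map[OF T \<sigma>] by blast
    show "P' \<noteq> {..k}" using P \<sigma>(2) unfolding indep_def P'_def by blast
    show "Suc j \<notin> P'" if "j \<in> P'" for j using adj[of j] that by (auto simp: P'_def)
  qed (auto simp: P'_def)
  \<comment> \<open>Each gap is next to at most one element of \<open>P\<close> and is read as the
    right or left coordinate of that element; a gap next to none is held at true.\<close>
  then have "cub (\<lambda>z. val s (\<sigma> ` ({..k} - {j \<in> P'. \<forall>i<k. i = j \<or> Suc i = j \<longrightarrow>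
      (\<lambda>i\<in>{..<k}. of_bool ((\<lambda>i z. if \<sigma> i \<in> P then z (\<sigma> i, True) else \<sigma> (Suc i) \<in> P \<longrightarrow> z (\<sigma> (Suc i), False)) i z)) i = (1::int)})))"
    by (rule is_cube_cubic) (intro lit_if lit_imp lit_coord)
  moreover have "val s (\<sigma> ` ({..k} - {j \<in> P'. \<forall>i<k. i = j \<or> Suc i = j \<longrightarrow>
      (\<lambda>i\<in>{..<k}. of_bool ((\<lambda>i z. if \<sigma> i \<in> P then z (\<sigma> i, True) else \<sigma> (Suc i) \<in> P \<longrightarrow> z (\<sigma> (Suc i), False)) i z)) i = (1::int)}))
    = fam (val s) P (inc T) T z" for z
  proof -
    define h where "h i = (if \<sigma> i \<in> P then z (\<sigma> i, True) else \<sigma> (Suc i) \<in> P \<longrightarrow> z (\<sigma> (Suc i), False))" for i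
    have "(\<forall>i<k. i = j \<or> Suc i = j \<longrightarrow> h i) \<longleftrightarrow> (\<forall>b. (\<sigma> j, b) \<in> inc T \<longrightarrow> z (\<sigma> j, b))" if j: "j \<in> P'" for j
    proof -
      have jk: "j \<le> k" "\<sigma> j \<in> P" using j by (auto simp: P'_def)
      have "(\<sigma> j, True) \<in> inc T \<longleftrightarrow> j < k"
        using iff[OF jk(1)] jk(1) unfolding \<sigma>(2)[symmetric] inc_def by (auto intro: bexI[of _ k] order.strict_trans1)
      moreover have "(\<sigma> j, False) \<in> inc T \<longleftrightarrow> 0 < j"
        using iff[OF _ jk(1)] unfolding \<sigma>(2)[symmetric] inc_def by (auto intro: bexI[of _ 0])
      moreover have "(\<forall>i<k. i = j \<or> Suc i = j \<longrightarrow> h i) \<longleftrightarrow> (j < k \<longrightarrow> h j) \<and> (0 < j \<longrightarrow> h (j - 1))"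
      proof (cases j)
        case (Suc l)
        then have "l < k" using jk(1) by simp
        then show ?thesis unfolding Suc by (auto dest: spec[of _ l])
      qed auto
      moreover have "h j = z (\<sigma> j, True)" using jk by (simp add: h_def)
      moreover have "h (j - 1) = z (\<sigma> j, False)" if "0 < j"
        using adj[of "j - 1"] that jk by (cases j) (auto simp: h_def)
      ultimately show ?thesis by (auto simp: all_bool_eq)
    qed
    then have e1: "{j \<in> P'. \<forall>i<k. i = j \<or> Suc i = j \<longrightarrow> h i} = {j \<in> P'. \<sigma> j \<in> {t. \<forall>b. (t, b) \<in> inc T \<longrightarrow> z (t, b)}}"
      by blast
    have e2: "\<sigma> ` ({..k} - {j \<in> P'. \<sigma> j \<in> Q}) = T - {t \<in> P. t \<in> Q}" for Q
      unfolding \<sigma>(2)[symmetric] P'_def by auto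
    have "\<sigma> ` ({..k} - {j \<in> P'. \<forall>i<k. i = j \<or> Suc i = j \<longrightarrow> h i})
      = T - {t \<in> P. \<forall>b. (t, b) \<in> inc T \<longrightarrow> z (t, b)}"
      unfolding e1 e2 by simp
    then show ?thesis unfolding fam_def h_def by (simp cong: conj_cong)
  qed
  ultimately show "cond X (val s) T P" unfolding cond_def by simp
qed

end

section \<open>Extending labellings from horns\<close>

text \<open>For \<open>j\<close> in \<open>T\<close> this is 2 at an inner element, 1 at an end, and
  0 if \<open>T = {j}\<close>.\<close>

definition wt :: "nat set \<Rightarrow> nat \<Rightarrow> nat" where
  "wt T j = card {b. (j, b) \<in> inc T}"

definition adjacent :: "nat set \<Rightarrow> nat \<Rightarrow> nat \<Rightarrow> bool" where
  "adjacent T p q \<longleftrightarrow> p \<in> T \<and> q \<in> T \<and> p \<noteq> q \<and> (\<forall>t\<in>T. \<not> (p < t \<and> t < q) \<and> \<not> (q < t \<and> t < p))"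

text \<open>Compared with \<open>fam\<close>, elements of \<open>M\<close> are present exactly when
  all their coordinates are true. This changes which label set sits at the last vertex.\<close>

definition gfam :: "(nat set \<Rightarrow> 'a) \<Rightarrow> nat set \<Rightarrow> nat set \<Rightarrow> (nat \<times> bool) set \<Rightarrow> nat set \<Rightarrow> (nat \<times> bool \<Rightarrow> bool) \<Rightarrow> 'a" where
  "gfam f P M A T z = f (T - {j \<in> P. (\<forall>b. (j, b) \<in> A \<longrightarrow> z (j, b)) \<noteq> (j \<in> M)})"

lemma gfam_empty: "gfam f P {} A T = fam f P A T"
  by (simp add: gfam_def fam_def fun_eq_iff)

lemma gfam_split:
  assumes "j \<in> P"
  shows "gfam f P M A T z = (if (\<forall>e\<in>{j} \<times> {b. (j, b) \<in> A}. z e) \<noteq> (j \<in> M)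
    then gfam f (P - {j}) (M - {j}) A (T - {j}) z else gfam f (P - {j}) (M - {j}) A T z)"
  unfolding gfam_def using assms by (auto intro!: arg_cong[where f = f])

lemma gfam_supported: "supported (- ({j} \<times> B)) (gfam f (P - {j}) M A S)"
  unfolding supported_def gfam_def by (intro allI impI arg_cong[where f = f]) fastforce

lemma gfam_cong: "(\<And>j b. j \<in> P \<Longrightarrow> (j, b) \<in> A \<longleftrightarrow> (j, b) \<in> A') \<Longrightarrow> gfam f P M A = gfam f P M A'"
  unfolding gfam_def fun_eq_iff by (intro allI arg_cong[where f = f]) auto

lemma wt_eq: "wt T j = of_bool ((j, False) \<in> inc T) + of_bool ((j, True) \<in> inc T)"
proof -
  have "{b. (j, b) \<in> inc T} = (if (j, False) \<in> inc T then {False} else {}) \<union> (if (j, True) \<in> inc T then {True} else {})"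
    by (auto split: if_splits) (metis (full_types))+
  then show ?thesis unfolding wt_def by auto
qed

lemma indep_subset: "indep T P \<Longrightarrow> Q \<subseteq> P \<Longrightarrow> indep T Q"
  unfolding indep_def by blast

lemma indep_sub: "indep T P \<Longrightarrow> P \<subseteq> T"
  unfolding indep_def by blast

lemma indep_between:
  assumes "indep T P" "p \<in> P" "q \<in> P" "p \<noteq> q"
  shows "\<exists>t\<in>T. (p < t \<and> t < q) \<or> (q < t \<and> t < p)"
proof -
  have "p < q \<or> q < p" using assms(4) by linarith
  then show ?thesis using assms(1-3) unfolding indep_def by blast
qed

text \<open>Between \<open>i\<close> and \<open>j\<close> lies a further element of
  \<open>T\<close>, which remains on that side of \<open>i\<close> when \<open>j\<close> is
  removed.\<close>

lemma indep_inc_remove: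
  assumes "indep T P" "i \<in> P" "j \<in> P" "i \<noteq> j"
  shows "(i, b) \<in> inc (T - {j}) \<longleftrightarrow> (i, b) \<in> inc T"
proof -
  obtain t where "t \<in> T" "(i < t \<and> t < j) \<or> (j < t \<and> t < i)" using indep_between[OF assms] by blast
  then show ?thesis unfolding inc_def by (auto; metis less_irrefl less_trans)
qed

lemma indep_remove:
  assumes "indep T P" "j \<in> P" shows "indep (T - {j}) (P - {j})"
  unfolding indep_def
proof (intro conjI ballI impI)
  show "P - {j} \<subseteq> T - {j}" "P - {j} \<noteq> T - {j}" using assms unfolding indep_def by blast+
  fix p q assume pq: "p \<in> P - {j}" "q \<in> P - {j}" "p < q"
  obtain t where t: "t \<in> T" "p < t" "t < q" using assms pq unfolding indep_def by blast
  show "\<exists>t\<in>T - {j}. p < t \<and> t < q"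
  proof (cases "t = j")
    case True
    then obtain u where "u \<in> T" "p < u" "u < j" using assms pq t unfolding indep_def by blast
    then show ?thesis using True t by (intro bexI[of _ u]) auto
  qed (use t in blast)
qed

lemma indep_has_inc:
  assumes "indep T P" "j \<in> P" shows "\<exists>b. (j, b) \<in> inc T"
proof -
  obtain t where "t \<in> T" "t \<noteq> j" using assms unfolding indep_def by blast
  then have "(j, j < t) \<in> inc T" unfolding inc_def by (cases "j < t") (auto intro!: bexI[of _ t])
  then show ?thesis ..
qed

text \<open>If only \<open>p\<close> separates two members of \<open>insert q R\<close>, one of them
  is in \<open>R\<close>, and independence of \<open>insert p R\<close> supplies another separating
  element between that one and \<open>p\<close>.\<close>

lemma indep_swap:
  assumes p: "indep T (insert p R)" and q: "indep T (insert q R)" and "p \<notin> R" "q \<notin> R"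
    and adj: "adjacent T p q" and ne: "insert p (insert q R) \<noteq> T"
  shows "indep (T - {p}) (insert q R)"
proof -
  have r: "\<exists>t\<in>T - {p}. x < t \<and> t < y" if xy: "x \<in> R" "y \<in> insert q R" "x < y" for x y
  proof -
    obtain t where t: "t \<in> T" "x < t" "t < y" using q xy unfolding indep_def by blast
    show ?thesis
    proof (cases "t = p")
      case True
      then obtain u where "u \<in> T" "x < u" "u < p" using p xy(1) t unfolding indep_def by blast
      then show ?thesis using True t by (intro bexI[of _ u]) auto
    qed (use t in blast)
  qed
  have l: "\<exists>t\<in>T - {p}. q < t \<and> t < y" if xy: "y \<in> R" "q < y" for y
  proof -
    obtain t where t: "t \<in> T" "q < t" "t < y" using q xy unfolding indep_def by blast
    show ?thesis
    proof (cases "t = p")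
      case True
      then obtain u where "u \<in> T" "p < u" "u < y" using p xy(1) t unfolding indep_def by blast
      then show ?thesis using True t by (intro bexI[of _ u]) auto
    qed (use t in blast)
  qed
  show ?thesis
    unfolding indep_def
  proof (intro conjI ballI impI)
    show "insert q R \<subseteq> T - {p}" "insert q R \<noteq> T - {p}"
      using adj ne p assms(3) unfolding adjacent_def indep_def by blast+
    show "\<exists>t\<in>T - {p}. x < t \<and> t < y" if "x \<in> insert q R" "y \<in> insert q R" "x < y" for x y
      using that r l by blast
  qed
qed

lemma adjacent_sym: "adjacent T p q \<Longrightarrow> adjacent T q p"
  unfolding adjacent_def by blast

text \<open>Each of \<open>p\<close> and \<open>q\<close> has the other on one side, and
  \<open>l\<close>, \<open>r\<close> record whether anything lies beyond. When one of them is
  removed, the other inherits its outer side.\<close>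

lemma adjacent_wt:
  assumes "adjacent T p q"
  defines "l \<equiv> of_bool ((p, \<not> p < q) \<in> inc T)" and "r \<equiv> of_bool ((q, p < q) \<in> inc T)"
  shows "wt T p = 1 + l" "wt T q = 1 + r" "wt (T - {p}) q = l + r" "wt (T - {q}) p = l + r"
proof -
  have pq: "p \<in> T" "q \<in> T" "p \<noteq> q" and no: "\<And>t. t \<in> T \<Longrightarrow> \<not> (p < t \<and> t < q) \<and> \<not> (q < t \<and> t < p)"
    using assms(1) by (auto simp: adjacent_def)
  have n: "p < q \<Longrightarrow> t < q \<Longrightarrow> t \<noteq> p \<Longrightarrow> t < p" "p < q \<Longrightarrow> p < t \<Longrightarrow> t \<noteq> q \<Longrightarrow> q < t"
    "q < p \<Longrightarrow> q < t \<Longrightarrow> t \<noteq> p \<Longrightarrow> p < t" "q < p \<Longrightarrow> t < p \<Longrightarrow> t \<noteq> q \<Longrightarrow> t < q" if "t \<in> T" for t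
    using no[OF that] by linarith+
  have "p < q \<or> q < p" using pq(3) by linarith
  then have all: "(p, p < q) \<in> inc T \<and> (q, \<not> p < q) \<in> inc T \<and>
    ((q, \<not> p < q) \<in> inc (T - {p}) \<longleftrightarrow> (p, \<not> p < q) \<in> inc T) \<and>
    ((p, p < q) \<in> inc (T - {q}) \<longleftrightarrow> (q, p < q) \<in> inc T) \<and>
    ((q, p < q) \<in> inc (T - {p}) \<longleftrightarrow> (q, p < q) \<in> inc T) \<and>
    ((p, \<not> p < q) \<in> inc (T - {q}) \<longleftrightarrow> (p, \<not> p < q) \<in> inc T)"
  proof
    assume lt: "p < q"
    have "(\<exists>t\<in>T - {p}. t < q) \<longleftrightarrow> (\<exists>t\<in>T. t < p)" "(\<exists>t\<in>T - {q}. p < t) \<longleftrightarrow> (\<exists>t\<in>T. q < t)"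
      using n(1,2)[OF _ lt] less_trans[OF _ lt] less_trans[OF lt] less_not_refl by blast+
    moreover have "(\<exists>t\<in>T - {p}. q < t) \<longleftrightarrow> (\<exists>t\<in>T. q < t)" "(\<exists>t\<in>T - {q}. t < p) \<longleftrightarrow> (\<exists>t\<in>T. t < p)"
      using lt by (auto dest: less_trans)
    ultimately show ?thesis using lt pq by (auto simp: inc_def)
  next
    assume gt: "q < p"
    have "(\<exists>t\<in>T - {p}. q < t) \<longleftrightarrow> (\<exists>t\<in>T. p < t)" "(\<exists>t\<in>T - {q}. t < p) \<longleftrightarrow> (\<exists>t\<in>T. t < q)"
      using n(3,4)[OF _ gt] less_trans[OF _ gt] less_trans[OF gt] less_not_refl by blast+
    moreover have "(\<exists>t\<in>T - {p}. t < q) \<longleftrightarrow> (\<exists>t\<in>T. t < q)" "(\<exists>t\<in>T - {q}. p < t) \<longleftrightarrow> (\<exists>t\<in>T. p < t)"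
      using gt by (auto dest: less_trans)
    ultimately show ?thesis using gt pq by (auto simp: inc_def)
  qed
  show "wt T p = 1 + l" "wt T q = 1 + r" "wt (T - {p}) q = l + r" "wt (T - {q}) p = l + r"
    using all unfolding wt_eq l_def r_def by (cases "p < q"; simp)+
qed

section \<open>Exchange of neighbours, and filling of a single label\<close>

context cfcubeset
begin

lemma cond_cong: "(\<And>D. D \<subseteq> P \<Longrightarrow> f (T - D) = f' (T - D)) \<Longrightarrow> cond X f T P \<longleftrightarrow> cond X f' T P"
proof -
  assume "\<And>D. D \<subseteq> P \<Longrightarrow> f (T - D) = f' (T - D)"
  then have "fam f P (inc T) T = fam f' P (inc T) T" unfolding fam_def fun_eq_iff by auto
  then show ?thesis by (simp add: cond_def)
qed

lemma cond_rel:
  "p \<notin> R \<Longrightarrow> cond X f T (insert p R) \<longleftrightarrow> rel X (wt T p) (fam f R (inc T) T) (fam f R (inc T) (T - {p}))"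
  unfolding cond_def wt_def by (rule fam_rel) simp_all

lemma cond_rel_remove:
  assumes "indep T (insert p R)" "p \<notin> R" "q \<notin> R"
  shows "cond X f (T - {p}) (insert q R) \<longleftrightarrow>
    rel X (wt (T - {p}) q) (fam f R (inc T) (T - {p})) (fam f R (inc T) (T - {p} - {q}))"
proof -
  have "fam f R (inc (T - {p})) = fam f R (inc T)"
    by (rule fam_cong) (use indep_inc_remove[OF assms(1)] assms(2) in blast)
  then show ?thesis using cond_rel[OF assms(3), of f "T - {p}"] by simp
qed

text \<open>Holding the coordinates of an element of \<open>P' - P\<close> at false keeps it in
  place; for this it needs at least one coordinate.\<close>

lemma cond_mono:
  assumes "cond X f T P'" "P \<subseteq> P'" "\<And>j. j \<in> P' - P \<Longrightarrow> \<exists>b. (j, b) \<in> inc T"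
  shows "cond X f T P"
  unfolding cond_def
proof (rule fam_subst[OF assms(1)[unfolded cond_def], where s = "\<lambda>e z. fst e \<in> P \<and> z e"])
  fix z
  have "{j \<in> P'. \<forall>b. (j, b) \<in> inc T \<longrightarrow> fst (j, b) \<in> P \<and> z (j, b)} = {j \<in> P. \<forall>b. (j, b) \<in> inc T \<longrightarrow> z (j, b)}"
    using assms(2,3) by fastforce
  then show "f (T - {j \<in> P'. \<forall>b. (j, b) \<in> inc T \<longrightarrow> fst (j, b) \<in> P \<and> z (j, b)}) = fam f P (inc T) T z"
    by (simp add: fam_def)
qed simp

text \<open>Holding the coordinates of \<open>j\<close> at true removes it at every vertex, and the
  coordinates of the other elements are the same with and without \<open>j\<close>.\<close>

lemma cond_face:
  assumes i: "indep T (insert j P)" "j \<notin> P" and "cond X f T (insert j P)"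
  shows "cond X f (T - {j}) P"
  unfolding cond_def
proof (rule fam_subst[OF assms(3)[unfolded cond_def], where s = "\<lambda>e z. fst e \<noteq> j \<longrightarrow> z e"])
  fix z
  have "T - {i \<in> insert j P. \<forall>b. (i, b) \<in> inc T \<longrightarrow> fst (i, b) \<noteq> j \<longrightarrow> z (i, b)}
    = T - {j} - {i \<in> P. \<forall>b. (i, b) \<in> inc (T - {j}) \<longrightarrow> z (i, b)}"
    using indep_inc_remove[OF i(1), of _ j] i(2) by (auto simp: set_eq_iff)
  then show "f (T - {i \<in> insert j P. \<forall>b. (i, b) \<in> inc T \<longrightarrow> fst (i, b) \<noteq> j \<longrightarrow> z (i, b)})
    = fam f P (inc (T - {j})) (T - {j}) z" by (simp add: fam_def)
qed simp

text \<open>The condition \<open>(p, \<not> p < q) \<in> inc T\<close> says that \<open>T\<close> has elements on the side of \<open>p\<close> away from \<open>q\<close>.\<close>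

lemma swap_square:
  assumes p: "indep T (insert p R)" and q: "indep T (insert q R)" and R: "p \<notin> R" "q \<notin> R"
    and adj: "adjacent T p q"
  shows swap_inner: "(p, \<not> p < q) \<in> inc T \<Longrightarrow> cond X f T (insert p R) \<Longrightarrow> cond X f (T - {p}) (insert q R) \<Longrightarrow>
      cond X f (T - {q}) (insert p R) \<Longrightarrow> cond X f T (insert q R)"
    and swap_outer: "(p, \<not> p < q) \<in> inc T \<or> (q, p < q) \<in> inc T \<Longrightarrow> cond X f T (insert p R) \<Longrightarrow>
      cond X f T (insert q R) \<Longrightarrow> cond X f (T - {p}) (insert q R) \<Longrightarrow> cond X f (T - {q}) (insert p R)"
proof -
  \<comment> \<open>The families at \<open>T\<close>, \<open>T - {p}\<close>, \<open>T - {q}\<close>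
    and \<open>T - {p} - {q}\<close> form a square. The edges at \<open>T\<close> have weights
    \<open>1 + ?l\<close> (towards \<open>T - {p}\<close>) and \<open>1 + ?r\<close>, the other two
    both have \<open>?l + ?r\<close>. An edge follows from the other three by transitivity if each
    of them is at least as strong.\<close>
  let ?l = "of_bool ((p, \<not> p < q) \<in> inc T) :: nat" and ?r = "of_bool ((q, p < q) \<in> inc T) :: nat"
  let ?F = "fam f R (inc T)"
  have e: "T - {q} - {p} = T - {p} - {q}" by auto
  note iffs = cond_rel[OF R(1), of f T] cond_rel[OF R(2), of f T] cond_rel_remove[OF p R, of f]
    cond_rel_remove[OF q R(2,1), of f, unfolded e]
  note w = adjacent_wt[OF adj]
  show "cond X f T (insert q R)" if "(p, \<not> p < q) \<in> inc T" "cond X f T (insert p R)"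
    "cond X f (T - {p}) (insert q R)" "cond X f (T - {q}) (insert p R)"
  proof -
    have a: "rel X (1 + ?r) (?F T) (?F (T - {p}))" using that(1,2) unfolding iffs w by (auto intro: rel_mono)
    have c: "rel X (1 + ?r) (?F (T - {p})) (?F (T - {p} - {q}))" using that(1,3) unfolding iffs w by simp
    have d: "rel X (1 + ?r) (?F (T - {q})) (?F (T - {p} - {q}))" using that(1,4) unfolding iffs w by simp
    show ?thesis unfolding iffs w
      by (rule rel_trans[OF rel_trans[OF a c] rel_sym[OF d]]) simp_all
  qed
  show "cond X f (T - {q}) (insert p R)" if "(p, \<not> p < q) \<in> inc T \<or> (q, p < q) \<in> inc T"
    "cond X f T (insert p R)" "cond X f T (insert q R)" "cond X f (T - {p}) (insert q R)"
  proof -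
    have pos: "1 \<le> ?l + ?r" using that(1) by auto
    have a: "rel X (?l + ?r) (?F T) (?F (T - {p}))" using that(2) unfolding iffs w by (rule rel_mono) simp
    have b: "rel X (?l + ?r) (?F T) (?F (T - {q}))" using that(3) unfolding iffs w by (rule rel_mono) simp
    have c: "rel X (?l + ?r) (?F (T - {p})) (?F (T - {p} - {q}))" using that(4) unfolding iffs w .
    show ?thesis unfolding iffs w
      by (rule rel_trans[OF rel_sym[OF b pos] rel_trans[OF a c pos] pos])
  qed
qed

text \<open>Reversing one element exchanges the two sides of a relation, so this is the symmetry of
  \<open>rel\<close>, used once for each element of \<open>M\<close>. Symmetry needs positive
  weight, hence a coordinate for each of these elements.\<close>

lemma gfam_flip:
  assumes "finite M" "M \<subseteq> P" "\<And>j. j \<in> M \<Longrightarrow> \<exists>b. (j, b) \<in> A"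
  shows "cub (gfam f P M A T) \<longleftrightarrow> cub (fam f P A T)"
  using assms
proof (induction M rule: finite_induct)
  case (insert j M)
  let ?E = "{j} \<times> {b. (j, b) \<in> A}"
  let ?F = "gfam f (P - {j}) M A T" and ?G = "gfam f (P - {j}) M A (T - {j})"
  have j: "j \<in> P" "insert j M - {j} = M" "M - {j} = M" using insert by auto
  have pos: "1 \<le> card ?E" using insert.prems(2)[of j] by (auto simp: Suc_le_eq card_gt_0_iff)
  have fin: "finite ?E" by simp
  have "gfam f P (insert j M) A T = (\<lambda>z. if \<forall>e\<in>?E. z e then ?F z else ?G z)"
    unfolding gfam_split[OF j(1), abs_def] j by (rule ext) auto
  moreover have "gfam f P M A T = (\<lambda>z. if \<forall>e\<in>?E. z e then ?G z else ?F z)"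
    unfolding gfam_split[OF j(1), abs_def] j using insert.hyps(2) by (intro ext) auto
  moreover have "rel X (card ?E) ?G ?F \<longleftrightarrow> rel X (card ?E) ?F ?G"
    using rel_sym[OF _ pos] by blast
  ultimately have "cub (gfam f P (insert j M) A T) \<longleftrightarrow> cub (gfam f P M A T)"
    using rel_iff[OF fin refl gfam_supported gfam_supported] by simp
  then show ?case using insert by simp
qed (simp add: gfam_empty)

text \<open>Flipping the coordinates of the elements outside \<open>Q\<close> makes \<open>T - Q\<close> the label of exactly
  one vertex of the cube, which can therefore be found by filling a corner.\<close>

lemma cond_fill:
  assumes fin: "finite T" and P: "indep T P" "P \<noteq> {}" "Q \<subseteq> P"
    and present: "\<And>j. j \<in> Q \<Longrightarrow> cond X f T (P - {j})"
    and absent: "\<And>j. j \<in> P - Q \<Longrightarrow> cond X f (T - {j}) (P - {j})"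
  shows "\<exists>a. cond X (f(T - Q := a)) T P"
proof -
  define M where "M = P - Q"
  define I where "I = {(j, b) \<in> inc T. j \<in> P}"
  have PT: "P \<subseteq> T" using P(1) by (rule indep_sub)
  have finP: "finite P" using PT fin by (rule finite_subset)
  have finI: "finite I" by (rule finite_subset[of _ "P \<times> UNIV"]) (auto simp: I_def finP)
  have neI: "I \<noteq> {}" using P(2) indep_has_inc[OF P(1)] by (auto simp: I_def)
  let ?g = "gfam f P M (inc T) T"
  have sup: "supported I ?g"
    unfolding supported_def gfam_def I_def by (intro allI impI arg_cong[where f = f]) fastforce
  have "\<exists>g'. cub g' \<and> (\<forall>z. (\<exists>i\<in>I. \<not> z i) \<longrightarrow> g' z = ?g z)"
  proof (rule corner_cub[OF finI neI sup])
    fix e assume e: "e \<in> I"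
    obtain j b where jb: "e = (j, b)" "(j, b) \<in> inc T" "j \<in> P" using e by (auto simp: I_def)
    have has: "\<exists>b. (i, b) \<in> inc T" if "i \<in> M - {j}" for i
      using indep_has_inc[OF P(1)] that by (auto simp: M_def)
    have eq: "gfam f (P - {j}) (M - {j}) (inc T) S (z(e := False)) = gfam f (P - {j}) (M - {j}) (inc T) S z" for S z
      by (rule supportedD[OF gfam_supported[of j "{b}"]]) (auto simp: jb)
    have off: "\<not> (\<forall>e'\<in>{j} \<times> {b. (j, b) \<in> inc T}. (z(e := False)) e')" for z using jb by auto
    \<comment> \<open>Where a coordinate of \<open>j\<close> is false, \<open>j\<close> is
      constantly absent if it lies in \<open>M\<close> and constantly present otherwise; the two
      hypotheses cover these cases.\<close>
    show "cub (\<lambda>z. ?g (z(e := False)))"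
    proof (cases "j \<in> M")
      case True
      have "cub (gfam f (P - {j}) (M - {j}) (inc (T - {j})) (T - {j}))"
      proof (subst gfam_flip)
        show "finite (M - {j})" "M - {j} \<subseteq> P - {j}" using finP by (auto simp: M_def)
        show "\<exists>b. (i, b) \<in> inc (T - {j})" if "i \<in> M - {j}" for i
          using has[OF that] indep_inc_remove[OF P(1) _ jb(3)] that by (auto simp: M_def)
        show "cub (fam f (P - {j}) (inc (T - {j})) (T - {j}))"
          using absent[of j] True by (simp add: cond_def M_def)
      qed
      moreover have "gfam f (P - {j}) (M - {j}) (inc (T - {j})) = gfam f (P - {j}) (M - {j}) (inc T)"
        by (rule gfam_cong) (use indep_inc_remove[OF P(1) _ jb(3)] in blast)
      ultimately show ?thesis
        unfolding gfam_split[OF jb(3), abs_def] using off True eq by simp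
    next
      case False
      have "cub (gfam f (P - {j}) (M - {j}) (inc T) T)"
      proof (subst gfam_flip)
        show "finite (M - {j})" "M - {j} \<subseteq> P - {j}" using finP by (auto simp: M_def)
        show "cub (fam f (P - {j}) (inc T) T)"
          using present[of j] False jb(3) by (simp add: cond_def M_def)
      qed (use has in blast)
      then show ?thesis
        unfolding gfam_split[OF jb(3), abs_def] using off False eq by simp
    qed
  qed
  then obtain g' where g': "cub g'" "\<And>z e. e \<in> I \<Longrightarrow> \<not> z e \<Longrightarrow> g' z = ?g z" by blast
  define a where "a = g' (\<lambda>_. True)"
  have "cub (gfam (f(T - Q := a)) P M (inc T) T)"
  proof (rule cub_subst_eq[OF g'(1), where s = "\<lambda>e z. e \<in> I \<longrightarrow> z e"])
    fix z
    define D where "D = {j \<in> P. (\<forall>b. (j, b) \<in> inc T \<longrightarrow> z (j, b)) \<noteq> (j \<in> M)}"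
    show "g' (\<lambda>e. e \<in> I \<longrightarrow> z e) = gfam (f(T - Q := a)) P M (inc T) T z"
    proof (cases "\<forall>e\<in>I. z e")
      case True
      then have "D = Q" using P(3) by (auto simp: D_def I_def M_def)
      moreover have "(\<lambda>e. e \<in> I \<longrightarrow> z e) = (\<lambda>_. True)" using True by auto
      ultimately show ?thesis by (simp add: gfam_def D_def a_def)
    next
      case False
      then obtain j b where e: "(j, b) \<in> I" "\<not> z (j, b)" by auto
      \<comment> \<open>A false coordinate of \<open>j\<close> makes its presence the opposite of
        that in \<open>T - Q\<close>.\<close>
      then have "j \<in> D \<longleftrightarrow> j \<notin> Q" "j \<in> T" using PT by (auto simp: D_def I_def M_def)
      then have ne: "T - D \<noteq> T - Q" by blast
      have "g' (\<lambda>e. e \<in> I \<longrightarrow> z e) = ?g (\<lambda>e. e \<in> I \<longrightarrow> z e)" using e by (intro g'(2)[of "(j, b)"]) auto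
      also have "\<dots> = ?g z" by (rule supportedD[OF sup]) simp
      also have "\<dots> = gfam (f(T - Q := a)) P M (inc T) T z" using ne by (simp add: gfam_def D_def)
      finally show ?thesis .
    qed
  qed simp
  moreover have "finite M" "M \<subseteq> P" "\<And>j. j \<in> M \<Longrightarrow> \<exists>b. (j, b) \<in> inc T"
    using finP indep_has_inc[OF P(1)] by (auto simp: M_def)
  ultimately show ?thesis using gfam_flip[of M P "inc T"] unfolding cond_def by blast
qed

end

section \<open>Conditions at the full set of labels: reduction to the two parity classes\<close>

lemma indep_atMost:
  assumes "1 \<le> n" "P \<subseteq> {..n}" "\<And>j. j \<in> P \<Longrightarrow> Suc j \<notin> P"
  shows "indep {..n} P"
  unfolding indep_def
proof (intro conjI ballI impI)
  have "0 \<notin> P \<or> Suc 0 \<notin> P" using assms(3) by blast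
  then show "P \<noteq> {..n}" using assms(1) by auto
  fix p q assume pq: "p \<in> P" "q \<in> P" "p < q"
  then have "Suc p \<noteq> q" using assms(3) by blast
  then show "\<exists>t\<in>{..n}. p < t \<and> t < q" using pq assms(2) by (intro bexI[of _ "Suc p"]) auto
qed (rule assms(2))

lemma indep_atMost_Suc: "indep {..n} P \<Longrightarrow> j \<in> P \<Longrightarrow> Suc j \<notin> P"
  unfolding indep_def by (metis lessI less_Suc_eq_le not_less)

lemma adjacent_Suc: "Suc p \<le> n \<Longrightarrow> adjacent {..n} p (Suc p)"
  unfolding adjacent_def by auto

lemma inc_atMost: "(j, b) \<in> inc {..n} \<longleftrightarrow> (if b then j < n else 0 < j)"
  unfolding inc_def by (auto intro: bexI[of _ n] bexI[of _ 0])

lemma indep_parity: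
  assumes "1 \<le> n" shows "indep {..n} {j \<in> {..n}. even j = e}"
  by (rule indep_atMost[OF assms]) auto

context cfcubeset
begin

text \<open>Elements of \<open>P\<close> outside the parity class \<open>c\<close> are moved, one at a time, one step towards \<open>k\<close>
  and thereby into \<open>c\<close>; the sets without \<open>k\<close> are avoided.\<close>

lemma cond_shift:
  assumes n: "1 \<le> n" and k: "k \<le> n"
    and H: "\<And>T P. T \<subseteq> {..n} \<Longrightarrow> insert k T \<noteq> {..n} \<Longrightarrow> indep T P \<Longrightarrow> cond X f T P"
    and c: "c = {j \<in> {..n}. even j = e}" and cc: "cond X f {..n} c"
    and P: "indep {..n} P" "k \<in> P \<longleftrightarrow> k \<in> c"
  shows "cond X f {..n} P"
  using P
proof (induction "card (P - c)" arbitrary: P rule: less_induct)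
  case less
  note P = less.prems
  have PN: "P \<subseteq> {..n}" using P(1) by (rule indep_sub)
  then have finP: "finite P" by (rule finite_subset) simp
  \<comment> \<open>The new place \<open>p\<close> must not be an end of \<open>{..n}\<close>, so
    that the exchange square has enough weight, and no other element of \<open>P\<close> may be next
    to it. The sets \<open>{..n} - {p}\<close> and \<open>{..n} - {q}\<close> still contain
    \<open>k\<close>, so their conditions come from the horn.\<close>
  have step: "cond X f {..n} P" if q: "q \<in> P" "q \<notin> c" and p: "p \<in> c" "p \<noteq> k"
      and adj: "p = Suc q \<and> p < n \<or> q = Suc p \<and> 0 < p"
      and nb: "\<And>r. r \<in> P \<Longrightarrow> r \<noteq> q \<Longrightarrow> Suc r \<noteq> p \<and> Suc p \<noteq> r" for p q
  proof -
    define R where "R = P - {q}"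
    have qk: "q \<noteq> k" using q P(2) by auto
    have pn: "p \<le> n" "q \<le> n" using p q(1) c PN by auto
    have pR: "p \<notin> P"
    proof
      assume "p \<in> P"
      then show False using adj q(1) indep_atMost_Suc[OF P(1)] by blast
    qed
    have Pq: "P = insert q R" "q \<notin> R" "p \<notin> R" using q pR by (auto simp: R_def)
    have ip: "indep {..n} (insert p R)"
    proof (rule indep_atMost[OF n])
      show "insert p R \<subseteq> {..n}" using PN pn by (auto simp: R_def)
      show "Suc j \<notin> insert p R" if "j \<in> insert p R" for j
        using that nb indep_atMost_Suc[OF P(1)] by (auto simp: R_def)
    qed
    have iq: "indep {..n} (insert q R)" using P(1) Pq by simp
    have a: "adjacent {..n} p q" using adj adjacent_Suc[of q n] adjacent_Suc[of p n] pn adjacent_sym by blast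
    have outer: "(p, \<not> p < q) \<in> inc {..n}" using adj by (auto simp: inc_atMost)
    have ne: "insert p (insert q R) \<noteq> {..n}"
    proof -
      define r where "r = (if p < q then p - 1 else Suc p)"
      have "r \<noteq> p" "r \<noteq> q" "r \<le> n" "Suc r = p \<or> Suc p = r" using adj pn by (auto simp: r_def)
      moreover have "r \<notin> R" using nb[of r] calculation by (auto simp: R_def)
      ultimately show ?thesis by blast
    qed
    have cardlt: "card (insert p R - c) < card (P - c)"
    proof (rule psubset_card_mono)
      show "insert p R - c \<subset> P - c" using p(1) q by (auto simp: R_def)
    qed (use finP in simp)
    show ?thesis unfolding Pq(1)
    proof (rule swap_inner[OF ip iq Pq(3,2) a outer])
      show "cond X f {..n} (insert p R)"
        by (rule less.hyps[OF cardlt ip]) (use P(2) qk p(2) in \<open>auto simp: R_def\<close>)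
      show "cond X f ({..n} - {p}) (insert q R)"
        by (intro H indep_swap[OF ip iq Pq(3,2) a ne]) (use pn p(2) in auto)
      show "cond X f ({..n} - {q}) (insert p R)"
        by (intro H indep_swap[OF iq ip Pq(2,3) adjacent_sym[OF a]]) (use pn qk ne in auto)
    qed
  qed
  have inc: "j \<in> c \<longleftrightarrow> j \<le> n \<and> even j = e" for j using c by auto
  have nk: "q \<noteq> k" if "q \<in> P - c" for q using that P(2) by auto
  consider "P \<subseteq> c" | q where "q \<in> P - c" "k < q" | q where "q \<in> P - c" "q < k"
    using nk by (metis DiffI linorder_neqE_nat subsetI)
  then show ?case
  proof cases
    case 1
    show ?thesis by (rule cond_mono[OF cc 1]) (use indep_has_inc[OF indep_parity[OF n, of e]] c in blast)
  next
    case 2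
    define S where "S = {q \<in> P - c. k < q}"
    have S: "finite S" "S \<noteq> {}" using finP 2 by (auto simp: S_def)
    \<comment> \<open>The element nearest to \<open>k\<close> is moved first: then nothing else in
      \<open>P\<close> is next to the place it moves to.\<close>
    define q where "q = Min S"
    have qS: "q \<in> P" "q \<notin> c" "k < q" using Min_in[OF S] by (auto simp: S_def q_def)
    have least: "r \<notin> P - c" if "k < r" "r < q" for r
    proof
      assume "r \<in> P - c"
      then have "r \<in> S" using that(1) by (simp add: S_def)
      then show False using Min_le[OF S(1), of r] that(2) by (simp add: q_def)
    qed
    obtain p where p: "q = Suc p" using qS(3) by (cases q) auto
    have pc: "p \<in> c" using qS(1,2) PN unfolding inc p by auto
    have pk: "p \<noteq> k"
    proof
      assume "p = k"
      then have "k \<in> P" using pc P(2) by simp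
      then show False using indep_atMost_Suc[OF P(1), of k] qS(1) p \<open>p = k\<close> by simp
    qed
    show ?thesis
    proof (rule step[OF qS(1,2) pc pk])
      show "p = Suc q \<and> p < n \<or> q = Suc p \<and> 0 < p" using p pk qS(3) by auto
      show "Suc r \<noteq> p \<and> Suc p \<noteq> r" if "r \<in> P" "r \<noteq> q" for r
      proof (rule conjI)
        show "Suc p \<noteq> r" using that p by simp
        show "Suc r \<noteq> p"
        proof
          assume rp: "Suc r = p"
          then have "r \<notin> c" using pc unfolding inc by auto
          then have "r \<in> P - c" "r \<noteq> k" using that(1) P(2) by auto
          moreover have "k < r" using rp qS(3) p pk \<open>r \<noteq> k\<close> by simp
          ultimately show False using least[of r] rp p by simp
        qed
      qed
    qed
  next
    case 3
    define S where "S = {q \<in> P - c. q < k}"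
    have S: "finite S" "S \<noteq> {}" using finP 3 by (auto simp: S_def)
    define q where "q = Max S"
    have qS: "q \<in> P" "q \<notin> c" "q < k" using Max_in[OF S] by (auto simp: S_def q_def)
    have greatest: "r \<notin> P - c" if "q < r" "r < k" for r
    proof
      assume "r \<in> P - c"
      then have "r \<in> S" using that(2) by (simp add: S_def)
      then show False using Max_ge[OF S(1), of r] that(1) by (simp add: q_def)
    qed
    have pc: "Suc q \<in> c" using qS PN k unfolding inc by auto
    have pk: "Suc q \<noteq> k"
    proof
      assume "Suc q = k"
      then have "Suc q \<in> P" using pc P(2) by simp
      then show False using indep_atMost_Suc[OF P(1) qS(1)] by simp
    qed
    show ?thesis
    proof (rule step[OF qS(1,2) pc pk])
      show "Suc q = Suc q \<and> Suc q < n \<or> q = Suc (Suc q) \<and> 0 < Suc q" using pk qS(3) k by auto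
      show "Suc r \<noteq> Suc q \<and> Suc (Suc q) \<noteq> r" if "r \<in> P" "r \<noteq> q" for r
      proof (rule conjI)
        show "Suc r \<noteq> Suc q" using that by simp
        show "Suc (Suc q) \<noteq> r"
        proof
          assume rp: "Suc (Suc q) = r"
          then have "r \<notin> c" using pc unfolding inc by auto
          then have "r \<in> P - c" "r \<noteq> k" using that(1) P(2) by auto
          moreover have "r < k" using rp qS(3) pk \<open>r \<noteq> k\<close> by simp
          ultimately show False using greatest[of r] rp by simp
        qed
      qed
    qed
  qed
qed

text \<open>At \<open>{..n}\<close> the parity class that agrees with \<open>P\<close> about
  \<open>k\<close> is used. A condition at \<open>{..n} - {k}\<close> is a face of one at
  \<open>{..n}\<close>, unless \<open>P\<close> contains a neighbour of \<open>k\<close>; then it is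
  the fourth edge of the exchange square of \<open>k\<close> and this neighbour.\<close>

lemma K_labelling_of_parity:
  assumes n: "1 \<le> n" and k: "k \<le> n"
    and H: "\<And>T P. T \<subseteq> {..n} \<Longrightarrow> insert k T \<noteq> {..n} \<Longrightarrow> indep T P \<Longrightarrow> cond X f T P"
    and cc: "\<And>e. cond X f {..n} {j \<in> {..n}. even j = e}"
  shows "K_labelling X n f"
proof -
  \<comment> \<open>The parity \<open>even k = (k \<in> P)\<close> selects the class that contains
    \<open>k\<close> exactly if \<open>P\<close> does.\<close>
  have N: "cond X f {..n} P" if "indep {..n} P" for P
    by (rule cond_shift[OF n k H refl cc[of "even k = (k \<in> P)"] that]) (use k in auto)
  have F: "cond X f ({..n} - {k}) P" if P: "indep ({..n} - {k}) P" for P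
  proof -
    have PF: "P \<subseteq> {..n} - {k}" "P \<noteq> {..n} - {k}" using P by (auto simp: indep_def)
    have PI: "Suc j \<notin> P" if j: "j \<in> P" for j
    proof
      assume "Suc j \<in> P"
      then obtain t where "j < t \<and> t < Suc j \<or> Suc j < t \<and> t < j"
        using indep_between[OF P j, of "Suc j"] by auto
      then show False by linarith
    qed
    have iN: "indep {..n} P" using PF by (intro indep_atMost n PI) auto
    show ?thesis
    proof (cases "indep {..n} (insert k P)")
      case True
      then show ?thesis using PF by (intro cond_face N) auto
    next
      case False
      have "\<exists>p\<in>P. p = Suc k \<or> k = Suc p"
      proof (rule ccontr)
        assume no: "\<not> ?thesis"
        have "indep {..n} (insert k P)"
        proof (rule indep_atMost[OF n])
          show "insert k P \<subseteq> {..n}" using PF(1) k by auto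
          show "Suc j \<notin> insert k P" if "j \<in> insert k P" for j using that PI no by auto
        qed
        then show False using False by simp
      qed
      then obtain p where p: "p \<in> P" "p = Suc k \<or> k = Suc p" by blast
      define R where "R = P - {p}"
      have PR: "P = insert p R" "p \<notin> R" "k \<notin> R" using p PF by (auto simp: R_def)
      \<comment> \<open>Without \<open>k\<close> the numbers on its two sides are neighbours, so
        \<open>P\<close> contains only one of them.\<close>
      have far: "Suc r \<noteq> k \<and> Suc k \<noteq> r" if "r \<in> R" for r
      proof -
        have r: "r \<in> P" "r \<noteq> p" using that by (auto simp: R_def)
        obtain t where "t \<in> {..n} - {k}" "(p < t \<and> t < r) \<or> (r < t \<and> t < p)"
          using indep_between[OF P p(1) r(1)] r(2) by blast
        then show ?thesis using p(2) r(2) by auto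
      qed
      have ik: "indep {..n} (insert k R)"
      proof (rule indep_atMost[OF n])
        show "insert k R \<subseteq> {..n}" using PF k by (auto simp: R_def)
        show "Suc j \<notin> insert k R" if "j \<in> insert k R" for j
          using that far PI by (auto simp: R_def)
      qed
      have ip: "indep {..n} (insert p R)" using iN PR by simp
      have pn: "p \<le> n" using p PF by auto
      have a: "adjacent {..n} k p" using p(2) adjacent_Suc[of k n] adjacent_Suc[of p n] pn k adjacent_sym by blast
      have ne: "insert k (insert p R) \<noteq> {..n}" using PF PR by auto
      \<comment> \<open>The exchange needs an element beyond \<open>k\<close> or beyond
        \<open>p\<close>. If there were none, \<open>{..n}\<close> would be \<open>{k, p}\<close>
        and \<open>P\<close> would exhaust \<open>{..n} - {k}\<close>.\<close>
      have outer: "(k, \<not> k < p) \<in> inc {..n} \<or> (p, k < p) \<in> inc {..n}"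
        using p(2)
      proof
        assume pk: "p = Suc k"
        have "k \<noteq> 0 \<or> p \<noteq> n"
        proof (rule ccontr)
          assume "\<not> ?thesis"
          then have "{..n} = {k, p}" unfolding pk by (auto simp: le_Suc_eq)
          then show False using ne indep_sub[OF ip] indep_sub[OF ik] by blast
        qed
        then show ?thesis using pk pn by (auto simp: inc_atMost)
      next
        assume pk: "k = Suc p"
        have "p \<noteq> 0 \<or> k \<noteq> n"
        proof (rule ccontr)
          assume "\<not> ?thesis"
          then have "{..n} = {p, k}" unfolding pk by (auto simp: le_Suc_eq)
          then show False using ne indep_sub[OF ip] indep_sub[OF ik] by blast
        qed
        then show ?thesis using pk k by (auto simp: inc_atMost)
      qed
      have pk: "p \<noteq> k" using p(2) by auto
      have "insert k ({..n} - {p}) \<noteq> {..n}" using pn pk by blast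
      moreover have "insert p (insert k R) \<noteq> {..n}" using ne by (simp add: insert_commute)
      ultimately have ik': "cond X f ({..n} - {p}) (insert k R)"
        by (intro H indep_swap[OF ip ik PR(2,3) adjacent_sym[OF a]]) blast+
      have dir: "(\<not> p < k) = (k < p)" "(p < k) = (\<not> k < p)" using pk by linarith+
      show ?thesis unfolding PR(1)
      proof (rule swap_outer[OF ip ik PR(2,3) adjacent_sym[OF a]])
        show "(p, \<not> p < k) \<in> inc {..n} \<or> (k, p < k) \<in> inc {..n}"
          using outer unfolding dir(2) not_not by blast
      qed (intro N ip ik ik')+
    qed
  qed
  show ?thesis
    unfolding K_labelling_def
  proof (intro ballI allI impI)
    fix T P assume T: "T \<in> Sub n" and P: "indep T P"
    then have TN: "T \<subseteq> {..n}" by (auto simp: Sub_def simplex_def)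
    show "cond X f T P"
    proof (cases "insert k T = {..n}")
      case True
      have "T = {..n} \<or> T = {..n} - {k}"
      proof (cases "k \<in> T")
        case kT: True
        then show ?thesis using True by (simp add: insert_absorb)
      next
        case False
        then show ?thesis using True by blast
      qed
      then show ?thesis using N F P by blast
    qed (use H TN P in blast)
  qed
qed

text \<open>The parity class without \<open>k\<close> determines a value at \<open>{..n}\<close>, and then the one with \<open>k\<close> a value at
  \<open>{..n} - {k}\<close>; no other label is missing from the horn.\<close>

theorem K_labelling_fill:
  assumes n: "1 \<le> n" and k: "k \<le> n"
    and H: "\<And>T P. T \<subseteq> {..n} \<Longrightarrow> insert k T \<noteq> {..n} \<Longrightarrow> indep T P \<Longrightarrow> cond X f T P"
  obtains f' where "K_labelling X n f'" "\<And>S. S \<subseteq> {..n} \<Longrightarrow> insert k S \<noteq> {..n} \<Longrightarrow> f' S = f S"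
proof -
  define c0 where "c0 = {j \<in> {..n}. even j = (\<not> even k)}"
  define c1 where "c1 = {j \<in> {..n}. even j = even k}"
  have i0: "indep {..n} c0" and i1: "indep {..n} c1" unfolding c0_def c1_def by (rule indep_parity[OF n])+
  have k0: "k \<notin> c0" and k1: "k \<in> c1" using k by (auto simp: c0_def c1_def)
  have "(if k = 0 then 1 else k - 1) \<in> c0" using n k by (auto simp: c0_def)
  then have ne0: "c0 \<noteq> {}" by blast
  \<comment> \<open>With \<open>Q = {}\<close> the open label is \<open>{..n}\<close> itself. Each
    face of this cube removes some \<open>j \<noteq> k\<close> and lies in the horn.\<close>
  have "\<exists>a. cond X (f({..n} - {} := a)) {..n} c0"
  proof (rule cond_fill[OF _ i0 ne0])
    show "cond X f ({..n} - {j}) (c0 - {j})" if "j \<in> c0 - {}" for j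
      by (rule H[OF _ _ indep_remove[OF i0]]) (use that k0 in \<open>auto simp: c0_def\<close>)
  qed auto
  then obtain a where a: "cond X (f({..n} := a)) {..n} c0" by auto
  define f1 where "f1 = f({..n} := a)"
  have H1: "cond X f1 T P" if "T \<subseteq> {..n}" "insert k T \<noteq> {..n}" "indep T P" for T P
  proof -
    have "f1 (T - D) = f (T - D)" for D using that k by (auto simp: f1_def)
    then show ?thesis using H[OF that] cond_cong[of P f1 T f] by simp
  qed
  have N1: "cond X f1 {..n} P" if "indep {..n} P" "k \<notin> P" for P
    by (rule cond_shift[OF n k H1 c0_def a[folded f1_def]]) (use that k0 in auto)
  \<comment> \<open>With \<open>Q = {k}\<close> the open label is \<open>{..n} - {k}\<close>. The
    faces that keep \<open>k\<close> are conditions just obtained from the first value; the others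
    remove some \<open>j \<noteq> k\<close> and lie in the horn.\<close>
  have "\<exists>b. cond X (f1({..n} - {k} := b)) {..n} c1"
  proof (rule cond_fill[OF _ i1])
    show "cond X f1 {..n} (c1 - {j})" if "j \<in> {k}" for j
      using that by (intro N1 indep_subset[OF i1]) auto
    show "cond X f1 ({..n} - {j}) (c1 - {j})" if "j \<in> c1 - {k}" for j
      by (rule H1[OF _ _ indep_remove[OF i1]]) (use that k in \<open>auto simp: c1_def\<close>)
  qed (use k1 in auto)
  then obtain b where b: "cond X (f1({..n} - {k} := b)) {..n} c1" by blast
  define f2 where "f2 = f1({..n} - {k} := b)"
  have keep: "f2 S = f S" if "insert k S \<noteq> {..n}" for S
    using that k by (auto simp: f1_def f2_def)
  have H2: "cond X f2 T P" if "T \<subseteq> {..n}" "insert k T \<noteq> {..n}" "indep T P" for T P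
  proof -
    have "f2 (T - D) = f (T - D)" for D by (rule keep) (use that k in auto)
    then show ?thesis using H[OF that] cond_cong[of P f2 T f] by simp
  qed
  \<comment> \<open>Removing part of \<open>c0\<close> never removes \<open>k\<close>, so the second
    value cannot disturb the first condition.\<close>
  have c0': "cond X f2 {..n} c0"
  proof -
    have "f2 ({..n} - D) = f1 ({..n} - D)" if "D \<subseteq> c0" for D
      using that k0 k unfolding f2_def by auto
    then show ?thesis using cond_cong[of c0 f2 "{..n}" f1] a by (simp add: f1_def)
  qed
  have "K_labelling X n f2"
  proof (rule K_labelling_of_parity[OF n k H2])
    show "cond X f2 {..n} {j \<in> {..n}. even j = e}" for e
      using c0' b by (cases "e = even k") (auto simp: c0_def c1_def f2_def)
  qed
  then show thesis using keep by (rule that)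
qed

end

section \<open>The Kan condition\<close>

text \<open>A monotone left inverse of the enumeration of \<open>T\<close>, defined on all numbers:
  below the least element of \<open>T\<close> the truncated subtraction gives 0.\<close>

definition rank :: "nat set \<Rightarrow> nat \<Rightarrow> nat" where
  "rank T j = card {t \<in> T. t \<le> j} - 1"

lemma rank_enumeration:
  assumes \<sigma>: "\<sigma> ` {..k} = T" "strict_mono_on {..k} \<sigma>" and a: "a \<le> k"
  shows "rank T (\<sigma> a) = a"
proof -
  have le: "\<sigma> i \<le> \<sigma> a \<longleftrightarrow> i \<le> a" if "i \<le> k" for i
    using \<sigma>(2) that a by (simp add: strict_mono_on_leD strict_mono_on_less_eq)
  have inj: "inj_on \<sigma> {..k}" using \<sigma>(2) by (rule strict_mono_on_imp_inj_on)
  have "{t \<in> T. t \<le> \<sigma> a} = \<sigma> ` {..a}" using le a unfolding \<sigma>(1)[symmetric] by auto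
  then have "card {t \<in> T. t \<le> \<sigma> a} = Suc a"
    using inj a by (simp add: card_image inj_on_subset)
  then show ?thesis by (simp add: rank_def)
qed

lemma rank_map:
  assumes "T \<in> Sub n" "card T = Suc k"
  shows "(\<lambda>j\<in>simplex n. rank T j) \<in> simplex_maps n k"
proof -
  have fin: "finite T" using assms(1) by (auto simp: Sub_def simplex_def finite_subset)
  have "rank T j \<le> k" for j
    using card_mono[OF fin, of "{t \<in> T. t \<le> j}"] assms(2) by (simp add: rank_def)
  moreover have "rank T i \<le> rank T j" if "i \<le> j" for i j
    unfolding rank_def using fin that by (intro diff_le_mono card_mono) auto
  ultimately show ?thesis by (auto simp: simplex_maps_def simplex_def mono_on_def)
qed

definition enum_of :: "nat set \<Rightarrow> nat \<Rightarrow> nat" where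
  "enum_of S = (SOME \<tau>. \<tau> \<in> extensional {..card S - 1} \<and> \<tau> ` {..card S - 1} = S \<and> strict_mono_on {..card S - 1} \<tau>)"

lemma enum_of:
  assumes "finite S" "S \<noteq> {}"
  shows "enum_of S \<in> extensional {..card S - 1} \<and> enum_of S ` {..card S - 1} = S \<and>
    strict_mono_on {..card S - 1} (enum_of S)"
proof -
  obtain k \<sigma> where e: "\<sigma> \<in> extensional {..k}" "\<sigma> ` {..k} = S" "strict_mono_on {..k} \<sigma>" "card S = Suc k"
    using assms by (rule ex_enumeration)
  then have "\<exists>\<tau>. \<tau> \<in> extensional {..card S - 1} \<and> \<tau> ` {..card S - 1} = S \<and> strict_mono_on {..card S - 1} \<tau>"
    by (intro exI[of _ \<sigma>]) simp
  from someI_ex[OF this] show ?thesis unfolding enum_of_def .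
qed

lemma sections_Kstar [simp]: "sections (Kstar X) n = cubeset_hom (K n) X"
  by (simp add: Kstar_def)

lemma K_push_compose:
  assumes "c \<in> sections (K k) m" "\<psi> \<in> cube_maps l m"
  shows "K_push l \<sigma> (compose (cube l) c \<psi>) = compose (cube l) (K_push m \<sigma> c) \<psi>"
proof -
  have "\<psi> x \<in> cube m" if "x \<in> cube l" for x using assms(2) that by (auto simp: cube_maps_def)
  then show ?thesis by (auto simp: K_push_def compose_def fun_eq_iff)
qed

context cfcubeset
begin

lemma Kstar_restr_in:
  assumes "\<sigma> \<in> simplex_maps k n" "s \<in> cubeset_hom (K n) X"
  shows "restr (Kstar X) k n \<sigma> s \<in> cubeset_hom (K k) X"
proof -
  have "restr (Kstar X) k n \<sigma> s = (\<lambda>m. \<lambda>c\<in>sections (K k) m. s m (K_push m \<sigma> c))"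
    by (simp add: Kstar_def)
  moreover have "(\<lambda>m. \<lambda>c\<in>sections (K k) m. s m (K_push m \<sigma> c)) \<in> cubeset_hom (K k) X"
    unfolding psh_hom_def
  proof (intro CollectI conjI allI ballI)
    show "(\<lambda>c\<in>sections (K k) m. s m (K_push m \<sigma> c)) \<in> sections (K k) m \<rightarrow>\<^sub>E sections X m" for m
      using hom_in[OF assms(2) K_push_in[OF assms(1)]] by auto
    fix l m \<psi> c assume \<psi>: "\<psi> \<in> cube_maps l m" and c: "c \<in> sections (K k) m"
    have "s l (compose (cube l) (K_push m \<sigma> c) \<psi>) = restr X l m \<psi> (s m (K_push m \<sigma> c))"
      using assms(2) \<psi> K_push_in[OF assms(1) c] unfolding psh_hom_def K_def by auto
    moreover have "restr (K k) l m \<psi> c = compose (cube l) c \<psi>" by (simp add: K_def)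
    ultimately show "(\<lambda>c\<in>sections (K k) l. s l (K_push l \<sigma> c)) (restr (K k) l m \<psi> c) =
         restr X l m \<psi> ((\<lambda>c\<in>sections (K k) m. s m (K_push m \<sigma> c)) c)"
      using K_restr_in[OF \<psi> c] c K_push_compose[OF c \<psi>] by simp
  qed
  ultimately show ?thesis by simp
qed

lemma val_restr:
  assumes "S \<in> Sub k"
  shows "val (restr (Kstar X) k n \<sigma> s) S = val s (\<sigma> ` S)"
proof -
  have "K_push 0 \<sigma> (\<lambda>u\<in>cube 0. S) = (\<lambda>u\<in>cube 0. \<sigma> ` S)" 
    by (rule ext) (simp add: K_push_def restrict_def)
  then show ?thesis using K_const[OF assms, of 0] by (simp add: val_def Kstar_def)
qed

lemma simplicial_set_Kstar: "simplicial_set (Kstar X)"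
  unfolding presheaf_def sections_Kstar
proof (intro conjI allI ballI)
  show in1: "restr (Kstar X) m n \<phi> c \<in> cubeset_hom (K m) X" if "\<phi> \<in> simplex_maps m n" "c \<in> cubeset_hom (K n) X" for m n \<phi> c
    using that by (rule Kstar_restr_in)
  fix n c assume c: "c \<in> cubeset_hom (K n) X"
  show "restr (Kstar X) n n (\<lambda>p\<in>simplex n. p) c = c"
  proof (rule hom_eqI[OF in1[OF id_simplex_map c] c])
    fix S assume S: "S \<in> Sub n"
    then have "(\<lambda>p\<in>simplex n. p) ` S = S" by (force simp: Sub_def)
    then show "val (restr (Kstar X) n n (\<lambda>p\<in>simplex n. p) c) S = val c S" using val_restr[OF S] by simp
  qed
next
  fix l m n \<psi> \<phi> c assume \<psi>: "\<psi> \<in> simplex_maps l m" and \<phi>: "\<phi> \<in> simplex_maps m n" and c: "c \<in> cubeset_hom (K n) X"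
  show "restr (Kstar X) l n (compose (simplex l) \<phi> \<psi>) c = restr (Kstar X) l m \<psi> (restr (Kstar X) m n \<phi> c)"
  proof (rule hom_eqI)
    show "restr (Kstar X) l n (compose (simplex l) \<phi> \<psi>) c \<in> cubeset_hom (K l) X"
      by (rule Kstar_restr_in[OF compose_simplex_maps[OF \<phi> \<psi>] c])
    show "restr (Kstar X) l m \<psi> (restr (Kstar X) m n \<phi> c) \<in> cubeset_hom (K l) X"
      by (rule Kstar_restr_in[OF \<psi> Kstar_restr_in[OF \<phi> c]])
    fix S assume S: "S \<in> Sub l"
    then have "compose (simplex l) \<phi> \<psi> ` S = \<phi> ` \<psi> ` S" by (force simp: Sub_def compose_def)
    then show "val (restr (Kstar X) l n (compose (simplex l) \<phi> \<psi>) c) S =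
        val (restr (Kstar X) l m \<psi> (restr (Kstar X) m n \<phi> c)) S"
      using val_restr[OF S] val_restr[OF Sub_image[OF \<psi> S]] by simp
  qed
qed

text \<open>The simplices of a horn are compatible, so their labels combine to one labelling
  \<open>f\<close> of all sets that do not become \<open>{..n}\<close> by adding \<open>k\<close>.
  Pulling a simplex of the horn back along \<open>rank\<close> shows that \<open>f\<close> satisfies
  the conditions there, and \<open>K_labelling_fill\<close> applies.\<close>

lemma Kstar_horn_filler:
  assumes n: "1 \<le> n" and k: "k \<le> n" and h: "h \<in> sset_hom (horn n k) (Kstar X)"
  shows "\<exists>s\<in>cubeset_hom (K n) X. \<forall>m. \<forall>\<sigma>\<in>sections (horn n k) m. restr (Kstar X) m n \<sigma> s = h m \<sigma>"
proof -
  have horn: "\<sigma> \<in> sections (horn n k) m \<longleftrightarrow> \<sigma> \<in> simplex_maps m n \<and> insert k (\<sigma> ` {..m}) \<noteq> {..n}" for \<sigma> m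
  proof (cases "\<sigma> \<in> simplex_maps m n")
    case True
    then have "\<sigma> ` {..m} \<subseteq> {..n}" by (auto simp: simplex_maps_def simplex_def)
    then show ?thesis using True k by (auto simp: horn_def simplex_def)
  qed (simp add: horn_def)
  have hin: "h m \<sigma> \<in> cubeset_hom (K m) X" if "\<sigma> \<in> sections (horn n k) m" for m \<sigma>
  proof -
    have "h m \<in> sections (horn n k) m \<rightarrow>\<^sub>E sections (Kstar X) m" using h unfolding psh_hom_def by blast
    from PiE_mem[OF this that] show ?thesis by simp
  qed
  have hnat: "h l (compose (simplex l) \<sigma> \<tau>) = restr (Kstar X) l m \<tau> (h m \<sigma>)"
    if "\<tau> \<in> simplex_maps l m" "\<sigma> \<in> sections (horn n k) m" for l m \<sigma> \<tau>
    using h that unfolding psh_hom_def by (auto simp: horn_def representable_def)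
  define r :: "nat set \<Rightarrow> nat" where "r S = card S - 1" for S
  define \<tau> where "\<tau> = enum_of"
  have Subfin: "finite S \<and> S \<noteq> {}" if "S \<in> Sub m" for S m
    using that by (auto simp: Sub_def simplex_def finite_subset)
  have \<tau>: "\<tau> S \<in> simplex_maps (r S) m" "\<tau> S ` {..r S} = S" "strict_mono_on {..r S} (\<tau> S)" "card S = Suc (r S)"
    if "S \<in> Sub m" for S m
  proof -
    have e: "\<tau> S \<in> extensional {..r S}" "\<tau> S ` {..r S} = S" "strict_mono_on {..r S} (\<tau> S)" "card S = Suc (r S)"
      using enum_of[of S] Subfin[OF that] by (auto simp: r_def \<tau>_def card_gt_0_iff)
    then show "\<tau> S ` {..r S} = S" "strict_mono_on {..r S} (\<tau> S)" "card S = Suc (r S)" by blast+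
    show "\<tau> S \<in> simplex_maps (r S) m"
      by (rule enumeration_map[OF that e(1,2)]) (use e(3) in \<open>auto simp: strict_mono_on_def\<close>)
  qed
  have top: "{..m} \<in> Sub m" for m by (auto simp: Sub_def simplex_def)
  define f where "f S = val (h (r S) (\<tau> S)) {..r S}" for S
  \<comment> \<open>The enumeration of \<open>U\<close> followed by \<sigma> factors through the
    enumeration of \<open>S\<close> by a surjection \<pi>. Naturality of \<open>h\<close> for both
    factorizations compares the labels of the full simplices.\<close>
  have hval: "val (h m \<sigma>) U = f (\<sigma> ` U)" if \<sigma>: "\<sigma> \<in> sections (horn n k) m" and U: "U \<in> Sub m" for m \<sigma> U
  proof -
    define S where "S = \<sigma> ` U"
    have \<sigma>m: "\<sigma> \<in> simplex_maps m n" using \<sigma> horn by blast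
    have S: "S \<in> Sub n" unfolding S_def by (rule Sub_image[OF \<sigma>m U])
    have Sh: "\<tau> S \<in> sections (horn n k) (r S)"
    proof -
      have "insert k (\<sigma> ` {..m}) \<subset> {..n}" using \<sigma> horn \<sigma>m k by (auto simp: simplex_maps_def simplex_def)
      moreover have "S \<subseteq> \<sigma> ` {..m}" using U by (auto simp: S_def Sub_def simplex_def)
      ultimately have "insert k S \<noteq> {..n}" by blast
      then show ?thesis using \<tau>[OF S] horn by simp
    qed
    define \<upsilon> where "\<upsilon> = \<tau> U"
    have \<upsilon>: "\<upsilon> \<in> simplex_maps (r U) m" "\<upsilon> ` {..r U} = U" using \<tau>[OF U] by (simp_all add: \<upsilon>_def)
    define \<pi> where "\<pi> = compose (simplex (r U)) (\<lambda>j\<in>simplex n. rank S j) (compose (simplex (r U)) \<sigma> \<upsilon>)"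
    have \<pi>: "\<pi> \<in> simplex_maps (r U) (r S)"
      unfolding \<pi>_def
      by (rule compose_simplex_maps[OF rank_map[OF S \<tau>(4)[OF S]] compose_simplex_maps[OF \<sigma>m \<upsilon>(1)]])
    have inS: "\<sigma> (\<upsilon> a) \<in> S" if "a \<le> r U" for a using \<upsilon>(2) that by (auto simp: S_def)
    have Sn: "S \<subseteq> simplex n" using S by (simp add: Sub_def)
    have \<pi>a: "\<pi> a = rank S (\<sigma> (\<upsilon> a))" if "a \<le> r U" for a
      using that inS[OF that] Sn by (auto simp: \<pi>_def compose_def simplex_def)
    have rk: "rank S (\<tau> S a) = a" if "a \<le> r S" for a
      using rank_enumeration[OF \<tau>(2,3)[OF S] that] .
    have kr: "\<tau> S (rank S t) = t \<and> rank S t \<le> r S" if "t \<in> S" for t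
    proof -
      have "t \<in> \<tau> S ` {..r S}" using that \<tau>(2)[OF S] by simp
      then show ?thesis using rk by auto
    qed
    have eq: "compose (simplex (r U)) (\<tau> S) \<pi> = compose (simplex (r U)) \<sigma> \<upsilon>"
      using kr inS \<pi>a by (auto simp: compose_def simplex_def fun_eq_iff)
    have "\<pi> ` {..r U} = rank S ` \<sigma> ` \<upsilon> ` {..r U}" using \<pi>a by force
    also have "\<dots> = rank S ` S" by (simp add: \<upsilon>(2) S_def)
    also have "\<dots> = {..r S}"
    proof
      show "rank S ` S \<subseteq> {..r S}" using kr by auto
      show "{..r S} \<subseteq> rank S ` S"
      proof
        fix a assume "a \<in> {..r S}"
        then have "a = rank S (\<tau> S a)" "\<tau> S a \<in> S" using rk \<tau>(2)[OF S] by auto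
        then show "a \<in> rank S ` S" by (rule image_eqI)
      qed
    qed
    finally have surj: "\<pi> ` {..r U} = {..r S}" .
    have "val (h m \<sigma>) U = val (restr (Kstar X) (r U) m \<upsilon> (h m \<sigma>)) {..r U}"
      using val_restr[OF top] \<upsilon>(2) by simp
    also have "restr (Kstar X) (r U) m \<upsilon> (h m \<sigma>) = restr (Kstar X) (r U) (r S) \<pi> (h (r S) (\<tau> S))"
      using hnat[OF \<upsilon>(1) \<sigma>] hnat[OF \<pi> Sh] eq by simp
    also have "val \<dots> {..r U} = val (h (r S) (\<tau> S)) {..r S}"
      using val_restr[OF top] surj by simp
    finally show ?thesis by (simp add: f_def S_def)
  qed
  have H: "cond X f T P" if T: "T \<subseteq> {..n}" "insert k T \<noteq> {..n}" and P: "indep T P" for T P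
  proof -
    have TS: "T \<in> Sub n" using T(1) P by (auto simp: Sub_def simplex_def indep_def)
    have \<tau>h: "\<tau> T \<in> sections (horn n k) (r T)" using \<tau>[OF TS] horn T(2) by simp
    define \<rho> where "\<rho> = (\<lambda>j\<in>simplex n. rank T j)"
    have \<rho>: "\<rho> \<in> simplex_maps n (r T)" unfolding \<rho>_def by (rule rank_map[OF TS \<tau>(4)[OF TS]])
    \<comment> \<open>This n-simplex has the labels of the horn on all subsets of \<open>T\<close>,
      so the conditions known for simplices can be quoted for \<open>T\<close> in its original
      position.\<close>
    define s where "s = restr (Kstar X) n (r T) \<rho> (h (r T) (\<tau> T))"
    have "cond X (val s) T P"
      using hom_labelling[OF Kstar_restr_in[OF \<rho> hin[OF \<tau>h]]] TS P unfolding K_labelling_def s_def by blast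
    moreover have "val s (T - D) = f (T - D)" if D: "D \<subseteq> P" for D
    proof -
      have TD: "T - D \<in> Sub n" using D T(1) P by (auto simp: Sub_def simplex_def indep_def)
      have "\<tau> T ` \<rho> ` (T - D) = T - D"
      proof -
        have "\<tau> T (\<rho> t) = t" if "t \<in> T" for t
        proof -
          have "t \<in> \<tau> T ` {..r T}" using that \<tau>(2)[OF TS] by simp
          then show ?thesis
            using rank_enumeration[OF \<tau>(2,3)[OF TS]] that T(1) by (auto simp: \<rho>_def simplex_def)
        qed
        then show ?thesis unfolding image_image by (auto simp: image_iff)
      qed
      then show ?thesis
        using val_restr[OF TD] hval[OF \<tau>h Sub_image[OF \<rho> TD]] by (simp add: s_def)
    qed
    ultimately show ?thesis using cond_cong[of P "val s" T f] by blast
  qed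
  obtain f' where f': "K_labelling X n f'" "\<And>S. S \<subseteq> {..n} \<Longrightarrow> insert k S \<noteq> {..n} \<Longrightarrow> f' S = f S"
    using K_labelling_fill[OF n k H] by blast
  obtain s where s: "s \<in> cubeset_hom (K n) X" "\<And>S. S \<in> Sub n \<Longrightarrow> val s S = f' S"
    using hom_of_labelling[OF f'(1)] by blast
  show ?thesis
  proof (intro bexI[OF _ s(1)] allI ballI)
    fix m \<sigma> assume \<sigma>: "\<sigma> \<in> sections (horn n k) m"
    then have \<sigma>m: "\<sigma> \<in> simplex_maps m n" using horn by blast
    show "restr (Kstar X) m n \<sigma> s = h m \<sigma>"
    proof (rule hom_eqI[OF Kstar_restr_in[OF \<sigma>m s(1)] hin[OF \<sigma>]])
      fix U assume U: "U \<in> Sub m"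
      have S: "\<sigma> ` U \<in> Sub n" by (rule Sub_image[OF \<sigma>m U])
      have "insert k (\<sigma> ` {..m}) \<subset> {..n}" using \<sigma> horn \<sigma>m k by (auto simp: simplex_maps_def simplex_def)
      moreover have "\<sigma> ` U \<subseteq> \<sigma> ` {..m}" using U by (auto simp: Sub_def simplex_def)
      ultimately have "insert k (\<sigma> ` U) \<noteq> {..n}" by blast
      then have "f' (\<sigma> ` U) = f (\<sigma> ` U)" using f'(2) S by (auto simp: Sub_def simplex_def)
      then show "val (restr (Kstar X) m n \<sigma> s) U = val (h m \<sigma>) U"
        using val_restr[OF U] s(2)[OF S] hval[OF \<sigma> U] by simp
    qed
  qed
qed

theorem kan_complex_Kstar: "kan_complex (Kstar X)"
  unfolding kan_complex_def extends_along_def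
proof (intro conjI allI impI ballI simplicial_set_Kstar)
  fix n k h assume n: "1 \<le> n" "k \<le> n" and h: "h \<in> sset_hom (horn n k) (Kstar X)"
  obtain s where s: "s \<in> cubeset_hom (K n) X"
      "\<And>m \<sigma>. \<sigma> \<in> sections (horn n k) m \<Longrightarrow> restr (Kstar X) m n \<sigma> s = h m \<sigma>"
    using Kstar_horn_filler[OF n h] by blast
  define g where "g m = (\<lambda>\<sigma>\<in>simplex_maps m n. restr (Kstar X) m n \<sigma> s)" for m
  have "g \<in> sset_hom (std_simplex n) (Kstar X)"
    unfolding psh_hom_def
  proof (intro CollectI conjI allI ballI)
    show "g m \<in> sections (std_simplex n) m \<rightarrow>\<^sub>E sections (Kstar X) m" for m
      using Kstar_restr_in[OF _ s(1)] by (auto simp: g_def representable_def)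
    fix l m \<psi> \<sigma> assume \<psi>: "\<psi> \<in> simplex_maps l m" and "\<sigma> \<in> sections (std_simplex n) m"
    then have \<sigma>: "\<sigma> \<in> simplex_maps m n" by (simp add: representable_def)
    have "restr (Kstar X) l n (compose (simplex l) \<sigma> \<psi>) s = restr (Kstar X) l m \<psi> (restr (Kstar X) m n \<sigma> s)"
      using simplicial_set_Kstar \<psi> \<sigma> s(1) unfolding presheaf_def sections_Kstar by blast
    then show "g l (restr (std_simplex n) l m \<psi> \<sigma>) = restr (Kstar X) l m \<psi> (g m \<sigma>)"
      using \<psi> \<sigma> compose_simplex_maps[OF \<sigma> \<psi>] by (simp add: g_def representable_def)
  qed
  moreover have "\<forall>m. \<forall>c\<in>sections (horn n k) m. g m c = h m c"
    using s(2) by (auto simp: g_def horn_def)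
  ultimately show "\<exists>g\<in>sset_hom (std_simplex n) (Kstar X). \<forall>m. \<forall>c\<in>sections (horn n k) m. g m c = h m c"
    by blast
qed

end

section \<open>Components\<close>

lemma psh_hom_in: "f \<in> psh_hom mor X Y \<Longrightarrow> c \<in> sections X n \<Longrightarrow> f n c \<in> sections Y n"
  unfolding psh_hom_def by blast

lemma psh_hom_restr: "f \<in> psh_hom mor X Y \<Longrightarrow> \<phi> \<in> mor m n \<Longrightarrow> c \<in> sections X n \<Longrightarrow>
    f m (restr X m n \<phi> c) = restr Y m n \<phi> (f n c)"
  unfolding psh_hom_def by blast

lemma hom_vert_commute:
  "f \<in> cubeset_hom X Y \<Longrightarrow> c \<in> sections X n \<Longrightarrow> v \<in> cube n \<Longrightarrow> vert Y n (f n c) v = f 0 (vert X n c v)"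
  unfolding vert_def using psh_hom_restr[of f cube_maps X Y "\<lambda>u\<in>cube 0. v" 0 n c] point_map[of v n] by simp

lemma Kstar_map_in:
  assumes f: "f \<in> cubeset_hom X Y" and s: "s \<in> cubeset_hom (K n) X"
  shows "Kstar_map f n s \<in> cubeset_hom (K n) Y"
  unfolding psh_hom_def
proof (intro CollectI conjI allI ballI)
  show "Kstar_map f n s m \<in> sections (K n) m \<rightarrow>\<^sub>E sections Y m" for m
    using psh_hom_in[OF f psh_hom_in[OF s]] by (auto simp: Kstar_map_def)
  fix l m \<psi> c assume \<psi>: "\<psi> \<in> cube_maps l m" and c: "c \<in> sections (K n) m"
  have "restr (K n) l m \<psi> c \<in> sections (K n) l" using K_restr_in[OF \<psi> c] by (simp add: K_def)
  then show "Kstar_map f n s l (restr (K n) l m \<psi> c) = restr Y l m \<psi> (Kstar_map f n s m c)"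
    using c psh_hom_restr[OF s \<psi> c] psh_hom_restr[OF f \<psi> psh_hom_in[OF s c]]
    by (simp add: Kstar_map_def)
qed

lemma val_Kstar_map: "S \<in> Sub n \<Longrightarrow> val (Kstar_map f n s) S = f 0 (val s S)"
  using K_const[of S n 0] by (simp add: val_def Kstar_map_def)

lemma face_map: "1 \<le> n \<Longrightarrow> (\<lambda>j\<in>simplex (n - 1). if j < i then j else Suc j) \<in> simplex_maps (n - 1) n"
  by (auto simp: simplex_maps_def simplex_def mono_on_def)

lemma Sub_atMost: "S \<in> Sub n \<longleftrightarrow> S \<noteq> {} \<and> S \<subseteq> {..n}"
  by (simp add: Sub_def simplex_def)

context cfcubeset
begin

lemma is_cube_iff_cub: "is_cube X n p \<longleftrightarrow> cub (\<lambda>z :: nat \<Rightarrow> bool. p (\<lambda>i\<in>{..<n}. of_bool (z i)))"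
proof
  assume "is_cube X n p"
  then show "cub (\<lambda>z :: nat \<Rightarrow> bool. p (\<lambda>i\<in>{..<n}. of_bool (z i)))" by (rule is_cube_cubic) simp
next
  assume "cub (\<lambda>z :: nat \<Rightarrow> bool. p (\<lambda>i\<in>{..<n}. of_bool (z i)))"
  from cub_is_cube[OF this, of n] show "is_cube X n p"
  proof (rule iffD1[OF is_cube_cong, rotated])
    fix v assume "v \<in> cube n"
    then have "(\<lambda>i\<in>{..<n}. of_bool (i < n \<and> v i = 1)) = v"
      by (auto simp: cube_def fun_eq_iff PiE_iff extensional_def)
    then show "p (\<lambda>i\<in>{..<n}. of_bool (i < n \<and> v i = 1)) = p v" by simp
  qed
qed

lemma erg_rel_iff: "(x, y) \<in> erg_rel X \<longleftrightarrow> eqv X 1 x y"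
proof -
  have "is_cube X 1 (\<lambda>v. if v 0 = 0 then x else y) \<longleftrightarrow> eqv X 1 x y"
  proof -
    have "(\<lambda>z :: nat \<Rightarrow> bool. if \<not> z 0 then x else y) = (\<lambda>z. if z 0 then y else x)" by auto
    then show ?thesis unfolding is_cube_iff_cub eqv_def by simp
  qed
  then show ?thesis using eqv_in[of 1 x y] by (auto simp: erg_rel_def)
qed

lemma equiv_erg_rel: "equiv (sections X 0) (erg_rel X)"
proof (rule equivI)
  show "erg_rel X \<subseteq> sections X 0 \<times> sections X 0" by (auto simp: erg_rel_def)
  show "refl_on (sections X 0) (erg_rel X)"
    using eqv_refl by (auto simp: refl_on_def erg_rel_iff)
  show "sym (erg_rel X)" using eqv_sym by (auto intro!: symI simp: erg_rel_iff)
  show "trans (erg_rel X)" using eqv_trans by (auto intro!: transI simp: erg_rel_iff)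
qed

lemma const_cube_in: "x \<in> sections X 0 \<Longrightarrow> const_cube X n x \<in> sections X n"
  and vert_const_cube: "x \<in> sections X 0 \<Longrightarrow> v \<in> cube n \<Longrightarrow> vert X n (const_cube X n x) v = x"
proof -
  assume x: "x \<in> sections X 0"
  have one: "ones 0 \<in> cube 0" by (auto simp: ones_def cube_def)
  have m: "(\<lambda>u\<in>cube n. ones 0) \<in> cube_maps n 0"
    using one by (auto simp: cube_maps_def)
  show "const_cube X n x \<in> sections X n" unfolding const_cube_def by (rule restr_in[OF m x])
  show "vert X n (const_cube X n x) v = x" if "v \<in> cube n"
    unfolding const_cube_def using vert_restr[OF m x that] vert_0[OF x one] that by simp
qed

lemma Kstar_vertex_in: "x \<in> sections X 0 \<Longrightarrow> Kstar_vertex X x \<in> cubeset_hom (K 0) X"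
  unfolding psh_hom_def
proof (intro CollectI conjI allI ballI)
  assume x: "x \<in> sections X 0"
  show "Kstar_vertex X x m \<in> sections (K 0) m \<rightarrow>\<^sub>E sections X m" for m
    using const_cube_in[OF x] by (auto simp: Kstar_vertex_def)
  fix l m \<psi> c assume \<psi>: "\<psi> \<in> cube_maps l m" and c: "c \<in> sections (K 0) m"
  have c': "restr (K 0) l m \<psi> c \<in> sections (K 0) l" using K_restr_in[OF \<psi> c] by (simp add: K_def)
  have "const_cube X l x = restr X l m \<psi> (const_cube X m x)"
  proof (rule section_eqI)
    fix v assume v: "v \<in> cube l"
    then have "\<psi> v \<in> cube m" using \<psi> by (auto simp: cube_maps_def)
    then show "vert X l (const_cube X l x) v = vert X l (restr X l m \<psi> (const_cube X m x)) v"
      using v x by (simp add: vert_restr[OF \<psi> const_cube_in[OF x] v] vert_const_cube)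
  qed (use x \<psi> in \<open>auto intro: const_cube_in restr_in\<close>)
  then show "Kstar_vertex X x l (restr (K 0) l m \<psi> c) = restr X l m \<psi> (Kstar_vertex X x m c)"
    using c c' by (simp add: Kstar_vertex_def)
qed

lemma val_Kstar_vertex: "x \<in> sections X 0 \<Longrightarrow> S \<in> Sub 0 \<Longrightarrow> val (Kstar_vertex X x) S = x"
  using K_const[of S 0 0] vert_const_cube[of x "ones 0" 0] vert_0[OF const_cube_in[of x 0], of "ones 0"]
  by (simp add: val_def Kstar_vertex_def ones_def cube_0 restrict_def)

lemma Sub_0: "S \<in> Sub 0 \<longleftrightarrow> S = {0}"
  by (auto simp: Sub_def simplex_def)

lemma Kstar_vertex_eq:
  assumes "s \<in> cubeset_hom (K 0) X" shows "s = Kstar_vertex X (val s {0})"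
proof (rule hom_eqI[OF assms])
  have v: "val s {0} \<in> sections X 0" by (rule val_in[OF assms]) (simp add: Sub_0)
  show "Kstar_vertex X (val s {0}) \<in> cubeset_hom (K 0) X" by (rule Kstar_vertex_in[OF v])
  show "val s S = val (Kstar_vertex X (val s {0})) S" if "S \<in> Sub 0" for S
    using val_Kstar_vertex[OF v that] that by (simp add: Sub_0)
qed

lemma Kstar_vertex_inj: "inj_on (Kstar_vertex X) (sections X 0)"
  by (rule inj_on_inverseI[where g = "\<lambda>s. val s {0}"]) (simp add: val_Kstar_vertex Sub_0)

lemma sface_in: "1 \<le> n \<Longrightarrow> s \<in> cubeset_hom (K n) X \<Longrightarrow> sface (Kstar X) n i s \<in> cubeset_hom (K (n - 1)) X"
  unfolding sface_def by (intro Kstar_restr_in face_map)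

lemma val_sface:
  assumes "S \<in> Sub (n - 1)"
  shows "val (sface (Kstar X) n i s) S = val s ((\<lambda>j. if j < i then j else Suc j) ` S)"
proof -
  have "(\<lambda>j\<in>simplex (n - 1). if j < i then j else Suc j) ` S = (\<lambda>j. if j < i then j else Suc j) ` S"
    using assms by (intro image_cong) (auto simp: Sub_def)
  then show ?thesis unfolding sface_def val_restr[OF assms] by simp
qed

lemma fam_no_coords: "fam f {} A T = (\<lambda>_. f T)"
  by (simp add: fam_def fun_eq_iff)

lemma cond_single: "cond X f T {p} \<longleftrightarrow> eqv X (wt T p) (f T) (f (T - {p}))"
  using cond_rel[of p "{}" f T] eqv_rel[where 'i = "nat \<times> bool", of "wt T p" "f T" "f (T - {p})"]
  by (simp add: fam_no_coords)

lemma cond_none: "cond X f T {} \<longleftrightarrow> f T \<in> sections X 0"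
  unfolding cond_def fam_no_coords using cub_const cub_in by blast

lemma wt_two: "wt {0, 1} 0 = 1" "wt {0, 1} 1 = 1"
  by (auto simp: wt_eq inc_def)

text \<open>The label of \<open>{0, 1}\<close> is a point related to both ends, which are then
  related by transitivity. Conversely, the starting point can itself be taken as this label.\<close>

lemma edge_iff:
  "(\<exists>e\<in>cubeset_hom (K 1) X. s = sface (Kstar X) 1 1 e \<and> t = sface (Kstar X) 1 0 e) \<longleftrightarrow>
   (\<exists>x y. s = Kstar_vertex X x \<and> t = Kstar_vertex X y \<and> (x, y) \<in> erg_rel X)"
proof
  assume "\<exists>e\<in>cubeset_hom (K 1) X. s = sface (Kstar X) 1 1 e \<and> t = sface (Kstar X) 1 0 e"
  then obtain e where e: "e \<in> cubeset_hom (K 1) X" "s = sface (Kstar X) 1 1 e" "t = sface (Kstar X) 1 0 e" by blast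
  have st: "s \<in> cubeset_hom (K 0) X" "t \<in> cubeset_hom (K 0) X"
    using sface_in[of 1 e] e by auto
  have v: "val s {0} = val e {0}" "val t {0} = val e {1}"
    using val_sface[of "{0}" 1] e by (simp_all add: Sub_0)
  have T: "{0, 1} \<in> Sub 1" by (auto simp: Sub_atMost)
  have "indep {0, 1} {p}" if "p \<in> {0, 1}" for p :: nat using that by (auto simp: indep_def)
  then have "cond X (val e) {0, 1} {0}" "cond X (val e) {0, 1} {1}"
    using hom_labelling[OF e(1)] T unfolding K_labelling_def by blast+
  moreover have "{0, 1} - {0} = {1::nat}" "{0, 1} - {1} = {0::nat}" by auto
  ultimately have "eqv X 1 (val e {0, 1}) (val e {1})" "eqv X 1 (val e {0, 1}) (val e {0})"
    unfolding cond_single wt_two by simp_all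
  then have "eqv X 1 (val s {0}) (val t {0})" unfolding v using eqv_sym eqv_trans by blast
  then show "\<exists>x y. s = Kstar_vertex X x \<and> t = Kstar_vertex X y \<and> (x, y) \<in> erg_rel X"
    using Kstar_vertex_eq st erg_rel_iff by blast
next
  assume "\<exists>x y. s = Kstar_vertex X x \<and> t = Kstar_vertex X y \<and> (x, y) \<in> erg_rel X"
  then obtain x y where xy: "s = Kstar_vertex X x" "t = Kstar_vertex X y" "(x, y) \<in> erg_rel X" by blast
  have in0: "x \<in> sections X 0" "y \<in> sections X 0" using xy(3) by (auto simp: erg_rel_def)
  define f where "f S = (if S = {1} then y else x)" for S :: "nat set"
  have "K_labelling X 1 f"
    unfolding K_labelling_def
  proof (intro ballI allI impI)
    fix T P assume T: "T \<in> Sub 1" and P: "indep T P"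
    show "cond X f T P"
    proof (cases "P = {}")
      case True
      then show ?thesis using in0 by (simp add: cond_none f_def)
    next
      case False
      have "{..1} = {0, 1 :: nat}" by auto
      then have T01: "T \<subseteq> {0, 1}" using T by (simp add: Sub_atMost)
      obtain p where p: "p \<in> P" using False by blast
      obtain q where q: "q \<in> T" "q \<notin> P" using P by (auto simp: indep_def)
      have "P \<subseteq> T" using P by (rule indep_sub)
      then have TP: "T = {0, 1}" "P = {0} \<or> P = {1}" using T01 p q by auto
      have "{0, 1} - {0} = {1::nat}" "{0, 1} - {1} = {0::nat}" by auto
      then have "cond X f {0, 1} {0}" "cond X f {0, 1} {1}"
        unfolding cond_single wt_two using xy(3) in0 eqv_refl by (simp_all add: f_def erg_rel_iff doubleton_eq_iff)
      then show ?thesis using TP by auto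
    qed
  qed
  then obtain e where e: "e \<in> cubeset_hom (K 1) X" "\<And>S. S \<in> Sub 1 \<Longrightarrow> val e S = f S"
    by (rule hom_of_labelling) blast
  have vx: "Kstar_vertex X x \<in> cubeset_hom (K 0) X" "Kstar_vertex X y \<in> cubeset_hom (K 0) X"
    using Kstar_vertex_in in0 by blast+
  have sf: "sface (Kstar X) 1 i e \<in> cubeset_hom (K 0) X" for i using sface_in[of 1 e i] e(1) by simp
  have S1: "{0} \<in> Sub 1" "{1} \<in> Sub 1" by (auto simp: Sub_atMost)
  have "Kstar_vertex X x = sface (Kstar X) 1 1 e"
  proof (rule hom_eqI[OF vx(1) sf])
    show "val (Kstar_vertex X x) S = val (sface (Kstar X) 1 1 e) S" if "S \<in> Sub 0" for S
      using that val_Kstar_vertex[OF in0(1) that] val_sface[of S 1] e(2)[OF S1(1)] by (simp add: Sub_0 f_def)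
  qed
  moreover have "Kstar_vertex X y = sface (Kstar X) 1 0 e"
  proof (rule hom_eqI[OF vx(2) sf])
    show "val (Kstar_vertex X y) S = val (sface (Kstar X) 1 0 e) S" if "S \<in> Sub 0" for S
      using that val_Kstar_vertex[OF in0(2) that] val_sface[of S 1] e(2)[OF S1(2)] by (simp add: Sub_0 f_def)
  qed
  ultimately show "\<exists>e\<in>cubeset_hom (K 1) X. s = sface (Kstar X) 1 1 e \<and> t = sface (Kstar X) 1 0 e"
    using e(1) xy by blast
qed

text \<open>Edges already form an equivalence relation on the vertices, so passing to the generated
  one adds nothing.\<close>

lemma conn_rel_vertex:
  assumes x: "x \<in> sections X 0"
  shows "conn_rel (Kstar X) `` {Kstar_vertex X x} = Kstar_vertex X ` (erg_rel X `` {x})"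
proof -
  define E where "E = {(sface (Kstar X) 1 1 e, sface (Kstar X) 1 0 e) | e. e \<in> sections (Kstar X) 1}"
  have E: "(s, t) \<in> E \<longleftrightarrow> (\<exists>x y. s = Kstar_vertex X x \<and> t = Kstar_vertex X y \<and> (x, y) \<in> erg_rel X)" for s t
    using edge_iff[of s t] by (auto simp: E_def)
  have sym: "(y, x) \<in> erg_rel X" if "(x, y) \<in> erg_rel X" for x y
    using that equiv_erg_rel by (auto simp: equiv_def dest: symD)
  have "t \<in> Kstar_vertex X ` (erg_rel X `` {x})" if "(Kstar_vertex X x, t) \<in> (E \<union> E\<inverse>)\<^sup>*" for t
    using that
  proof (induction rule: rtrancl_induct)
    case base
    then show ?case using x eqv_refl by (auto simp: erg_rel_iff)
  next
    case (step s t)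
    then obtain y where y: "s = Kstar_vertex X y" "(x, y) \<in> erg_rel X" by auto
    obtain y' z where z: "s = Kstar_vertex X y'" "t = Kstar_vertex X z" "(y', z) \<in> erg_rel X"
      using step.hyps(2) E sym by blast
    have "y' = y"
      using inj_onD[OF Kstar_vertex_inj, of y' y] y z by (auto simp: erg_rel_def)
    then have "(x, z) \<in> erg_rel X" using y(2) z(3) equiv_erg_rel by (auto simp: equiv_def dest: transD)
    then show ?case using z(2) by blast
  qed
  moreover have "(Kstar_vertex X x, Kstar_vertex X y) \<in> (E \<union> E\<inverse>)\<^sup>*" if "(x, y) \<in> erg_rel X" for y
    using that E by blast
  moreover have "conn_rel (Kstar X) = (E \<union> E\<inverse>)\<^sup>*" by (simp add: conn_rel_def E_def Let_def)
  ultimately show ?thesis by blast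
qed

lemma Kstar_vertices: "cubeset_hom (K 0) X = Kstar_vertex X ` sections X 0"
proof
  show "cubeset_hom (K 0) X \<subseteq> Kstar_vertex X ` sections X 0"
  proof
    fix s assume s: "s \<in> cubeset_hom (K 0) X"
    have "val s {0} \<in> sections X 0" by (rule val_in[OF s]) (simp add: Sub_0)
    then show "s \<in> Kstar_vertex X ` sections X 0" using Kstar_vertex_eq[OF s] by (rule rev_image_eqI)
  qed
qed (use Kstar_vertex_in in blast)

lemma components_bij:
  "bij_betw ((`) (Kstar_vertex X)) (erg_components X) (conn_components (Kstar X))"
proof -
  have "conn_components (Kstar X) = (`) (Kstar_vertex X) ` erg_components X"
    unfolding conn_components_def erg_components_def quotient_def sections_Kstar Kstar_vertices
    using conn_rel_vertex by auto
  moreover have "inj_on ((`) (Kstar_vertex X)) (erg_components X)"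
  proof (rule inj_on_subset[OF inj_on_image_Pow[OF Kstar_vertex_inj]])
    show "erg_components X \<subseteq> Pow (sections X 0)"
      by (auto simp: erg_components_def quotient_def erg_rel_def)
  qed
  ultimately show ?thesis by (simp add: bij_betw_def)
qed

end

lemma Kstar_map_vertex:
  assumes "concrete_fibrant X" "concrete_fibrant Y" and f: "f \<in> cubeset_hom X Y" and x: "x \<in> sections X 0"
  shows "Kstar_map f 0 (Kstar_vertex X x) = Kstar_vertex Y (f 0 x)"
proof -
  interpret X: cfcubeset X using assms(1) by unfold_locales
  interpret Y: cfcubeset Y using assms(2) by unfold_locales
  have fx: "f 0 x \<in> sections Y 0" by (rule psh_hom_in[OF f x])
  show ?thesis
  proof (rule Y.hom_eqI[OF Kstar_map_in[OF f X.Kstar_vertex_in[OF x]] Y.Kstar_vertex_in[OF fx]])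
    show "val (Kstar_map f 0 (Kstar_vertex X x)) S = val (Kstar_vertex Y (f 0 x)) S" if "S \<in> Sub 0" for S
      using that by (simp add: val_Kstar_map X.val_Kstar_vertex[OF x] Y.val_Kstar_vertex[OF fx])
  qed
qed

lemma components_natural:
  assumes "concrete_fibrant X" "concrete_fibrant Y" and f: "f \<in> cubeset_hom X Y" and P: "P \<subseteq> sections X 0"
  shows "Kstar_vertex Y ` erg_map X Y f P = conn_map (Kstar X) (Kstar Y) (Kstar_map f) (Kstar_vertex X ` P)"
proof -
  interpret Y: cfcubeset Y using assms(2) by unfold_locales
  have "Kstar_map f 0 ` Kstar_vertex X ` P = Kstar_vertex Y ` f 0 ` P"
    unfolding image_image using P Kstar_map_vertex[OF assms(1-3)] by (intro image_cong) auto
  then have "conn_map (Kstar X) (Kstar Y) (Kstar_map f) (Kstar_vertex X ` P) = (\<Union>x\<in>P. conn_rel (Kstar Y) `` {Kstar_vertex Y (f 0 x)})"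
    unfolding conn_map_def by auto
  also have "\<dots> = (\<Union>x\<in>P. Kstar_vertex Y ` (erg_rel Y `` {f 0 x}))"
  proof (rule SUP_cong[OF refl])
    show "conn_rel (Kstar Y) `` {Kstar_vertex Y (f 0 x)} = Kstar_vertex Y ` (erg_rel Y `` {f 0 x})" if "x \<in> P" for x
      using that P by (intro Y.conn_rel_vertex psh_hom_in[OF f]) auto
  qed
  also have "\<dots> = Kstar_vertex Y ` erg_map X Y f P" unfolding erg_map_def by auto
  finally show ?thesis by simp
qed

section \<open>Squares at a base point\<close>

text \<open>The vertices \<open>u, v, w, t\<close> are listed in the order \<open>(0,0), (1,0), (0,1), (1,1)\<close> of the last two
  coordinates.\<close>

definition square :: "'a cubeset \<Rightarrow> nat \<Rightarrow> 'a \<Rightarrow> 'a \<Rightarrow> 'a \<Rightarrow> 'a \<Rightarrow> 'a \<Rightarrow> bool" where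
  "square X n x0 u v w t \<longleftrightarrow> cubic X (\<lambda>z :: nat \<Rightarrow> bool.
     if \<forall>i<n - 1. z i then if z (n - 1) then if z n then t else v else if z n then w else u else x0)"

context cfcubeset
begin

text \<open>On the grid, \<open>x0\<close> stands where a direction of \<open>E1\<close> is at the
  middle, and \<open>a\<close> where only directions of \<open>E2\<close> are. The small cube at the
  last vertex is the given one; all others merely express that \<open>x0\<close> and
  \<open>a\<close> are related.\<close>

lemma peel:
  fixes E1 E2 :: "nat set"
  assumes E: "finite E1" "finite E2" "E1 \<inter> E2 = {}" and a: "eqv X (card E1) x0 a"
    and g: "cub (\<lambda>z. if \<forall>e\<in>E1. z e then if \<forall>e\<in>E2. z e then b else a else x0)"
  shows "eqv X (card E1 + card E2) a b"
proof -
  have "cub (\<lambda>z. if \<forall>e\<in>E1 \<union> E2. z e then b else a)"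
  proof (rule tricube_eq)
    show "finite (E1 \<union> E2)" using E by simp
    define W where "W y = (if \<exists>e\<in>E1. y e = None then x0 else if \<exists>e\<in>E2. y e = None then a
      else if \<forall>e\<in>E1 \<union> E2. y e = Some True then b else a)" for y
    show "cub (\<lambda>z. W (\<lambda>i. if i \<in> E1 \<union> E2 then (if z i then Some (\<eta> i) else None) else Some (z i)))" for \<eta>
    proof (cases "\<forall>e\<in>E1 \<union> E2. \<eta> e")
      case True
      have "W (\<lambda>i. if i \<in> E1 \<union> E2 then (if z i then Some (\<eta> i) else None) else Some (z i))
        = (if \<forall>e\<in>E1. z e then if \<forall>e\<in>E2. z e then b else a else x0)" for z
        using True by (auto simp: W_def)
      then show ?thesis using g by simp
    next
      case False
      have "W (\<lambda>i. if i \<in> E1 \<union> E2 then (if z i then Some (\<eta> i) else None) else Some (z i))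
        = (if \<forall>e\<in>E1. z e then a else x0)" for z
        using False by (auto simp: W_def)
      then show ?thesis using a eqv_iff[OF E(1) refl, of x0 a] by simp
    qed
    show "W (\<lambda>i. Some (z i)) = (if \<forall>e\<in>E1 \<union> E2. z e then b else a)" for z
      by (auto simp: W_def)
  qed
  then show ?thesis using eqv_iff[of "E1 \<union> E2" _ a b] E by (simp add: card_Un_disjoint)
qed

text \<open>Here the middle of the grid carries \<open>a\<close>. The small cube at the last vertex
  is the relation between \<open>a\<close> and \<open>b\<close>; those reversed in some direction of
  \<open>E1\<close> show \<open>a\<close> and \<open>x0\<close>, and the rest are constant.\<close>

lemma unpeel:
  fixes E1 E2 :: "nat set"
  assumes E: "finite E1" "finite E2" "E1 \<inter> E2 = {}" and a: "eqv X (card E1) x0 a"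
    and ab: "eqv X (card E1 + card E2) a b" and in0: "a \<in> sections X 0"
  shows "cub (\<lambda>z. if \<forall>e\<in>E1. z e then if \<forall>e\<in>E2. z e then b else a else x0)"
proof (rule tricube_eq)
  show "finite (E1 \<union> E2)" using E by simp
  define W where "W y = (if \<exists>e\<in>E1. y e = Some False then x0
    else if \<forall>e\<in>E1 \<union> E2. y e = Some True then b else a)" for y
  show "cub (\<lambda>z. W (\<lambda>i. if i \<in> E1 \<union> E2 then (if z i then Some (\<eta> i) else None) else Some (z i)))" for \<eta>
  proof -
    consider "\<forall>e\<in>E1 \<union> E2. \<eta> e" | "\<forall>e\<in>E1. \<eta> e" "\<exists>e\<in>E2. \<not> \<eta> e" | "\<exists>e\<in>E1. \<not> \<eta> e" by blast
    then show ?thesis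
    proof cases
      case 1
      have "W (\<lambda>i. if i \<in> E1 \<union> E2 then (if z i then Some (\<eta> i) else None) else Some (z i))
        = (if \<forall>e\<in>E1 \<union> E2. z e then b else a)" for z
        using 1 by (auto simp: W_def)
      then show ?thesis using ab eqv_iff[of "E1 \<union> E2" _ a b] E by (simp add: card_Un_disjoint)
    next
      case 2
      have "W (\<lambda>i. if i \<in> E1 \<union> E2 then (if z i then Some (\<eta> i) else None) else Some (z i)) = a" for z
        using 2 by (auto simp: W_def)
      then show ?thesis using cub_const[OF in0] by simp
    next
      case 3
      define N where "N = {e \<in> E1. \<not> \<eta> e}"
      have N: "finite N" "card N \<le> card E1" using E(1) by (auto simp: N_def intro: card_mono)
      have "cub (\<lambda>z. if \<forall>e\<in>N. z e then a else x0)"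
        using eqv_mono[OF a N(2)] eqv_iff[OF N(1) refl, of x0 a] by simp
      from cub_subst[OF this, of "\<lambda>i z. \<not> z i"] have "cub (\<lambda>z. if \<forall>e\<in>N. \<not> z e then a else x0)" by simp
      moreover have "W (\<lambda>i. if i \<in> E1 \<union> E2 then (if z i then Some (\<eta> i) else None) else Some (z i))
        = (if \<forall>e\<in>N. \<not> z e then a else x0)" for z
        using 3 by (auto simp: W_def N_def)
      ultimately show ?thesis by simp
    qed
  qed
  show "W (\<lambda>i. Some (z i)) = (if \<forall>e\<in>E1. z e then if \<forall>e\<in>E2. z e then b else a else x0)" for z
    by (auto simp: W_def)
qed

context
  fixes n :: nat and x0 :: 'a
  assumes n: "1 \<le> n" and x0: "x0 \<in> sections X 0"
begin

lemma nn [simp]: "n - Suc 0 \<noteq> n" "n \<noteq> n - Suc 0" "n - Suc 0 < n"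
proof -
  obtain m where "n = Suc m" using n by (cases n) simp_all
  then show "n - Suc 0 \<noteq> n" "n \<noteq> n - Suc 0" "n - Suc 0 < n" by simp_all
qed

lemma all_less_n: "(\<forall>i<n. P i) \<longleftrightarrow> (\<forall>i<n - 1. P i) \<and> P (n - 1)"
proof -
  obtain m where "n = Suc m" using n by (cases n) auto
  then show ?thesis by (auto simp: less_Suc_eq)
qed

lemma square_swap:
  assumes "square X n x0 u v w t" shows "square X n x0 u w v t"
  unfolding square_def
proof (rule cub_subst_eq[OF assms[unfolded square_def],
      where s = "\<lambda>i z. z (if i = n - 1 then n else if i = n then n - 1 else i)"])
  fix z :: "nat \<Rightarrow> bool"
  have "z (if i = n - 1 then n else if i = n then n - 1 else i) = z i" if "i < n - 1" for i
  proof -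
    have "i \<noteq> n - 1" "i \<noteq> n" using that by linarith+
    then show ?thesis by simp
  qed
  then have "(\<forall>i<n - 1. z (if i = n - 1 then n else if i = n then n - 1 else i)) \<longleftrightarrow> (\<forall>i<n - 1. z i)"
    by (intro all_cong) blast
  then show "(if \<forall>i<n - 1. z (if i = n - 1 then n else if i = n then n - 1 else i)
     then if z (if n - 1 = n - 1 then n else if n - 1 = n then n - 1 else n - 1)
       then if z (if n = n - 1 then n else if n = n then n - 1 else n) then t else v
       else if z (if n = n - 1 then n else if n = n then n - 1 else n) then w else u else x0)
    = (if \<forall>i<n - 1. z i then if z (n - 1) then if z n then t else w else if z n then v else u else x0)"
    by auto
qed simp

lemma square_flip:
  assumes "square X n x0 u v w t" shows "square X n x0 v u t w"
  unfolding square_def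
proof (rule cub_subst_eq[OF assms[unfolded square_def], where s = "\<lambda>i z. if i = n - 1 then \<not> z i else z i"])
  show "lit (\<lambda>z. if i = n - 1 then \<not> z i else z i)" for i by (rule lit_if) simp_all
qed auto

text \<open>Turned suitably, both cubes have the common row \<open>c\<close>, \<open>d\<close> at
  \<open>z n\<close> false, which is where \<open>glue\<close> joins them.\<close>

lemma square_glue:
  assumes "square X n x0 a b c d" "square X n x0 c d e f" shows "square X n x0 a b e f"
proof -
  define g1 where "g1 z = (if \<forall>i<n - 1. z i then if z (n - 1) then if z n then f else d else if z n then e else c else x0)" for z
  define g2 where "g2 z = (if \<forall>i<n - 1. z i then if z (n - 1) then if z n then b else d else if z n then a else c else x0)" for z
  have "cub (\<lambda>z. if z n then g1 (z(n := True)) else g2 (z(n := True)))"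
  proof (rule glue)
    show "cub g1" using assms(2) by (simp add: square_def g1_def[abs_def])
    show "cub g2"
    proof (rule cub_subst_eq[OF assms(1)[unfolded square_def], where s = "\<lambda>i z. if i = n then \<not> z i else z i"])
      show "lit (\<lambda>z. if i = n then \<not> z i else z i)" for i by (rule lit_if) simp_all
    qed (auto simp: g2_def)
    show "g1 (z(n := False)) = g2 (z(n := False))" for z by (auto simp: g1_def g2_def)
  qed
  then show ?thesis
    unfolding square_def by (rule cub_subst_eq[where s = "\<lambda>i z. z i"]) (auto simp: g1_def g2_def)
qed

text \<open>The faces in the first \<open>n - 1\<close> directions are constant, so two edges
  starting at \<open>u\<close> already describe a whole corner.\<close>

lemma square_fill:
  assumes v: "cub (\<lambda>z :: nat \<Rightarrow> bool. if \<forall>i<n - 1. z i then if z (n - 1) then v else u else x0)"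
    and w: "cub (\<lambda>z :: nat \<Rightarrow> bool. if \<forall>i<n - 1. z i then if z (n - 1) then w else u else x0)"
  obtains t where "square X n x0 u v w t"
proof -
  \<comment> \<open>The entry \<open>x0\<close> at the last vertex is a placeholder for the
    filler.\<close>
  define g :: "(nat \<Rightarrow> bool) \<Rightarrow> 'a" where
    "g z = (if \<forall>i<n - 1. z i then if z (n - 1) then if z n then x0 else v else if z n then w else u else x0)" for z
  have "\<exists>g'. cub g' \<and> (\<forall>z. (\<exists>i\<in>{..n}. \<not> z i) \<longrightarrow> g' z = g z)"
  proof (rule corner_cub)
    show "supported {..n} g" unfolding supported_def g_def by auto
    fix i assume "i \<in> {..n}"
    then consider "i < n - 1" | "i = n - 1" | "i = n" using n by force
    then show "cub (\<lambda>z. g (z(i := False)))"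
    proof cases
      case 1
      then have "g (z(i := False)) = x0" for z by (auto simp: g_def)
      then show ?thesis using cub_const[OF x0] by simp
    next
      case 2
      show ?thesis
      proof (rule cub_subst_eq[OF w, where s = "\<lambda>j z. if j = n - 1 then z n else z j"])
        show "lit (\<lambda>z. if j = n - 1 then z n else z j)" for j by (rule lit_if) simp_all
      qed (auto simp: g_def 2)
    next
      case 3
      show ?thesis
        by (rule cub_subst_eq[OF v, where s = "\<lambda>j z. z j"]) (auto simp: g_def 3)
    qed
  qed auto
  then obtain g' where g': "cub g'" "\<And>z i. i \<le> n \<Longrightarrow> \<not> z i \<Longrightarrow> g' z = g z" by auto
  have "square X n x0 u v w (g' (\<lambda>_. True))"
    unfolding square_def
  proof (rule cub_subst_eq[OF g'(1), where s = "\<lambda>i z. i \<le> n \<longrightarrow> z i"])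
    fix z :: "nat \<Rightarrow> bool"
    show "g' (\<lambda>i. i \<le> n \<longrightarrow> z i) = (if \<forall>i<n - 1. z i then if z (n - 1) then
       if z n then g' (\<lambda>_. True) else v else if z n then w else u else x0)"
    proof (cases "\<forall>i\<le>n. z i")
      case True
      then have "(\<lambda>i. i \<le> n \<longrightarrow> z i) = (\<lambda>_. True)" by auto
      then show ?thesis using True by auto
    next
      case False
      then obtain i where i: "i \<le> n" "\<not> z i" by blast
      then have "g' (\<lambda>i. i \<le> n \<longrightarrow> z i) = g (\<lambda>i. i \<le> n \<longrightarrow> z i)" by (intro g'(2)[of i]) auto
      also have "\<dots> = (if \<forall>i<n - 1. z i then if z (n - 1) then
         if z n then g' (\<lambda>_. True) else v else if z n then w else u else x0)"
      proof -
        have "\<not> ((\<forall>i<n - 1. z i) \<and> z (n - 1) \<and> z n)"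
        proof
          assume a: "(\<forall>i<n - 1. z i) \<and> z (n - 1) \<and> z n"
          have "i < n - 1 \<or> i = n - 1 \<or> i = n" using i(1) by linarith
          then show False using a i(2) by auto
        qed
        then show ?thesis unfolding g_def by auto
      qed
      finally show ?thesis .
    qed
  qed simp
  then show thesis by (rule that)
qed

lemma edge_iff_eqv:
  "cub (\<lambda>z :: nat \<Rightarrow> bool. if \<forall>i<n - 1. z i then if z (n - 1) then a else x0 else x0) \<longleftrightarrow> eqv X n x0 a"
proof -
  have "(\<lambda>z :: nat \<Rightarrow> bool. if \<forall>i<n - 1. z i then if z (n - 1) then a else x0 else x0)
    = (\<lambda>z. if \<forall>k<n. z k then a else x0)"
    unfolding all_less_n by (auto simp: fun_eq_iff)
  then show ?thesis by (simp add: eqv_def)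
qed

lemma edge_flip:
  assumes "eqv X n x0 a"
  shows "cub (\<lambda>z :: nat \<Rightarrow> bool. if \<forall>i<n - 1. z i then if z (n - 1) then x0 else a else x0)"
proof (rule cub_subst_eq[OF assms[folded edge_iff_eqv], where s = "\<lambda>i z. if i = n - 1 then \<not> z i else z i"])
  show "lit (\<lambda>z. if i = n - 1 then \<not> z i else z i)" for i by (rule lit_if) simp_all
qed auto

text \<open>While \<open>a\<close> and \<open>b\<close> are seen on faces, \<open>e\<close> is seen
  on the diagonal where the last two coordinates are equal.\<close>

lemma square_edges:
  assumes "square X n x0 x0 a b e"
  shows "eqv X n x0 a" "eqv X n x0 b" "eqv X n x0 e"
proof -
  note s = assms[unfolded square_def]
  have init: "(\<forall>i<n - 1. P i) \<longleftrightarrow> (\<forall>i<n - 1. Q i)"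
    if "\<And>i. i \<noteq> n - 1 \<Longrightarrow> i \<noteq> n \<Longrightarrow> P i = Q i" for P Q
  proof (intro all_cong)
    fix i assume "i < n - 1"
    then have "i \<noteq> n - 1" "i \<noteq> n" by linarith+
    then show "P i = Q i" by (rule that)
  qed
  have 1: "(\<forall>i<n - 1. i \<noteq> n \<and> z i) \<longleftrightarrow> (\<forall>i<n - 1. z i)"
    "(\<forall>i<n - 1. i \<noteq> n - 1 \<and> z (if i = n then n - 1 else i)) \<longleftrightarrow> (\<forall>i<n - 1. z i)"
    "(\<forall>i<n - 1. z (if i = n then n - 1 else i)) \<longleftrightarrow> (\<forall>i<n - 1. z i)" for z
    by (rule init, simp)+
  show "eqv X n x0 a" unfolding edge_iff_eqv[symmetric]
    by (rule cub_subst_eq[OF s, where s = "\<lambda>i z. i \<noteq> n \<and> z i"]) (simp, simp only: 1, auto)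
  show "eqv X n x0 b" unfolding edge_iff_eqv[symmetric]
    by (rule cub_subst_eq[OF s, where s = "\<lambda>i z. i \<noteq> n - 1 \<and> z (if i = n then n - 1 else i)"])
      (simp, simp only: 1, auto)
  show "eqv X n x0 e" unfolding edge_iff_eqv[symmetric]
    by (rule cub_subst_eq[OF s, where s = "\<lambda>i z. z (if i = n then n - 1 else i)"]) (simp, simp only: 1, auto)
qed

lemma square_unit:
  assumes "eqv X n x0 a" shows "square X n x0 x0 x0 a a"
  unfolding square_def
proof (rule cub_subst_eq[OF assms[folded edge_iff_eqv], where s = "\<lambda>i z. z (if i = n - 1 then n else i)"])
  fix z :: "nat \<Rightarrow> bool"
  have "(\<forall>i<n - 1. z (if i = n - 1 then n else i)) \<longleftrightarrow> (\<forall>i<n - 1. z i)"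
    by (intro all_cong) simp
  then show "(if \<forall>i<n - 1. z (if i = n - 1 then n else i) then if z (if n - 1 = n - 1 then n else n - 1) then a else x0 else x0) =
     (if \<forall>i<n - 1. z i then if z (n - 1) then if z n then a else x0 else if z n then a else x0 else x0)"
    by auto
qed simp

lemma square_total:
  assumes "eqv X n x0 a" "eqv X n x0 b"
  obtains e where "square X n x0 x0 a b e" "eqv X n x0 e"
proof -
  obtain e where "square X n x0 x0 a b e"
    using square_fill[OF assms[folded edge_iff_eqv]] .
  then show thesis using square_edges(3) by (intro that)
qed

lemma square_inverse:
  assumes "eqv X n x0 a"
  obtains b where "square X n x0 x0 a b x0" "eqv X n x0 b"
proof -
  obtain b where "square X n x0 a x0 x0 b"
    using square_fill[OF edge_flip[OF assms] edge_flip[OF assms]] .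
  then have "square X n x0 x0 a b x0" by (rule square_flip)
  then show thesis using square_edges(2) by (intro that)
qed

text \<open>Pasting of squares: the second and third share the row \<open>x0\<close>,
  \<open>c\<close>, and the result shares the row \<open>b\<close>, \<open>e\<close> with the
  first.\<close>

lemma square_assoc:
  assumes "square X n x0 x0 a b e" "square X n x0 x0 b c h" "square X n x0 x0 e c g"
  shows "square X n x0 x0 a h g"
proof -
  have "square X n x0 b h x0 c" by (rule square_swap[OF square_flip[OF assms(2)]])
  moreover have "square X n x0 x0 c e g" by (rule square_swap[OF assms(3)])
  ultimately have "square X n x0 b h e g" by (rule square_glue)
  then have "square X n x0 b e h g" by (rule square_swap)
  with assms(1) show ?thesis by (rule square_glue)
qed

lemma square_supported:
  "supported {..<Suc n} (\<lambda>z. if \<forall>i<n - 1. z i then if z (n - 1) then if z n then t else v else if z n then w else u else x0)"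
  unfolding supported_def
proof (intro allI impI)
  fix z z' :: "nat \<Rightarrow> bool" assume "\<forall>j\<in>{..<Suc n}. z j = z' j"
  then have "(\<forall>i<n - 1. z i) \<longleftrightarrow> (\<forall>i<n - 1. z' i)" "z (n - 1) = z' (n - 1)" "z n = z' n" by auto
  then show "(if \<forall>i<n - 1. z i then if z (n - 1) then if z n then t else v else if z n then w else u else x0) =
    (if \<forall>i<n - 1. z' i then if z' (n - 1) then if z' n then t else v else if z' n then w else u else x0)"
    by auto
qed

lemma square_unique:
  assumes "square X n x0 u v w t" "square X n x0 u v w t'"
  shows "eqv X (Suc n) t t'"
proof -
  define g where "g t z = (if \<forall>i<n - 1. z i then if z (n - 1) then if z n then t else v else if z n then w else u else x0)" for t and z :: "nat \<Rightarrow> bool"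
  have "eqv X (Suc n) (g t (\<lambda>_. True)) (g t' (\<lambda>_. True))"
  proof (rule eqv_completions)
    show "cub (g t)" "cub (g t')" using assms by (simp_all add: square_def g_def[abs_def])
    show "supported {..<Suc n} (g t)" "supported {..<Suc n} (g t')"
      using square_supported by (simp_all add: g_def[abs_def])
    fix z i assume i: "i < Suc n" "\<not> z i"
    then have "i < n - 1 \<or> i = n - 1 \<or> i = n" by linarith
    then show "g t z = g t' z" using i(2) by (auto simp: g_def)
  qed
  then show ?thesis by (simp add: g_def)
qed

lemma all_le_iff: "(\<forall>i<Suc n. P i) \<longleftrightarrow> (\<forall>i<n - 1. P i) \<and> P (n - 1) \<and> P n"
proof -
  have "(\<forall>i<Suc n. P i) \<longleftrightarrow> (\<forall>i<n. P i) \<and> P n" by (auto simp: less_Suc_eq)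
  then show ?thesis unfolding all_less_n by simp
qed

text \<open>Entries are replaced vertex by vertex. The function
  \<open>\<lambda>i. i \<noteq> n\<close> is the vertex of \<open>a\<close>, and \<open>b\<close> is
  brought there by a swap.\<close>

lemma square_cong:
  assumes s: "square X n x0 x0 a b e" and "eqv X (Suc n) a a'" "eqv X (Suc n) b b'" "eqv X (Suc n) e e'"
  shows "square X n x0 x0 a' b' e'"
proof -
  have A: "square X n x0 x0 a' b e" if s: "square X n x0 x0 a b e" "eqv X (Suc n) a a'" for a a' b e
    unfolding square_def
  proof (rule cub_subst_eq[OF replace_vertex[OF s(1)[unfolded square_def] square_supported, of "\<lambda>i. i \<noteq> n" a'], where s = "\<lambda>i z. z i"])
  qed (use s(2) in \<open>auto simp: all_le_iff\<close>)
  have E: "square X n x0 x0 a b e'" if s: "square X n x0 x0 a b e" "eqv X (Suc n) e e'" for a b e e'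
    unfolding square_def
  proof (rule cub_subst_eq[OF replace_vertex[OF s(1)[unfolded square_def] square_supported, of "\<lambda>i. True" e'], where s = "\<lambda>i z. z i"])
  qed (use s(2) in \<open>auto simp: all_le_iff\<close>)
  have "square X n x0 x0 a' b e" by (rule A[OF s assms(2)])
  then have "square X n x0 x0 b' a' e" by (rule A[OF square_swap assms(3)])
  then have "square X n x0 x0 a' b' e" by (rule square_swap)
  then show ?thesis by (rule E[OF _ assms(4)])
qed

end

end

section \<open>Groups defined by product relations\<close>

text \<open>The common form of \<open>str_group\<close> and \<open>homotopy_group\<close>, so that
  both can be treated at once.\<close>

definition quotient_monoid :: "'b set \<Rightarrow> ('b \<times> 'b) set \<Rightarrow> ('b \<Rightarrow> 'b \<Rightarrow> 'b \<Rightarrow> bool) \<Rightarrow> 'b \<Rightarrow> 'b set monoid" where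
  "quotient_monoid A r pr u =
     \<lparr>carrier = A // r,
      mult = (\<lambda>P Q. THE R. R \<in> A // r \<and> (\<exists>c\<in>P. \<exists>d\<in>Q. \<exists>e\<in>R. pr c d e)),
      one = r `` {u}\<rparr>"

text \<open>The product is only a relation on representatives. The clause \<open>unique\<close> is
  what makes the definite description in \<open>quotient_monoid\<close> meaningful; the others give
  closure, associativity, a left unit and left inverses.\<close>

locale product_relation =
  fixes A :: "'b set" and r :: "('b \<times> 'b) set" and pr :: "'b \<Rightarrow> 'b \<Rightarrow> 'b \<Rightarrow> bool" and u :: 'b
  assumes equiv: "equiv A r" and unit_in: "u \<in> A"
    and total: "a \<in> A \<Longrightarrow> b \<in> A \<Longrightarrow> \<exists>e\<in>A. pr a b e"
    and unique: "(a, a') \<in> r \<Longrightarrow> (b, b') \<in> r \<Longrightarrow> e \<in> A \<Longrightarrow> e' \<in> A \<Longrightarrow> pr a b e \<Longrightarrow> pr a' b' e' \<Longrightarrow> (e, e') \<in> r"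
    and assoc: "a \<in> A \<Longrightarrow> b \<in> A \<Longrightarrow> c \<in> A \<Longrightarrow> e \<in> A \<Longrightarrow> h \<in> A \<Longrightarrow> g \<in> A \<Longrightarrow> g' \<in> A \<Longrightarrow>
      pr a b e \<Longrightarrow> pr b c h \<Longrightarrow> pr e c g \<Longrightarrow> pr a h g' \<Longrightarrow> (g, g') \<in> r"
    and unit: "a \<in> A \<Longrightarrow> e \<in> A \<Longrightarrow> pr u a e \<Longrightarrow> (e, a) \<in> r"
    and inverse: "a \<in> A \<Longrightarrow> \<exists>b\<in>A. \<exists>e\<in>A. pr b a e \<and> (e, u) \<in> r"
begin

abbreviation "G \<equiv> quotient_monoid A r pr u"

lemma class_eq: "(a, b) \<in> r \<Longrightarrow> r `` {a} = r `` {b}"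
  using equiv by (rule equiv_class_eq)

lemma rel_in: "(a, b) \<in> r \<Longrightarrow> a \<in> A \<and> b \<in> A"
  using equiv by (auto simp: equiv_def)

lemma class_self: "a \<in> A \<Longrightarrow> a \<in> r `` {a}"
  by (rule equiv_class_self[OF equiv])

lemma mult_class:
  assumes "a \<in> A" "b \<in> A" "e \<in> A" "pr a b e"
  shows "r `` {a} \<otimes>\<^bsub>G\<^esub> r `` {b} = r `` {e}"
proof -
  have "(THE R. R \<in> A // r \<and> (\<exists>c\<in>r `` {a}. \<exists>d\<in>r `` {b}. \<exists>e\<in>R. pr c d e)) = r `` {e}"
  proof (rule the_equality)
    show "r `` {e} \<in> A // r \<and> (\<exists>c\<in>r `` {a}. \<exists>d\<in>r `` {b}. \<exists>e\<in>r `` {e}. pr c d e)"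
      using assms class_self quotientI[of e A r] by blast
    fix R assume R: "R \<in> A // r \<and> (\<exists>c\<in>r `` {a}. \<exists>d\<in>r `` {b}. \<exists>e\<in>R. pr c d e)"
    then obtain c d e' where c: "(a, c) \<in> r" "(b, d) \<in> r" "e' \<in> R" "pr c d e'" by blast
    obtain x where x: "x \<in> A" "R = r `` {x}" using R by (auto elim: quotientE)
    have xe: "(x, e') \<in> r" using c(3) x by simp
    then have "(e, e') \<in> r" using unique[OF c(1,2) assms(3) _ assms(4) c(4)] rel_in by blast
    then show "R = r `` {e}" using class_eq[OF xe] class_eq x(2) by simp
  qed
  then show ?thesis by (simp add: quotient_monoid_def)
qed

lemma carrier_iff: "P \<in> carrier G \<longleftrightarrow> (\<exists>a\<in>A. P = r `` {a})"
  by (auto simp: quotient_monoid_def quotient_def)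

lemma one_eq: "\<one>\<^bsub>G\<^esub> = r `` {u}"
  by (simp add: quotient_monoid_def)

lemma group: "group G"
proof (rule groupI)
  fix P Q assume "P \<in> carrier G" "Q \<in> carrier G"
  then obtain a b where ab: "a \<in> A" "P = r `` {a}" "b \<in> A" "Q = r `` {b}" unfolding carrier_iff by blast
  obtain e where "e \<in> A" "pr a b e" using total[OF ab(1,3)] by blast
  then show "P \<otimes>\<^bsub>G\<^esub> Q \<in> carrier G"
    using mult_class[OF ab(1,3)] ab carrier_iff by auto
next
  show "\<one>\<^bsub>G\<^esub> \<in> carrier G" unfolding one_eq carrier_iff using unit_in by blast
next
  fix P Q R assume "P \<in> carrier G" "Q \<in> carrier G" "R \<in> carrier G"
  then obtain a b c where abc: "a \<in> A" "P = r `` {a}" "b \<in> A" "Q = r `` {b}" "c \<in> A" "R = r `` {c}"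
    unfolding carrier_iff by blast
  obtain e where e: "e \<in> A" "pr a b e" using total[OF abc(1,3)] by blast
  obtain h where h: "h \<in> A" "pr b c h" using total[OF abc(3,5)] by blast
  obtain g where g: "g \<in> A" "pr e c g" using total[OF e(1) abc(5)] by blast
  obtain g' where g': "g' \<in> A" "pr a h g'" using total[OF abc(1) h(1)] by blast
  have "r `` {g} = r `` {g'}"
    by (rule class_eq[OF assoc[OF abc(1,3,5) e(1) h(1) g(1) g'(1) e(2) h(2) g(2) g'(2)]])
  then show "P \<otimes>\<^bsub>G\<^esub> Q \<otimes>\<^bsub>G\<^esub> R = P \<otimes>\<^bsub>G\<^esub> (Q \<otimes>\<^bsub>G\<^esub> R)"
    using mult_class[OF abc(1,3) e] mult_class[OF abc(3,5) h] mult_class[OF e(1) abc(5) g]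
      mult_class[OF abc(1) h(1) g'] abc by simp
next
  fix P assume "P \<in> carrier G"
  then obtain a where a: "a \<in> A" "P = r `` {a}" unfolding carrier_iff by blast
  obtain e where e: "e \<in> A" "pr u a e" using total[OF unit_in a(1)] by blast
  show "\<one>\<^bsub>G\<^esub> \<otimes>\<^bsub>G\<^esub> P = P"
    using mult_class[OF unit_in a(1) e] class_eq[OF unit[OF a(1) e]] a by (simp add: one_eq)
  obtain b e' where b: "b \<in> A" "e' \<in> A" "pr b a e'" "(e', u) \<in> r" using inverse[OF a(1)] by blast
  have "r `` {b} \<otimes>\<^bsub>G\<^esub> P = \<one>\<^bsub>G\<^esub>"
    using mult_class[OF b(1) a(1) b(2,3)] class_eq[OF b(4)] a(2) by (simp add: one_eq)
  then show "\<exists>Q\<in>carrier G. Q \<otimes>\<^bsub>G\<^esub> P = \<one>\<^bsub>G\<^esub>"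
    using b(1) carrier_iff by (intro bexI[of _ "r `` {b}"]) auto
qed

text \<open>Transport along a bijection \<open>\<theta>\<close> that only maps products to products: totality makes up
  for the missing converse.\<close>

context
  fixes A' :: "'c set" and r' :: "('c \<times> 'c) set" and pr' :: "'c \<Rightarrow> 'c \<Rightarrow> 'c \<Rightarrow> bool" and u' :: 'c
    and \<theta> :: "'c \<Rightarrow> 'b"
  assumes bij: "bij_betw \<theta> A' A"
    and r': "\<And>s t. (s, t) \<in> r' \<longleftrightarrow> s \<in> A' \<and> t \<in> A' \<and> (\<theta> s, \<theta> t) \<in> r"
    and u': "u' \<in> A'" "\<theta> u' = u"
    and pr': "\<And>s t w. s \<in> A' \<Longrightarrow> t \<in> A' \<Longrightarrow> w \<in> A' \<Longrightarrow> pr' s t w \<Longrightarrow> pr (\<theta> s) (\<theta> t) (\<theta> w)"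
    and total': "\<And>s t. s \<in> A' \<Longrightarrow> t \<in> A' \<Longrightarrow> \<exists>w\<in>A'. pr' s t w"
begin

lemma th_in: "s \<in> A' \<Longrightarrow> \<theta> s \<in> A"
  using bij by (auto simp: bij_betw_def)

lemma th_surj: "a \<in> A \<Longrightarrow> \<exists>s\<in>A'. \<theta> s = a"
  using bij by (auto simp: bij_betw_def)

lemma product_relation_transport: "product_relation A' r' pr' u'"
proof
  have eq: "refl_on A r" "sym r" "trans r" using equiv by (auto simp: equiv_def)
  show "equiv A' r'"
  proof (rule equivI)
    show "r' \<subseteq> A' \<times> A'" using r' by auto
    show "refl_on A' r'" using eq(1) th_in by (auto simp: refl_on_def r')
    show "sym r'" using eq(2) by (auto simp: sym_def r')
    show "trans r'" using eq(3) unfolding trans_def r' by blast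
  qed
  show "u' \<in> A'" by (rule u'(1))
  show "\<exists>e\<in>A'. pr' a b e" if "a \<in> A'" "b \<in> A'" for a b using that by (rule total')
  show "(e, e') \<in> r'" if "(a, a') \<in> r'" "(b, b') \<in> r'" "e \<in> A'" "e' \<in> A'" "pr' a b e" "pr' a' b' e'" for a a' b b' e e'
    using that unique[of "\<theta> a" "\<theta> a'" "\<theta> b" "\<theta> b'" "\<theta> e" "\<theta> e'"] pr'[of a b e] pr'[of a' b' e'] th_in
    by (simp add: r')
  show "(g, g') \<in> r'" if "a \<in> A'" "b \<in> A'" "c \<in> A'" "e \<in> A'" "h \<in> A'" "g \<in> A'" "g' \<in> A'"
      "pr' a b e" "pr' b c h" "pr' e c g" "pr' a h g'" for a b c e h g g'
    using that assoc[of "\<theta> a" "\<theta> b" "\<theta> c" "\<theta> e" "\<theta> h" "\<theta> g" "\<theta> g'"] pr' th_in by (simp add: r')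
  show "(e, a) \<in> r'" if "a \<in> A'" "e \<in> A'" "pr' u' a e" for a e
    using that unit[of "\<theta> a" "\<theta> e"] pr'[OF u'(1), of a e] th_in u'(2) by (simp add: r')
  show "\<exists>b\<in>A'. \<exists>e\<in>A'. pr' b a e \<and> (e, u') \<in> r'" if a: "a \<in> A'" for a
  proof -
    obtain b e where b: "b \<in> A" "e \<in> A" "pr b (\<theta> a) e" "(e, u) \<in> r" using inverse[OF th_in[OF a]] by blast
    obtain b' where b': "b' \<in> A'" "\<theta> b' = b" using th_surj[OF b(1)] by blast
    \<comment> \<open>This product need not be the one found in \<open>A\<close>, but
      \<open>unique\<close> makes the two equivalent.\<close>
    obtain e' where e': "e' \<in> A'" "pr' b' a e'" using total'[OF b'(1) a] by blast
    have "(\<theta> e', e) \<in> r"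
      by (rule unique[of b b "\<theta> a" "\<theta> a"])
        (use eq(1) b a b' e' pr'[OF b'(1) a e'] th_in in \<open>auto simp: refl_on_def\<close>)
    then have "(\<theta> e', u) \<in> r" using b(4) eq(3) by (auto dest: transD)
    then show ?thesis using b' e' u' by (auto simp: r')
  qed
qed

lemma image_class:
  assumes s: "s \<in> A'" shows "\<theta> ` (r' `` {s}) = r `` {\<theta> s}"
proof
  show "\<theta> ` (r' `` {s}) \<subseteq> r `` {\<theta> s}" by (auto simp: r')
  show "r `` {\<theta> s} \<subseteq> \<theta> ` (r' `` {s})"
  proof
    fix a assume a: "a \<in> r `` {\<theta> s}"
    then obtain t where "t \<in> A'" "\<theta> t = a" using th_surj rel_in by blast
    then show "a \<in> \<theta> ` (r' `` {s})" using a s by (intro image_eqI[of _ _ t]) (auto simp: r')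
  qed
qed

lemma iso_transport: "(`) \<theta> \<in> iso (quotient_monoid A' r' pr' u') G"
proof -
  interpret T: product_relation A' r' pr' u' by (rule product_relation_transport)
  have into: "\<theta> ` P \<in> carrier G" if "P \<in> carrier T.G" for P
    using that th_in image_class unfolding T.carrier_iff carrier_iff by blast
  have "(`) \<theta> \<in> hom T.G G"
  proof (rule homI)
    show "\<theta> ` P \<in> carrier G" if "P \<in> carrier T.G" for P using that by (rule into)
    fix P Q assume "P \<in> carrier T.G" "Q \<in> carrier T.G"
    then obtain s t where st: "s \<in> A'" "P = r' `` {s}" "t \<in> A'" "Q = r' `` {t}" unfolding T.carrier_iff by blast
    obtain w where w: "w \<in> A'" "pr' s t w" using total'[OF st(1,3)] by blast
    show "\<theta> ` (P \<otimes>\<^bsub>T.G\<^esub> Q) = \<theta> ` P \<otimes>\<^bsub>G\<^esub> \<theta> ` Q"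
      using T.mult_class[OF st(1,3) w] mult_class[OF th_in[OF st(1)] th_in[OF st(3)] th_in[OF w(1)] pr'[OF st(1,3) w]]
      by (simp add: st image_class w(1))
  qed
  moreover have "bij_betw ((`) \<theta>) (carrier T.G) (carrier G)"
  proof (rule bij_betw_imageI)
    show "inj_on ((`) \<theta>) (carrier T.G)"
    proof (rule inj_on_subset[OF inj_on_image_Pow])
      show "inj_on \<theta> A'" using bij by (simp add: bij_betw_def)
      show "carrier T.G \<subseteq> Pow A'" unfolding T.carrier_iff using T.rel_in by (auto simp: subset_iff T.carrier_iff)
    qed
    show "(`) \<theta> ` carrier T.G = carrier G"
    proof
      show "(`) \<theta> ` carrier T.G \<subseteq> carrier G"
        using into by blast
      show "carrier G \<subseteq> (`) \<theta> ` carrier T.G"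
      proof
        fix P assume "P \<in> carrier G"
        then obtain s where s: "s \<in> A'" "P = r `` {\<theta> s}" unfolding carrier_iff using th_surj by blast
        have "r' `` {s} \<in> carrier T.G" unfolding T.carrier_iff using s(1) by blast
        moreover have "P = \<theta> ` (r' `` {s})" using image_class[OF s(1)] s(2) by simp
        ultimately show "P \<in> (`) \<theta> ` carrier T.G" by (rule rev_image_eqI)
      qed
    qed
  qed
  ultimately show ?thesis by (simp add: iso_def)
qed

end

end

text \<open>Here \<Psi> is \<open>F\<close> followed by the inverse of \<open>F'\<close>; the form
  chosen avoids writing the inverse down.\<close>

lemma iso_of_common_image:
  assumes H: "group H" and F: "F \<in> iso G B" and F': "F' \<in> iso H B"
    and \<Psi>: "\<And>P. P \<in> carrier G \<Longrightarrow> \<Psi> P \<in> carrier H" "\<And>P. P \<in> carrier G \<Longrightarrow> F' (\<Psi> P) = F P"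
    and G: "group G"
  shows "\<Psi> \<in> iso G H"
proof -
  interpret G: group G by (rule G)
  interpret H: group H by (rule H)
  have F: "F \<in> hom G B" "bij_betw F (carrier G) (carrier B)" and F': "F' \<in> hom H B" "bij_betw F' (carrier H) (carrier B)"
    using F F' by (auto simp: iso_def)
  have inj: "x = y" if "x \<in> carrier H" "y \<in> carrier H" "F' x = F' y" for x y
    using F'(2) that by (auto simp: bij_betw_def dest: inj_onD)
  have "\<Psi> \<in> hom G H"
  proof (rule homI)
    fix x y assume xy: "x \<in> carrier G" "y \<in> carrier G"
    then have "F' (\<Psi> (x \<otimes>\<^bsub>G\<^esub> y)) = F' (\<Psi> x \<otimes>\<^bsub>H\<^esub> \<Psi> y)"
      using hom_mult[OF F(1) xy] hom_mult[OF F'(1) \<Psi>(1) \<Psi>(1), OF xy] \<Psi>(2) by simp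
    then show "\<Psi> (x \<otimes>\<^bsub>G\<^esub> y) = \<Psi> x \<otimes>\<^bsub>H\<^esub> \<Psi> y"
      using xy \<Psi>(1) by (intro inj) auto
  qed (rule \<Psi>(1))
  moreover have "bij_betw \<Psi> (carrier G) (carrier H)"
  proof (rule bij_betw_imageI)
    show "inj_on \<Psi> (carrier G)"
      using F(2) \<Psi>(2) unfolding bij_betw_def inj_on_def by metis
    show "\<Psi> ` carrier G = carrier H"
    proof
      show "\<Psi> ` carrier G \<subseteq> carrier H" using \<Psi>(1) by auto
      show "carrier H \<subseteq> \<Psi> ` carrier G"
      proof
        fix y assume y: "y \<in> carrier H"
        then have "F' y \<in> carrier B" using F'(2) by (auto simp: bij_betw_def)
        then have "F' y \<in> F ` carrier G" using F(2) by (simp add: bij_betw_def)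
        then obtain x where x: "x \<in> carrier G" "F x = F' y" by (metis imageE)
        then have "y = \<Psi> x" using inj[OF y \<Psi>(1)] \<Psi>(2) by simp
        then show "y \<in> \<Psi> ` carrier G" using x by blast
      qed
    qed
  qed
  ultimately show ?thesis by (simp add: iso_def)
qed

section \<open>Structure groups\<close>

definition sphere_points :: "'a cubeset \<Rightarrow> nat \<Rightarrow> 'a \<Rightarrow> 'a set" where
  "sphere_points X n x0 = {a. eqv X n x0 a}"

definition point_rel :: "'a cubeset \<Rightarrow> nat \<Rightarrow> 'a \<Rightarrow> ('a \<times> 'a) set" where
  "point_rel X n x0 = {(a, b). eqv X n x0 a \<and> eqv X n x0 b \<and> eqv X (Suc n) a b}"

lemma bits_in_cube: "(\<lambda>i\<in>{..<n}. of_bool (z i)) \<in> cube n"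
  by (auto simp: cube_def)

lemma bits_ones: "(\<lambda>i\<in>{..<n}. of_bool (z i)) = ones n \<longleftrightarrow> (\<forall>i<n. z i)"
  by (auto simp: ones_def fun_eq_iff restrict_def)

lemma bits_ones_upd:
  "j < n \<Longrightarrow> (\<lambda>i\<in>{..<n}. of_bool (z i)) = (ones n)(j := 0) \<longleftrightarrow> (\<forall>i<n. i \<noteq> j \<longrightarrow> z i) \<and> \<not> z j"
  by (auto simp: ones_def fun_eq_iff restrict_def)

lemma ones_in_cube: "ones n \<in> cube n"
  by (auto simp: ones_def cube_def)

context cfcubeset
begin

text \<open>Products and inverses exist because corners can be filled; all laws hold because two
  fillings of the same corner are related by \<open>eqv X (Suc n)\<close>.\<close>

lemma product_relation_points:
  assumes n: "1 \<le> n" and x0: "x0 \<in> sections X 0"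
  shows "product_relation (sphere_points X n x0) (point_rel X n x0) (square X n x0 x0) x0"
proof
  let ?S = "sphere_points X n x0"
  note refl = eqv_refl[OF eqv_in(1)]
  show "equiv ?S (point_rel X n x0)"
  proof (rule equivI)
    show "point_rel X n x0 \<subseteq> ?S \<times> ?S" by (auto simp: point_rel_def sphere_points_def)
    show "refl_on ?S (point_rel X n x0)" using refl by (auto simp: refl_on_def point_rel_def sphere_points_def)
    show "sym (point_rel X n x0)" using eqv_sym by (auto simp: sym_def point_rel_def)
    show "trans (point_rel X n x0)" using eqv_trans by (fastforce simp: trans_def point_rel_def)
  qed
  show "x0 \<in> ?S" using eqv_refl[OF x0] by (simp add: sphere_points_def)
  show "\<exists>e\<in>?S. square X n x0 x0 a b e" if "a \<in> ?S" "b \<in> ?S" for a b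
    using square_total[OF n x0] that unfolding sphere_points_def by blast
  show un: "(e, e') \<in> point_rel X n x0" if r: "(a, a') \<in> point_rel X n x0" "(b, b') \<in> point_rel X n x0"
      and ee: "e \<in> ?S" "e' \<in> ?S" and s: "square X n x0 x0 a b e" "square X n x0 x0 a' b' e'" for a a' b b' e e'
  proof -
    have "square X n x0 x0 a' b' e"
      by (rule square_cong[OF n x0 s(1)]) (use r refl[of n x0 e] ee in \<open>auto simp: point_rel_def sphere_points_def\<close>)
    from square_unique[OF n x0 this s(2)] show ?thesis using ee by (simp add: point_rel_def sphere_points_def)
  qed
  show "(g, g') \<in> point_rel X n x0" if ee: "g \<in> ?S" "g' \<in> ?S"
      and s: "square X n x0 x0 a b e" "square X n x0 x0 b c h" "square X n x0 x0 e c g" "square X n x0 x0 a h g'"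
    for a b c e h g g'
    using square_unique[OF n x0 square_assoc[OF n x0 s(1,2,3)] s(4)] ee by (simp add: point_rel_def sphere_points_def)
  show "(e, a) \<in> point_rel X n x0" if "a \<in> ?S" "e \<in> ?S" "square X n x0 x0 x0 a e" for a e
    using square_unique[OF n x0 that(3) square_unit[OF n x0]] that by (simp add: point_rel_def sphere_points_def)
  show "\<exists>b\<in>?S. \<exists>e\<in>?S. square X n x0 x0 b a e \<and> (e, x0) \<in> point_rel X n x0" if a: "a \<in> ?S" for a
  proof -
    obtain b where "square X n x0 x0 a b x0" "eqv X n x0 b"
      using square_inverse[OF n x0] a unfolding sphere_points_def by blast
    then show ?thesis using square_swap[OF n x0] eqv_refl[OF x0]
      by (intro bexI[of _ b] bexI[of _ x0]) (auto simp: sphere_points_def point_rel_def)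
  qed
qed

lemma str_cubes_vert: "c \<in> str_cubes X n x0 \<Longrightarrow> v \<in> cube n \<Longrightarrow> vert X n c v = (if v = ones n then vert X n c (ones n) else x0)"
  by (auto simp: str_cubes_def)

lemma str_cubes_bij: "bij_betw (\<lambda>c. vert X n c (ones n)) (str_cubes X n x0) (sphere_points X n x0)"
proof (rule bij_betw_imageI)
  show "inj_on (\<lambda>c. vert X n c (ones n)) (str_cubes X n x0)"
  proof (rule inj_onI)
    fix c d assume c: "c \<in> str_cubes X n x0" and d: "d \<in> str_cubes X n x0"
      and e: "vert X n c (ones n) = vert X n d (ones n)"
    show "c = d"
      by (rule section_eqI[of _ n]) (use c d e str_cubes_vert[OF c] str_cubes_vert[OF d] in \<open>auto simp: str_cubes_def\<close>)
  qed
  have iff: "is_cube X n (\<lambda>v. if v = ones n then a else x0) \<longleftrightarrow> eqv X n x0 a" for a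
    unfolding is_cube_iff_cub bits_ones eqv_def ..
  show "(\<lambda>c. vert X n c (ones n)) ` str_cubes X n x0 = sphere_points X n x0"
  proof
    show "(\<lambda>c. vert X n c (ones n)) ` str_cubes X n x0 \<subseteq> sphere_points X n x0"
    proof
      fix a assume "a \<in> (\<lambda>c. vert X n c (ones n)) ` str_cubes X n x0"
      then obtain c where c: "c \<in> str_cubes X n x0" "a = vert X n c (ones n)" by blast
      then have "is_cube X n (\<lambda>v. if v = ones n then a else x0)"
        using str_cubes_vert[OF c(1)] unfolding is_cube_def by (intro bexI[of _ c]) (auto simp: str_cubes_def)
      then show "a \<in> sphere_points X n x0" by (simp add: iff sphere_points_def)
    qed
    show "sphere_points X n x0 \<subseteq> (\<lambda>c. vert X n c (ones n)) ` str_cubes X n x0"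
    proof
      fix a assume "a \<in> sphere_points X n x0"
      then have "is_cube X n (\<lambda>v. if v = ones n then a else x0)" by (simp add: iff sphere_points_def)
      then obtain c where "c \<in> sections X n" "\<forall>v\<in>cube n. vert X n c v = (if v = ones n then a else x0)"
        by (auto simp: is_cube_def)
      then show "a \<in> (\<lambda>c. vert X n c (ones n)) ` str_cubes X n x0"
        using ones_in_cube by (intro image_eqI[of _ _ c]) (auto simp: str_cubes_def)
    qed
  qed
qed

text \<open>In direction \<open>j\<close> the defining cube differs from \<open>x0\<close> only on
  the edge through the last vertex, so \<open>peel\<close> with \<open>E1 = {..n} - {j}\<close> and
  \<open>E2 = {j}\<close> applies, whichever \<open>j\<close> is given. For the converse,
  \<open>unpeel\<close> is used with \<open>j = n\<close>.\<close>

lemma str_rel_iff: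
  assumes n: "1 \<le> n" and x0: "x0 \<in> sections X 0"
  shows "(c, d) \<in> str_rel X n x0 \<longleftrightarrow> c \<in> str_cubes X n x0 \<and> d \<in> str_cubes X n x0 \<and>
    (vert X n c (ones n), vert X n d (ones n)) \<in> point_rel X n x0"
proof (cases "c \<in> str_cubes X n x0 \<and> d \<in> str_cubes X n x0")
  case True
  define a b where "a = vert X n c (ones n)" and "b = vert X n d (ones n)"
  have ab: "eqv X n x0 a" "eqv X n x0 b"
    using True bij_betwE[OF str_cubes_bij] by (auto simp: sphere_points_def a_def b_def)
  have eq: "is_cube X (Suc n) (\<lambda>v. vert X n (if v j = 0 then c else d) (drop_coord n j v)) \<longleftrightarrow>
      cub (\<lambda>z. if \<forall>e\<in>{..n} - {j}. z e then if \<forall>e\<in>{j}. z e then b else a else x0)" if j: "j \<le> n" for j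
  proof -
    have "vert X n (if v j = 0 then c else d) (drop_coord n j v) =
        (if \<forall>e\<in>{..n} - {j}. z e then if \<forall>e\<in>{j}. z e then b else a else x0)"
      if v: "v = (\<lambda>i\<in>{..<Suc n}. of_bool (z i))" for v z
    proof -
      have dc: "drop_coord n j v = (\<lambda>i\<in>{..<n}. of_bool (z (if i < j then i else Suc i)))"
        unfolding v drop_coord_def using j by (auto simp: fun_eq_iff)
      have "(\<forall>i<n. z (if i < j then i else Suc i)) \<longleftrightarrow> (\<forall>e\<in>{..n} - {j}. z e)"
      proof (intro iffI ballI allI impI)
        fix e assume all: "\<forall>i<n. z (if i < j then i else Suc i)" and e: "e \<in> {..n} - {j}"
        show "z e"
        proof (cases "e < j")
          case True
          then show ?thesis using all[rule_format, of e] j by simp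
        next
          case False
          then show ?thesis using all[rule_format, of "e - 1"] e by (cases e) auto
        qed
      next
        fix i assume "\<forall>e\<in>{..n} - {j}. z e" "i < n"
        then show "z (if i < j then i else Suc i)" by auto
      qed
      then have "drop_coord n j v = ones n \<longleftrightarrow> (\<forall>e\<in>{..n} - {j}. z e)" unfolding dc bits_ones .
      moreover have "drop_coord n j v \<in> cube n" unfolding dc by (rule bits_in_cube)
      moreover have "v j = 0 \<longleftrightarrow> \<not> z j" using j by (simp add: v)
      ultimately show ?thesis
        using str_cubes_vert[of c n x0 "drop_coord n j v"] str_cubes_vert[of d n x0 "drop_coord n j v"] True
        unfolding a_def[symmetric] b_def[symmetric] by (cases "z j") simp_all
    qed
    then show ?thesis unfolding is_cube_iff_cub by simp
  qed
  have fin: "finite ({..n} - {j})" "finite {j}" "({..n} - {j}) \<inter> {j} = {}" for j by auto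
  have card: "card ({..n} - {j}) = n" "card ({..n} - {j}) + card {j} = Suc n" if "j \<le> n" for j using that by auto
  have "(\<exists>j\<le>n. is_cube X (Suc n) (\<lambda>v. vert X n (if v j = 0 then c else d) (drop_coord n j v))) \<longleftrightarrow> eqv X (Suc n) a b"
  proof
    assume "\<exists>j\<le>n. is_cube X (Suc n) (\<lambda>v. vert X n (if v j = 0 then c else d) (drop_coord n j v))"
    then obtain j where j: "j \<le> n" "cub (\<lambda>z. if \<forall>e\<in>{..n} - {j}. z e then if \<forall>e\<in>{j}. z e then b else a else x0)"
      using eq by blast
    show "eqv X (Suc n) a b"
      using peel[OF fin, of j x0 a b] j ab(1) unfolding card[OF j(1)] by simp
  next
    assume "eqv X (Suc n) a b"
    then have "cub (\<lambda>z. if \<forall>e\<in>{..n} - {n}. z e then if \<forall>e\<in>{n}. z e then b else a else x0)"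
      using ab(1) eqv_in(1)[OF ab(1)] by (intro unpeel[OF fin]) simp_all
    then show "\<exists>j\<le>n. is_cube X (Suc n) (\<lambda>v. vert X n (if v j = 0 then c else d) (drop_coord n j v))"
      using eq[of n] by blast
  qed
  then show ?thesis using True ab by (simp add: str_rel_def point_rel_def a_def b_def)
qed (auto simp: str_rel_def)

text \<open>The vertex at which only coordinate \<open>n\<close> is 0 is the corner (1,0) of the
  square, and the one at which only \<open>n - 1\<close> is 0 is the corner (0,1).\<close>

lemma str_prod_iff:
  assumes n: "1 \<le> n" and x0: "x0 \<in> sections X 0"
  shows "str_prod X n x0 c d e \<longleftrightarrow>
    square X n x0 x0 (vert X n c (ones n)) (vert X n d (ones n)) (vert X n e (ones n))"
proof -
  have "(\<lambda>z. if (\<lambda>i\<in>{..<Suc n}. of_bool (z i)) = (ones (Suc n))(n := 0) then a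
       else if (\<lambda>i\<in>{..<Suc n}. of_bool (z i)) = (ones (Suc n))(n - 1 := 0) then b
       else if (\<lambda>i\<in>{..<Suc n}. of_bool (z i)) = ones (Suc n) then t else x0)
    = (\<lambda>z. if \<forall>i<n - 1. z i then if z (n - 1) then if z n then t else a else if z n then b else x0 else x0)" for a b t
  proof
    fix z :: "nat \<Rightarrow> bool"
    have 1: "(\<forall>i<Suc n. i \<noteq> n \<longrightarrow> z i) \<longleftrightarrow> (\<forall>i<n - 1. z i) \<and> z (n - 1)"
      using all_less_n[OF n x0, of z] by (auto simp: less_Suc_eq)
    have "(\<forall>i<Suc n. i \<noteq> n - 1 \<longrightarrow> z i) \<longleftrightarrow> (\<forall>i<n. i \<noteq> n - 1 \<longrightarrow> z i) \<and> z n"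
      using n by (auto simp: less_Suc_eq)
    also have "\<dots> \<longleftrightarrow> (\<forall>i<n - 1. z i) \<and> z n"
      unfolding all_less_n[OF n x0] by auto
    finally have 2: "(\<forall>i<Suc n. i \<noteq> n - 1 \<longrightarrow> z i) \<longleftrightarrow> (\<forall>i<n - 1. z i) \<and> z n" .
    have b: "n < Suc n" "n - 1 < Suc n" by auto
    show "(if (\<lambda>i\<in>{..<Suc n}. of_bool (z i)) = (ones (Suc n))(n := 0) then a
       else if (\<lambda>i\<in>{..<Suc n}. of_bool (z i)) = (ones (Suc n))(n - 1 := 0) then b
       else if (\<lambda>i\<in>{..<Suc n}. of_bool (z i)) = ones (Suc n) then t else x0)
      = (if \<forall>i<n - 1. z i then if z (n - 1) then if z n then t else a else if z n then b else x0 else x0)"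
      unfolding bits_ones bits_ones_upd[OF b(1)] bits_ones_upd[OF b(2)] 1 2 all_le_iff[OF n x0] by auto
  qed
  then show ?thesis unfolding str_prod_def is_cube_iff_cub square_def by simp
qed

lemma str_group_eq: "str_group X n x0 = quotient_monoid (str_cubes X n x0) (str_rel X n x0) (str_prod X n x0) (const_cube X n x0)"
  by (simp add: str_group_def quotient_monoid_def)

lemma str_group_iso:
  assumes n: "1 \<le> n" and x0: "x0 \<in> sections X 0"
  shows "group (str_group X n x0)"
    and "(`) (\<lambda>c. vert X n c (ones n)) \<in> iso (str_group X n x0)
      (quotient_monoid (sphere_points X n x0) (point_rel X n x0) (square X n x0 x0) x0)"
proof -
  interpret product_relation "sphere_points X n x0" "point_rel X n x0" "square X n x0 x0" x0
    by (rule product_relation_points[OF assms])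
  have u: "const_cube X n x0 \<in> str_cubes X n x0" "vert X n (const_cube X n x0) (ones n) = x0"
    using x0 const_cube_in vert_const_cube ones_in_cube by (auto simp: str_cubes_def)
  have tot: "\<exists>e\<in>str_cubes X n x0. str_prod X n x0 c d e" if cd: "c \<in> str_cubes X n x0" "d \<in> str_cubes X n x0" for c d
  proof -
    obtain t where "t \<in> sphere_points X n x0" "square X n x0 x0 (vert X n c (ones n)) (vert X n d (ones n)) t"
      using total bij_betwE[OF str_cubes_bij] cd by blast
    moreover from calculation(1) have "t \<in> (\<lambda>c. vert X n c (ones n)) ` str_cubes X n x0"
      using str_cubes_bij[of n x0] by (simp add: bij_betw_def)
    then obtain e where "e \<in> str_cubes X n x0" "vert X n e (ones n) = t" by auto
    ultimately show ?thesis using str_prod_iff[OF assms] by blast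
  qed
  note args = str_cubes_bij[of n x0] str_rel_iff[OF assms] u iffD1[OF str_prod_iff[OF assms]] tot
  show "group (str_group X n x0)"
    unfolding str_group_eq
    by (rule product_relation.group[OF product_relation_transport[where \<theta> = "\<lambda>c. vert X n c (ones n)"]])
      (use args in auto)
  show "(`) (\<lambda>c. vert X n c (ones n)) \<in> iso (str_group X n x0) G"
    unfolding str_group_eq by (rule iso_transport) (use args in auto)
qed

end

section \<open>Spheres in \<open>Kstar X\<close>\<close>

text \<open>Coordinates are gaps between consecutive elements of \<open>T\<close>. The map
  \<epsilon> names a gap by its left end, which is \<open>j\<close> for \<open>(j, True)\<close> and
  the predecessor of \<open>j\<close> for \<open>(j, False)\<close>; independence makes these gaps
  distinct.\<close>

lemma inc_card:
  assumes P: "indep T P" and T: "finite T" and R: "R \<subseteq> P" and U: "finite U"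
    and right: "\<And>j. j \<in> R \<Longrightarrow> (j, True) \<in> inc T \<Longrightarrow> j \<in> U"
    and left: "\<And>j t. j \<in> R \<Longrightarrow> t \<in> T \<Longrightarrow> t < j \<Longrightarrow> t \<in> U"
  shows "finite {(j, b) \<in> inc T. j \<in> R}" "card {(j, b) \<in> inc T. j \<in> R} \<le> card U"
proof -
  let ?I = "{(j, b) \<in> inc T. j \<in> R}"
  define \<epsilon> where "\<epsilon> e = (if snd e then fst e else Max {t \<in> T. t < fst e})" for e :: "nat \<times> bool"
  have mx: "Max {t \<in> T. t < j} \<in> T \<and> Max {t \<in> T. t < j} < j" if "(j, False) \<in> inc T" for j
  proof -
    have "Max {t \<in> T. t < j} \<in> {t \<in> T. t < j}"
      by (rule Max_in) (use T that in \<open>auto simp: inc_def\<close>)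
    then show ?thesis by blast
  qed
  have sep: "Max {t \<in> T. t < j'} \<noteq> j" if jj: "j \<in> R" "j' \<in> R" "(j', False) \<in> inc T" for j j'
  proof
    assume eq: "Max {t \<in> T. t < j'} = j"
    then have "j < j'" using mx[OF jj(3)] by simp
    then obtain t where "t \<in> T" "j < t" "t < j'" using P R jj(1,2) unfolding indep_def by blast
    then show False using Max_ge[of "{t \<in> T. t < j'}" t] T eq by simp
  qed
  have mono: "Max {t \<in> T. t < j} \<noteq> Max {t \<in> T. t < j'}" if "j \<in> R" "j < j'" "(j, False) \<in> inc T" for j j'
  proof
    assume eq: "Max {t \<in> T. t < j} = Max {t \<in> T. t < j'}"
    have "j \<in> T" using that(1) R P by (auto simp: indep_def)
    then have "j \<le> Max {t \<in> T. t < j'}" using T that(2) by (intro Max_ge) auto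
    then show False using eq mx[OF that(3)] by simp
  qed
  have inj: "inj_on \<epsilon> ?I"
  proof (rule inj_onI)
    fix x y assume x: "x \<in> ?I" and y: "y \<in> ?I" and eq: "\<epsilon> x = \<epsilon> y"
    obtain j b j' b' where xy: "x = (j, b)" "y = (j', b')" by (cases x, cases y)
    have r: "j \<in> R" "j' \<in> R" "(j, b) \<in> inc T" "(j', b') \<in> inc T" using x y xy by auto
    show "x = y"
    proof (cases "b = b'")
      case True
      then show ?thesis
        using eq r mono[of j j'] mono[of j' j] unfolding xy \<epsilon>_def
        by (cases b'; cases j j' rule: linorder_cases) auto
    next
      case False
      then show ?thesis
        using eq r sep[of j j'] sep[of j' j] unfolding xy \<epsilon>_def by (cases b; cases b') auto
    qed
  qed
  have im: "\<epsilon> ` ?I \<subseteq> U"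
  proof
    fix t assume "t \<in> \<epsilon> ` ?I"
    then obtain j b where jb: "(j, b) \<in> inc T" "j \<in> R" "t = \<epsilon> (j, b)" by auto
    show "t \<in> U"
    proof (cases b)
      case True
      then show ?thesis using jb right by (simp add: \<epsilon>_def)
    next
      case False
      then show ?thesis using jb mx[of j] left[of j t] by (simp add: \<epsilon>_def)
    qed
  qed
  show "finite ?I" using inj_on_finite[OF inj im U] .
  show "card ?I \<le> card U" by (rule card_inj_on_le[OF inj im U])
qed

definition skip :: "nat \<Rightarrow> nat \<Rightarrow> nat" where
  "skip i j = (if j < i then j else Suc j)"

lemma skip_inj: "inj (skip i)"
  by (rule injI) (auto simp: skip_def split: if_splits)

lemma skip_image_Sub: "S \<in> Sub n \<Longrightarrow> skip i ` S \<in> Sub (Suc n) \<and> i \<notin> skip i ` S"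
  by (auto simp: Sub_atMost skip_def)

lemma skip_image_surj:
  assumes "S \<in> Sub (Suc n)" "i \<notin> S" "i \<le> Suc n"
  obtains S' where "S' \<in> Sub n" "S = skip i ` S'"
proof
  define S' where "S' = {j. skip i j \<in> S}"
  have ex: "\<exists>j. s = skip i j" if "s \<in> S" for s
  proof (cases "s < i")
    case True
    then show ?thesis by (intro exI[of _ s]) (simp add: skip_def)
  next
    case False
    then have "i < s" using that assms(2) by (metis linorder_neqE_nat)
    then show ?thesis by (intro exI[of _ "s - 1"]) (auto simp: skip_def)
  qed
  then show eq: "S = skip i ` S'" by (auto simp: S'_def)
  have "j \<le> n" if "j \<in> S'" for j
    using that assms by (auto simp: S'_def skip_def Sub_atMost split: if_splits)
  then show "S' \<in> Sub n" using eq assms(1) by (auto simp: Sub_atMost)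
qed

lemma skip_image_top: "i \<le> Suc n \<Longrightarrow> skip i ` {..n} = {..Suc n} - {i}"
proof
  assume i: "i \<le> Suc n"
  show "skip i ` {..n} \<subseteq> {..Suc n} - {i}" by (auto simp: skip_def)
  show "{..Suc n} - {i} \<subseteq> skip i ` {..n}"
  proof (cases "{..Suc n} - {i} = {}")
    case False
    then have "{..Suc n} - {i} \<in> Sub (Suc n)" by (auto simp: Sub_atMost)
    then obtain S' where "S' \<in> Sub n" "{..Suc n} - {i} = skip i ` S'"
      using skip_image_surj[of "{..Suc n} - {i}" n i] i by blast
    then show ?thesis by (auto simp: Sub_atMost)
  qed blast
qed

lemma const_map: "(\<lambda>j\<in>simplex n. 0) \<in> simplex_maps n 0"
  by (auto simp: simplex_maps_def simplex_def mono_on_def)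

lemma skip_eq_top: "i \<le> Suc n \<Longrightarrow> skip i ` S = {..Suc n} - {i} \<longleftrightarrow> S = {..n}"
  using skip_image_top[of i n] skip_inj[of i] by (metis inj_image_eq_iff)

section \<open>Labellings that are \<open>x0\<close> at almost all sets\<close>

context cfcubeset
begin

text \<open>Both \<open>a\<close> and \<open>x0\<close> are related to \<open>x0\<close>, so
  \<open>rel_any\<close> can place either of them at each vertex of a cube of dimension at most
  \<open>n\<close>.\<close>

lemma choose_cub:
  assumes E: "finite E" "card E \<le> n" and a: "eqv X n x0 a" and x0: "x0 \<in> sections X 0"
  shows "cub (\<lambda>z. if p (\<lambda>e. e \<in> E \<and> z e) then a else x0)"
proof -
  have "rel X n (\<lambda>_ :: nat \<Rightarrow> bool. x0) (if p \<eta> then \<lambda>_. a else (\<lambda>_. x0))" for \<eta>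
    using a eqv_refl[OF x0, of n] by (simp add: eqv_rel[where 'i = nat])
  from rel_any_coords[where G = "\<lambda>\<eta>. if p \<eta> then \<lambda>_. a else (\<lambda>_. x0)" and s = "\<lambda>e z. z e"
      and r = "\<lambda>i z. False", OF E this]
  have "cub (\<lambda>z. (if p (\<lambda>e. e \<in> E \<and> z e) then \<lambda>_. a else (\<lambda>_. x0)) (\<lambda>_ :: nat. False))" by simp
  then show ?thesis by (rule cub_subst_eq[where s = "\<lambda>i z. z i"]) auto
qed

text \<open>The edge from \<open>a\<close> to \<open>b\<close> takes the place of the point
  \<open>a\<close> in the argument for \<open>choose_cub\<close>; by \<open>unpeel\<close> it is
  related to the constant edge at \<open>x0\<close>.\<close>

lemma choose_edge_cub:
  assumes E: "finite E" "card E \<le> n" and a: "eqv X n x0 a" and x0: "x0 \<in> sections X 0"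
    and ab: "eqv X (Suc n) a b"
  shows "cub (\<lambda>z. if p (\<lambda>e. e \<in> E \<and> z e) then if z u then b else a else x0)"
proof -
  have "cub (\<lambda>z. if \<forall>e\<in>{..<n}. z e then if \<forall>e\<in>{n}. z e then b else a else x0)"
    by (rule unpeel) (use a ab eqv_in(1)[OF a] in simp_all)
  then have "rel X n (\<lambda>_ :: nat \<Rightarrow> bool. x0) (\<lambda>y. if y 0 then b else a)"
    unfolding rel_def
  proof (rule cub_subst_eq[where s = "\<lambda>i z. z (if i < n then Inl i else Inr 0)"])
    have "(\<forall>e\<in>{..<n}. z (if e < n then Inl e else Inr 0)) \<longleftrightarrow> (\<forall>k<n. z (Inl k))" for z :: "nat + nat \<Rightarrow> bool" by auto
    then show "(if \<forall>e\<in>{..<n}. z (if e < n then Inl e else Inr 0) then if \<forall>e\<in>{n}. z (if e < n then Inl e else Inr 0) then b else a else x0)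
      = (if \<forall>k<n. z (Inl k) then if z (Inr 0) then b else a else x0)" for z :: "nat + nat \<Rightarrow> bool" by auto
  qed simp
  moreover have "rel X n (\<lambda>_ :: nat \<Rightarrow> bool. x0) (\<lambda>_. x0)"
    using eqv_refl[OF x0, of n] by (simp add: eqv_rel[where 'i = nat])
  ultimately have "rel X n (\<lambda>_ :: nat \<Rightarrow> bool. x0) (if p \<eta> then \<lambda>y. if y 0 then b else a else (\<lambda>_. x0))" for \<eta>
    by simp
  from rel_any_coords[where G = "\<lambda>\<eta>. if p \<eta> then \<lambda>y. if y 0 then b else a else (\<lambda>_. x0)"
      and s = "\<lambda>e z. z e" and r = "\<lambda>i z. z u", OF E this]
  have "cub (\<lambda>z. (if p (\<lambda>e. e \<in> E \<and> z e) then \<lambda>y. if y 0 then b else a else (\<lambda>_. x0)) (\<lambda>_ :: nat. z u))" by simp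
  then show ?thesis by (rule cub_subst_eq[where s = "\<lambda>i z. z i"]) auto
qed

lemma cond_const:
  assumes x0: "x0 \<in> sections X 0" and P: "indep T P" and f: "\<And>S. S \<subseteq> T \<Longrightarrow> S \<noteq> {} \<Longrightarrow> f S = x0"
  shows "cond X f T P"
proof -
  have "fam f P (inc T) T = (\<lambda>_. x0)"
    unfolding fam_def by (rule ext, rule f) (use P in \<open>auto simp: indep_def\<close>)
  then show ?thesis unfolding cond_def using cub_const[OF x0] by simp
qed

text \<open>As \<open>T\<close> has only \<open>n\<close> gaps, the condition is a cube of dimension
  at most \<open>n\<close> in which just \<open>f T\<close> and \<open>x0\<close> occur.\<close>

lemma cond_top:
  assumes x0: "x0 \<in> sections X 0" and P: "indep T P" and T: "finite T" "card T = Suc n"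
    and a: "eqv X n x0 (f T)" and f: "\<And>S. S \<subset> T \<Longrightarrow> S \<noteq> {} \<Longrightarrow> f S = x0"
  shows "cond X f T P"
proof -
  let ?I = "{(j, b) \<in> inc T. j \<in> P}"
  have ne: "T \<noteq> {}" using T by auto
  have PT: "P \<subseteq> T" using P by (rule indep_sub)
  have card: "card (T - {Max T}) = n" using T Max_in[OF T(1) ne] by simp
  have I: "finite ?I" "card ?I \<le> n"
  proof -
    have r: "j \<in> T - {Max T}" if "j \<in> P" "(j, True) \<in> inc T" for j
      using that PT Max_ge[OF T(1)] by (fastforce simp: inc_def)
    have l: "t \<in> T - {Max T}" if "j \<in> P" "t \<in> T" "t < j" for j t
      using that PT Max_ge[OF T(1), of j] by auto
    have fin: "finite (T - {Max T})" using T by simp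
    show "finite ?I" "card ?I \<le> n"
      using inc_card[OF P T(1) subset_refl fin r l] card by auto
  qed
  have "fam f P (inc T) T z = (if \<forall>j\<in>P. \<exists>b. (j, b) \<in> inc T \<and> \<not> ((j, b) \<in> ?I \<and> z (j, b)) then f T else x0)" for z
  proof -
    define D where "D = {j \<in> P. \<forall>b. (j, b) \<in> inc T \<longrightarrow> z (j, b)}"
    have D: "D \<subseteq> P" by (auto simp: D_def)
    have "(\<forall>j\<in>P. \<exists>b. (j, b) \<in> inc T \<and> \<not> ((j, b) \<in> ?I \<and> z (j, b))) \<longleftrightarrow> D = {}" by (auto simp: D_def)
    moreover have "f (T - D) = x0" if "D \<noteq> {}"
      using that D P by (intro f) (auto simp: indep_def)
    ultimately show ?thesis by (auto simp: fam_def D_def[symmetric])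
  qed
  then have "fam f P (inc T) T = (\<lambda>z. if \<forall>j\<in>P. \<exists>b. (j, b) \<in> inc T \<and> \<not> ((j, b) \<in> ?I \<and> z (j, b)) then f T else x0)"
    by (rule ext)
  then show ?thesis
    unfolding cond_def
    using choose_cub[OF I a x0, of "\<lambda>\<eta>. \<forall>j\<in>P. \<exists>b. (j, b) \<in> inc T \<and> \<not> \<eta> (j, b)"] by (simp only:)
qed

lemma const_simplex_in: "s \<in> cubeset_hom (K 0) X \<Longrightarrow> const_simplex (Kstar X) n s \<in> cubeset_hom (K n) X"
  unfolding const_simplex_def by (rule Kstar_restr_in[OF const_map])

lemma val_const_simplex:
  assumes "S \<in> Sub n" "x0 \<in> sections X 0"
  shows "val (const_simplex (Kstar X) n (Kstar_vertex X x0)) S = x0"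
proof -
  have "(\<lambda>j\<in>simplex n. 0) ` S \<in> Sub 0" by (rule Sub_image[OF const_map assms(1)])
  then show ?thesis unfolding const_simplex_def val_restr[OF assms(1)] using val_Kstar_vertex[OF assms(2)] by blast
qed

lemma sface_skip: "S \<in> Sub (n - 1) \<Longrightarrow> val (sface (Kstar X) n i s) S = val s (skip i ` S)"
  unfolding val_sface by (intro arg_cong[where f = "val s"] image_cong) (auto simp: skip_def)

text \<open>All gaps of \<open>{..m}\<close> are coordinates, and in contrast to \<open>fam\<close>
  a single false coordinate removes its element. Thus \<open>{..m}\<close> sits at the last vertex,
  as \<open>peel\<close> expects.\<close>

lemma parity_cube:
  assumes "s \<in> cubeset_hom (K m) X" "1 \<le> m"
  shows "cub (\<lambda>z :: nat \<Rightarrow> bool. val s ({..m} - {j. j \<le> m \<and> even j = e \<and> (\<exists>i<m. (i = j \<or> Suc i = j) \<and> \<not> z i)}))"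
proof -
  define P where "P = {j. j \<le> m \<and> even j = e}"
  have "is_cube X m (\<lambda>v. val s ((\<lambda>j\<in>simplex m. j) ` ({..m} - {j \<in> P. \<exists>i<m. (i = j \<or> Suc i = j) \<and> v i \<noteq> 1})))"
  proof (rule hom_formal[OF assms(1) id_simplex_map])
    have "0 \<notin> P \<or> 1 \<notin> P" by (auto simp: P_def)
    then show "P \<noteq> {..m}" using assms(2) by auto
  qed (auto simp: P_def)
  moreover have "(\<lambda>j\<in>simplex m. j) ` ({..m} - D) = {..m} - D" for D by (force simp: simplex_def)
  ultimately have "cub (\<lambda>z :: nat \<Rightarrow> bool. val s ({..m} - {j \<in> P. \<exists>i<m. (i = j \<or> Suc i = j) \<and> (\<lambda>i\<in>{..<m}. of_bool (z i)) i \<noteq> (1::int)}))"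
    unfolding is_cube_iff_cub by simp
  moreover have "{j \<in> P. \<exists>i<m. (i = j \<or> Suc i = j) \<and> (\<lambda>i\<in>{..<m}. of_bool (z i)) i \<noteq> (1::int)}
    = {j. j \<le> m \<and> even j = e \<and> (\<exists>i<m. (i = j \<or> Suc i = j) \<and> \<not> z i)}" for z
    by (auto simp: P_def)
  ultimately show ?thesis by simp
qed

abbreviation sph :: "nat \<Rightarrow> 'a \<Rightarrow> 'a Kstar_simplex set" where
  "sph n x0 \<equiv> spheres (Kstar X) n (Kstar_vertex X x0)"

abbreviation base_simplex :: "nat \<Rightarrow> 'a \<Rightarrow> 'a Kstar_simplex" where
  "base_simplex n x0 \<equiv> const_simplex (Kstar X) n (Kstar_vertex X x0)"

section \<open>Simplices of \<open>Kstar X\<close> with trivial boundary\<close>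

context
  fixes n :: nat and x0 :: 'a
  assumes n: "1 \<le> n" and x0: "x0 \<in> sections X 0"
begin

lemma spheres_iff: "s \<in> sph n x0 \<longleftrightarrow> s \<in> cubeset_hom (K n) X \<and> (\<forall>S\<in>Sub n. S \<noteq> {..n} \<longrightarrow> val s S = x0)"
proof -
  obtain m where m: "n = Suc m" using n by (cases n) auto
  have v: "Kstar_vertex X x0 \<in> cubeset_hom (K 0) X" by (rule Kstar_vertex_in[OF x0])
  have "(\<forall>i\<le>n. sface (Kstar X) n i s = const_simplex (Kstar X) (n - 1) (Kstar_vertex X x0)) \<longleftrightarrow>
      (\<forall>S\<in>Sub n. S \<noteq> {..n} \<longrightarrow> val s S = x0)" if s: "s \<in> cubeset_hom (K n) X"
  proof (intro iffI allI impI ballI)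
    fix S assume F: "\<forall>i\<le>n. sface (Kstar X) n i s = const_simplex (Kstar X) (n - 1) (Kstar_vertex X x0)"
      and S: "S \<in> Sub n" "S \<noteq> {..n}"
    then obtain i where i: "i \<le> n" "i \<notin> S" by (auto simp: Sub_atMost)
    obtain S' where S': "S' \<in> Sub m" "S = skip i ` S'" using skip_image_surj[of S m i] S i m by blast
    have "val s S = val (sface (Kstar X) n i s) S'" using sface_skip[of S' n i s] S' m by simp
    also have "\<dots> = x0" using F i(1) val_const_simplex[OF S'(1) x0] m by simp
    finally show "val s S = x0" .
  next
    fix i assume F: "\<forall>S\<in>Sub n. S \<noteq> {..n} \<longrightarrow> val s S = x0" and i: "i \<le> n"
    show "sface (Kstar X) n i s = const_simplex (Kstar X) (n - 1) (Kstar_vertex X x0)"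
    proof (rule hom_eqI[OF sface_in[OF n s] const_simplex_in[OF v]])
      fix S assume S: "S \<in> Sub (n - 1)"
      have "skip i ` S \<in> Sub n" "skip i ` S \<noteq> {..n}" using skip_image_Sub[of S m i] S i m by auto
      then show "val (sface (Kstar X) n i s) S = val (const_simplex (Kstar X) (n - 1) (Kstar_vertex X x0)) S"
        using sface_skip[OF S] val_const_simplex[OF S x0] F by simp
    qed
  qed
  then show ?thesis by (auto simp: spheres_def)
qed

lemma top_in: "{..n} \<in> Sub n"
  by (auto simp: Sub_atMost)

lemma const_sphere: "const_simplex (Kstar X) n (Kstar_vertex X x0) \<in> sph n x0"
  "val (const_simplex (Kstar X) n (Kstar_vertex X x0)) {..n} = x0"
  unfolding spheres_iff
  using const_simplex_in[OF Kstar_vertex_in[OF x0]] val_const_simplex[OF _ x0] top_in by auto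

lemma face_sphere:
  assumes w: "w \<in> cubeset_hom (K (Suc n)) X" and s: "s \<in> sph n x0" and i: "i \<le> Suc n"
  shows "sface (Kstar X) (Suc n) i w = s \<longleftrightarrow>
    (\<forall>S\<in>Sub (Suc n). i \<notin> S \<longrightarrow> val w S = (if S = {..Suc n} - {i} then val s {..n} else x0))"
proof -
  have sh: "s \<in> cubeset_hom (K n) X" using s by (simp add: spheres_iff)
  have sv: "val s S = (if S = {..n} then val s {..n} else x0)" if "S \<in> Sub n" for S
    using s that by (auto simp: spheres_iff)
  have fin: "sface (Kstar X) (Suc n) i w \<in> cubeset_hom (K n) X" using sface_in[OF _ w, of i] by simp
  have fv: "val (sface (Kstar X) (Suc n) i w) S = val w (skip i ` S)" if "S \<in> Sub n" for S
    using sface_skip[of S "Suc n" i w] that by simp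
  show ?thesis
  proof (intro iffI ballI impI)
    fix S assume eq: "sface (Kstar X) (Suc n) i w = s" and S: "S \<in> Sub (Suc n)" "i \<notin> S"
    obtain S' where S': "S' \<in> Sub n" "S = skip i ` S'" using skip_image_surj[OF S i] by blast
    then show "val w S = (if S = {..Suc n} - {i} then val s {..n} else x0)"
      using fv[OF S'(1)] sv[OF S'(1)] eq skip_eq_top[OF i, of S'] by simp
  next
    assume F: "\<forall>S\<in>Sub (Suc n). i \<notin> S \<longrightarrow> val w S = (if S = {..Suc n} - {i} then val s {..n} else x0)"
    show "sface (Kstar X) (Suc n) i w = s"
    proof (rule hom_eqI[OF fin sh])
      fix S assume S: "S \<in> Sub n"
      show "val (sface (Kstar X) (Suc n) i w) S = val s S"
        using fv[OF S] sv[OF S] F skip_image_Sub[OF S, of i] skip_eq_top[OF i, of S] by simp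
    qed
  qed
qed

text \<open>Every gap touches an even number, so in the even parity cube each vertex but the last
  lacks some element and carries \<open>x0\<close>. The element 1 always stays, which keeps the
  label sets nonempty.\<close>

lemma sphere_eqv: "s \<in> sph n x0 \<Longrightarrow> eqv X n x0 (val s {..n})"
proof -
  assume s: "s \<in> sph n x0"
  have "cub (\<lambda>z :: nat \<Rightarrow> bool. val s ({..n} - {j. j \<le> n \<and> even j = True \<and> (\<exists>i<n. (i = j \<or> Suc i = j) \<and> \<not> z i)}))"
    by (rule parity_cube) (use s n in \<open>auto simp: spheres_iff\<close>)
  moreover have "val s ({..n} - {j. j \<le> n \<and> even j = True \<and> (\<exists>i<n. (i = j \<or> Suc i = j) \<and> \<not> z i)})
    = (if \<forall>k<n. z k then val s {..n} else x0)" for z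
  proof (cases "\<forall>k<n. z k")
    case True
    then have e: "{j. j \<le> n \<and> even j = True \<and> (\<exists>i<n. (i = j \<or> Suc i = j) \<and> \<not> z i)} = {}" by auto
    show ?thesis unfolding e using True by simp
  next
    case False
    define D where "D = {j. j \<le> n \<and> even j = True \<and> (\<exists>i<n. (i = j \<or> Suc i = j) \<and> \<not> z i)}"
    obtain i where i: "i < n" "\<not> z i" using False by blast
    define j where "j = (if even i then i else Suc i)"
    have j: "j \<in> D" using i by (auto simp: D_def j_def)
    have "1 \<notin> D" "1 \<le> n" using n by (auto simp: D_def)
    then have "{..n} - D \<in> Sub n" by (auto simp: Sub_atMost)
    moreover have "{..n} - D \<noteq> {..n}" using j by (auto simp: D_def)
    ultimately show ?thesis using s False unfolding spheres_iff D_def by auto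
  qed
  ultimately show ?thesis by (simp add: eqv_def)
qed

lemma sphere_bij: "bij_betw (\<lambda>s. val s {..n}) (sph n x0) (sphere_points X n x0)"
proof (rule bij_betw_imageI)
  show "inj_on (\<lambda>s. val s {..n}) (sph n x0)"
  proof (rule inj_onI)
    fix s t assume s: "s \<in> sph n x0" and t: "t \<in> sph n x0" and eq: "val s {..n} = val t {..n}"
    show "s = t"
    proof (rule hom_eqI)
      show "s \<in> cubeset_hom (K n) X" "t \<in> cubeset_hom (K n) X" using s t by (simp_all add: spheres_iff)
      show "val s S = val t S" if "S \<in> Sub n" for S
        using s t eq that by (cases "S = {..n}") (simp_all add: spheres_iff)
    qed
  qed
  show "(\<lambda>s. val s {..n}) ` sph n x0 = sphere_points X n x0"
  proof
    show "(\<lambda>s. val s {..n}) ` sph n x0 \<subseteq> sphere_points X n x0" using sphere_eqv by (auto simp: sphere_points_def)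
    show "sphere_points X n x0 \<subseteq> (\<lambda>s. val s {..n}) ` sph n x0"
    proof
      fix a assume a: "a \<in> sphere_points X n x0"
      define f where "f S = (if S = {..n} then a else x0)" for S
      have "K_labelling X n f"
        unfolding K_labelling_def
      proof (intro ballI allI impI)
        fix T P assume T: "T \<in> Sub n" and P: "indep T P"
        show "cond X f T P"
        proof (cases "T = {..n}")
          case True
          show ?thesis
            by (rule cond_top[OF x0 P, of n]) (use True a in \<open>auto simp: f_def sphere_points_def\<close>)
        next
          case False
          show ?thesis
            by (rule cond_const[OF x0 P]) (use False T in \<open>auto simp: f_def Sub_atMost\<close>)
        qed
      qed
      then obtain s where s: "s \<in> cubeset_hom (K n) X" "\<And>S. S \<in> Sub n \<Longrightarrow> val s S = f S"
        by (rule hom_of_labelling) blast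
      have "s \<in> sph n x0" unfolding spheres_iff using s by (simp add: f_def)
      moreover have "val s {..n} = a" using s(2)[OF top_in] by (simp add: f_def)
      ultimately show "a \<in> (\<lambda>s. val s {..n}) ` sph n x0" by blast
    qed
  qed
qed

end

lemma Diff_in_Sub: "j \<le> Suc n \<Longrightarrow> j \<notin> D \<Longrightarrow> {..Suc n} - D \<in> Sub (Suc n)"
  by (auto simp: Sub_atMost)

section \<open>Homotopies between spheres\<close>

context
  fixes n :: nat and x0 :: 'a
  assumes n: "1 \<le> n" and x0: "x0 \<in> sections X 0"
begin

lemma val_const_face:
  assumes w: "w \<in> cubeset_hom (K (Suc n)) X" and i: "sface (Kstar X) (Suc n) i w = base_simplex n x0" "i \<le> Suc n"
    and S: "S \<in> Sub (Suc n)" "i \<notin> S"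
  shows "val w S = x0"
  using face_sphere[OF n x0 w const_sphere(1)[OF n x0] i(2)] i(1) S const_sphere(2)[OF n x0] by simp

lemma val_top_face:
  assumes w: "w \<in> cubeset_hom (K (Suc n)) X" and i: "sface (Kstar X) (Suc n) i w = s" "i \<le> Suc n" "s \<in> sph n x0"
  shows "val w ({..Suc n} - {i}) = val s {..n}"
proof -
  have "{..Suc n} - {i} \<noteq> {}" using n by (cases "i = 0") auto
  then have "{..Suc n} - {i} \<in> Sub (Suc n)" by (auto simp: Sub_atMost)
  then show ?thesis using face_sphere[OF n x0 w i(3,2)] i(1) by simp
qed

text \<open>In the parity cube of \<open>n\<close> the gaps \<open>n - 1\<close> and
  \<open>n\<close> both belong to \<open>n\<close>, and a false coordinate at an earlier gap removes
  some \<open>j < n - 1\<close>, whose face is trivial. So \<open>peel\<close> is used with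
  \<open>n - 1\<close> and two directions.\<close>

lemma eqv_inner_face:
  assumes w: "w \<in> cubeset_hom (K (Suc n)) X" and u: "sface (Kstar X) (Suc n) n w = u" "u \<in> sph n x0"
    and c: "\<And>i. i < n - 1 \<Longrightarrow> sface (Kstar X) (Suc n) i w = base_simplex n x0"
  shows "eqv X (Suc n) (val u {..n}) (val w {..Suc n})"
proof -
  define D where "D z = {j. j \<le> Suc n \<and> even j = even n \<and> (\<exists>i<Suc n. (i = j \<or> Suc i = j) \<and> \<not> z i)}" for z
  have "cub (\<lambda>z. val w ({..Suc n} - D z))" unfolding D_def by (rule parity_cube[OF w]) simp
  moreover have "val w ({..Suc n} - D z) = (if \<forall>e\<in>{..<n - 1}. z e then if \<forall>e\<in>{n - 1, n}. z e then val w {..Suc n} else val u {..n} else x0)" for z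
  proof -
    consider "\<forall>i\<le>n. z i" | "\<forall>i<n - 1. z i" "\<not> z (n - 1) \<or> \<not> z n" | i where "i < n - 1" "\<not> z i"
      by (metis One_nat_def Suc_diff_1 le_neq_implies_less less_Suc_eq_le n Suc_le_eq)
    then show ?thesis
    proof cases
      case 1
      then have "D z = {}" by (auto simp: D_def)
      then show ?thesis using 1 by auto
    next
      case 2
      have "j = n" if jD: "j \<in> D z" for j
      proof -
        obtain i where i: "i < Suc n" "i = j \<or> Suc i = j" "\<not> z i" "even j = even n" using jD unfolding D_def by blast
        have "\<not> i < n - 1" using i(3) 2(1) by blast
        then have "i = n - 1 \<or> i = n" using i(1) by linarith
        then have "j = n - 1 \<or> j = n \<or> j = Suc n" using i(2) n by auto
        then show ?thesis using i(4) n by auto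
      qed
      moreover have "n \<in> D z" using 2(2) n by (auto simp: D_def intro: exI[of _ n] exI[of _ "n - 1"])
      ultimately have e: "D z = {n}" by blast
      show ?thesis unfolding e using val_top_face[OF w u(1) _ u(2)] 2 by auto
    next
      case 3
      define j where "j = (if even i = even n then i else Suc i)"
      have "i < Suc n" "j \<le> Suc n" "i = j \<or> Suc i = j" "even j = even n" using 3 by (auto simp: j_def)
      then have j: "j \<in> D z" unfolding D_def using 3(2) by blast
      have "j \<noteq> n - 1" using n by (cases n) (auto simp: j_def)
      then have jn: "j < n - 1" using 3 by (auto simp: j_def)
      have "val w ({..Suc n} - D z) = x0"
        by (rule val_const_face[OF w c[OF jn] _ Diff_in_Sub[of "Suc n"]]) (use jn j in \<open>auto simp: D_def\<close>)
      then show ?thesis using 3 by auto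
    qed
  qed
  ultimately have g: "cub (\<lambda>z. if \<forall>e\<in>{..<n - 1}. z e then if \<forall>e\<in>{n - 1, n}. z e then val w {..Suc n} else val u {..n} else x0)"
    by simp
  have E: "finite {..<n - 1}" "finite {n - 1, n}" "{..<n - 1} \<inter> {n - 1, n} = {}" by auto
  have card: "card {..<n - 1} + card {n - 1, n} = Suc n" using n by (cases n) auto
  show ?thesis
    using peel[OF E _ g] eqv_mono[OF sphere_eqv[OF n x0 u(2)], of "n - 1"] card by simp
qed

text \<open>In the parity cube of \<open>Suc n\<close> only the gap \<open>n\<close> belongs to
  \<open>Suc n\<close>, and all others remove some \<open>j < n\<close>. So \<open>peel\<close> is
  used with \<open>n\<close> directions and one.\<close>

lemma eqv_last_face:
  assumes w: "w \<in> cubeset_hom (K (Suc n)) X" and t: "sface (Kstar X) (Suc n) (Suc n) w = t" "t \<in> sph n x0"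
    and c: "\<And>i. i < n \<Longrightarrow> sface (Kstar X) (Suc n) i w = base_simplex n x0"
  shows "eqv X (Suc n) (val t {..n}) (val w {..Suc n})"
proof -
  define D where "D z = {j. j \<le> Suc n \<and> even j = even (Suc n) \<and> (\<exists>i<Suc n. (i = j \<or> Suc i = j) \<and> \<not> z i)}" for z
  have "cub (\<lambda>z. val w ({..Suc n} - D z))" unfolding D_def by (rule parity_cube[OF w]) simp
  moreover have "val w ({..Suc n} - D z) = (if \<forall>e\<in>{..<n}. z e then if \<forall>e\<in>{n}. z e then val w {..Suc n} else val t {..n} else x0)" for z
  proof -
    consider "\<forall>i\<le>n. z i" | "\<forall>i<n. z i" "\<not> z n" | i where "i < n" "\<not> z i"
      by (metis le_neq_implies_less)
    then show ?thesis
    proof cases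
      case 1
      then have "D z = {}" by (auto simp: D_def)
      then show ?thesis using 1 by auto
    next
      case 2
      have "j = Suc n" if jD: "j \<in> D z" for j
      proof -
        obtain i where i: "i < Suc n" "i = j \<or> Suc i = j" "\<not> z i" "even j = even (Suc n)" using jD unfolding D_def by blast
        have "\<not> i < n" using i(3) 2(1) by blast
        then have "i = n" using i(1) by linarith
        then show ?thesis using i(2,4) by auto
      qed
      moreover have "Suc n \<in> D z" using 2(2) by (auto simp: D_def)
      ultimately have e: "D z = {Suc n}" by blast
      show ?thesis unfolding e using val_top_face[OF w t(1) _ t(2)] 2 by auto
    next
      case 3
      define j where "j = (if even i = even (Suc n) then i else Suc i)"
      have "i < Suc n" "j \<le> Suc n" "i = j \<or> Suc i = j" "even j = even (Suc n)" using 3 by (auto simp: j_def)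
      then have j: "j \<in> D z" unfolding D_def using 3(2) by blast
      have "j \<noteq> n" by (auto simp: j_def)
      then have jn: "j < n" using 3 by (auto simp: j_def)
      have "val w ({..Suc n} - D z) = x0"
        by (rule val_const_face[OF w c[OF jn] _ Diff_in_Sub[of n]]) (use jn j in \<open>auto simp: D_def\<close>)
      then show ?thesis using 3 by auto
    qed
  qed
  ultimately have g: "cub (\<lambda>z. if \<forall>e\<in>{..<n}. z e then if \<forall>e\<in>{n}. z e then val w {..Suc n} else val t {..n} else x0)"
    by simp
  have E: "finite {..<n}" "finite {n}" "{..<n} \<inter> {n} = {}" by auto
  show ?thesis using peel[OF E _ g] sphere_eqv[OF n x0 t(2)] by simp
qed

text \<open>Giving \<open>{..Suc n}\<close> the label of \<open>{..Suc n} - {n}\<close> makes the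
  removal of \<open>n\<close> alone invisible. What remains at the full set is a choice between
  \<open>x0\<close> and the edge from \<open>a\<close> to \<open>b\<close>, controlled by the gaps
  of the elements below \<open>n\<close>; there are at most \<open>n\<close> of them.\<close>

lemma homotopy_labelling:
  assumes a: "eqv X n x0 a" and b: "eqv X n x0 b" and ab: "eqv X (Suc n) a b"
    and f: "f = (\<lambda>S. if S = {..Suc n} - {n} \<or> S = {..Suc n} then a else if S = {..Suc n} - {Suc n} then b else x0)"
  shows "K_labelling X (Suc n) f"
  unfolding K_labelling_def
proof (intro ballI allI impI)
  fix T P assume T: "T \<in> Sub (Suc n)" and P: "indep T P"
  have TN: "T \<subseteq> {..Suc n}" using T by (simp add: Sub_atMost)
  have nin: "n \<in> {..Suc n} - {Suc n}" "n \<notin> {..Suc n} - {n}" "Suc n \<in> {..Suc n} - {n}" "Suc n \<notin> {..Suc n} - {Suc n}" by auto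
  consider "T = {..Suc n}" | "T = {..Suc n} - {n}" | "T = {..Suc n} - {Suc n}"
    | "T \<noteq> {..Suc n}" "T \<noteq> {..Suc n} - {n}" "T \<noteq> {..Suc n} - {Suc n}" by blast
  then show "cond X f T P"
  proof cases
    case 1
    have PT: "P \<subseteq> {..Suc n}" using indep_sub[OF P] 1 by simp
    have notboth: "n \<notin> P \<or> Suc n \<notin> P" using indep_atMost_Suc[of "Suc n" P n] P 1 by blast
    define R where "R = {j \<in> P. j < n}"
    let ?I = "{(j, b) \<in> inc T. j \<in> R}"
    have I: "finite ?I" "card ?I \<le> n"
    proof -
      have "R \<subseteq> P" "finite T" using TN by (auto simp: R_def finite_subset)
      from inc_card[OF P this(2,1), of "{..<n}"] show "finite ?I" "card ?I \<le> n" by (auto simp: R_def)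
    qed
    define p where "p \<eta> \<longleftrightarrow> (\<forall>j\<in>R. \<exists>b. (j, b) \<in> inc T \<and> \<not> \<eta> (j, b))" for \<eta> :: "nat \<times> bool \<Rightarrow> bool"
    have val: "fam f P (inc T) T z = (if p (\<lambda>e. e \<in> ?I \<and> z e) then if Suc n \<in> P \<and> z (Suc n, False) then b else a else x0)" for z
    proof -
      define D where "D = {j \<in> P. \<forall>b. (j, b) \<in> inc T \<longrightarrow> z (j, b)}"
      have fD: "fam f P (inc T) T z = f ({..Suc n} - D)" by (simp add: fam_def D_def 1)
      have pD: "p (\<lambda>e. e \<in> ?I \<and> z e) \<longleftrightarrow> D \<inter> {..<n} = {}"
        by (auto simp: p_def D_def R_def)
      have SD: "Suc n \<in> D \<longleftrightarrow> Suc n \<in> P \<and> z (Suc n, False)"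
        by (auto simp: D_def 1 inc_atMost all_bool_eq)
      have DP: "D \<subseteq> P" by (auto simp: D_def)
      show ?thesis
      proof (cases "D \<inter> {..<n} = {}")
        case True
        have sub: "D \<subseteq> {n, Suc n}"
        proof
          fix j assume j: "j \<in> D"
          then have "\<not> j < n" "j \<le> Suc n" using True DP PT by auto
          then show "j \<in> {n, Suc n}" by auto
        qed
        show ?thesis
        proof (cases "Suc n \<in> D")
          case SnD: True
          then have "D = {Suc n}" using sub notboth DP by blast
          moreover have "{..Suc n} - {Suc n} \<noteq> {..Suc n} - {n}" "{..Suc n} - {Suc n} \<noteq> {..Suc n}" using nin by blast+
          ultimately have "f ({..Suc n} - D) = b" by (simp add: f)
          then show ?thesis using True SnD pD SD fD by auto
        next
          case False
          then have "D = {} \<or> D = {n}" using sub by blast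
          then have "f ({..Suc n} - D) = a" by (auto simp: f)
          then show ?thesis using True False pD SD fD by auto
        qed
      next
        case False
        then obtain j where j: "j \<in> D" "j < n" by auto
        have "j \<in> {..Suc n} - {n}" "j \<in> {..Suc n}" "j \<in> {..Suc n} - {Suc n}" using j(2) by auto
        then have "{..Suc n} - D \<noteq> {..Suc n} - {n}" "{..Suc n} - D \<noteq> {..Suc n}" "{..Suc n} - D \<noteq> {..Suc n} - {Suc n}"
          using j(1) by blast+
        then have "f ({..Suc n} - D) = x0" by (simp add: f)
        then show ?thesis using False pD fD by auto
      qed
    qed
    have "cub (\<lambda>z. if p (\<lambda>e. e \<in> ?I \<and> z e) then if Suc n \<in> P \<and> z (Suc n, False) then b else a else x0)"
    proof (cases "Suc n \<in> P")
      case True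
      then show ?thesis using choose_edge_cub[OF I a x0 ab, of p "(Suc n, False)"] by (simp only: True simp_thms)
    next
      case False
      then show ?thesis using choose_cub[OF I a x0, of p] by (simp only: simp_thms if_False)
    qed
    moreover have "fam f P (inc T) T = (\<lambda>z. if p (\<lambda>e. e \<in> ?I \<and> z e) then if Suc n \<in> P \<and> z (Suc n, False) then b else a else x0)"
      using val by (rule ext)
    ultimately show ?thesis unfolding cond_def by (simp only:)
  next
    case 2
    show ?thesis
    proof (rule cond_top[OF x0 P])
      show "finite T" "card T = Suc n" by (simp_all add: 2)
      show "eqv X n x0 (f T)" using a by (simp add: f 2)
      show "f S = x0" if S: "S \<subset> T" for S
      proof -
        have S': "n \<notin> S" "S \<noteq> {..Suc n} - {n}" using S unfolding 2 by blast+
        have "S \<noteq> {..Suc n}" "S \<noteq> {..Suc n} - {Suc n}" using S'(1) nin(1) by blast+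
        then show ?thesis using S'(2) by (simp add: f)
      qed
    qed
  next
    case 3
    show ?thesis
    proof (rule cond_top[OF x0 P])
      show "finite T" "card T = Suc n" by (simp_all add: 3)
      have "T \<noteq> {..Suc n} - {n}" "T \<noteq> {..Suc n}" using nin 3 by blast+
      then show "eqv X n x0 (f T)" using b 3 by (simp add: f)
      show "f S = x0" if S: "S \<subset> T" for S
      proof -
        have S': "Suc n \<notin> S" "S \<noteq> {..Suc n} - {Suc n}" using S unfolding 3 by blast+
        have "S \<noteq> {..Suc n}" "S \<noteq> {..Suc n} - {n}" using S'(1) nin(3) by blast+
        then show ?thesis using S'(2) by (simp add: f)
      qed
    qed
  next
    case 4
    show ?thesis
    proof (rule cond_const[OF x0 P])
      fix S assume S: "S \<subseteq> T" "S \<noteq> {}"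
      have "S \<noteq> {..Suc n}" using S 4 TN by blast
      moreover have "S \<noteq> {..Suc n} - {n}"
      proof
        assume "S = {..Suc n} - {n}"
        then show False using S(1) 4(1,2) TN by (cases "n \<in> T") blast+
      qed
      moreover have "S \<noteq> {..Suc n} - {Suc n}"
      proof
        assume "S = {..Suc n} - {Suc n}"
        then show False using S(1) 4(1,3) TN by (cases "Suc n \<in> T") blast+
      qed
      ultimately show "f S = x0" by (simp add: f)
    qed
  qed
qed

lemma homotopy_rel_iff:
  "(s, t) \<in> homotopy_rel (Kstar X) n (Kstar_vertex X x0) \<longleftrightarrow>
    s \<in> sph n x0 \<and> t \<in> sph n x0 \<and> (val s {..n}, val t {..n}) \<in> point_rel X n x0"
proof (cases "s \<in> sph n x0 \<and> t \<in> sph n x0")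
  case True
  then have st: "s \<in> sph n x0" "t \<in> sph n x0" by auto
  note e = sphere_eqv[OF n x0 st(1)] sphere_eqv[OF n x0 st(2)]
  have "(\<exists>w\<in>cubeset_hom (K (Suc n)) X. sface (Kstar X) (Suc n) n w = s \<and> sface (Kstar X) (Suc n) (Suc n) w = t \<and>
      (\<forall>i<n. sface (Kstar X) (Suc n) i w = base_simplex n x0)) \<longleftrightarrow> eqv X (Suc n) (val s {..n}) (val t {..n})"
  proof
    assume "\<exists>w\<in>cubeset_hom (K (Suc n)) X. sface (Kstar X) (Suc n) n w = s \<and> sface (Kstar X) (Suc n) (Suc n) w = t \<and>
      (\<forall>i<n. sface (Kstar X) (Suc n) i w = base_simplex n x0)"
    then obtain w where w: "w \<in> cubeset_hom (K (Suc n)) X" "sface (Kstar X) (Suc n) n w = s"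
      "sface (Kstar X) (Suc n) (Suc n) w = t" "\<And>i. i < n \<Longrightarrow> sface (Kstar X) (Suc n) i w = base_simplex n x0" by blast
    have "eqv X (Suc n) (val s {..n}) (val w {..Suc n})"
      using w(4) by (intro eqv_inner_face[OF w(1,2) st(1)]) auto
    moreover have "eqv X (Suc n) (val t {..n}) (val w {..Suc n})"
      by (rule eqv_last_face[OF w(1,3) st(2) w(4)])
    ultimately show "eqv X (Suc n) (val s {..n}) (val t {..n})"
      using eqv_sym eqv_trans by (metis One_nat_def Suc_leI zero_less_Suc)
  next
    assume ab: "eqv X (Suc n) (val s {..n}) (val t {..n})"
    define f where "f = (\<lambda>S. if S = {..Suc n} - {n} \<or> S = {..Suc n} then val s {..n}
      else if S = {..Suc n} - {Suc n} then val t {..n} else x0)"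
    obtain w where w: "w \<in> cubeset_hom (K (Suc n)) X" "\<And>S. S \<in> Sub (Suc n) \<Longrightarrow> val w S = f S"
      using hom_of_labelling[OF homotopy_labelling[OF e ab f_def]] by blast
    have nin: "n \<in> {..Suc n} - {Suc n}" "Suc n \<in> {..Suc n} - {n}" "n \<in> {..Suc n}" "Suc n \<in> {..Suc n}" by auto
    have "sface (Kstar X) (Suc n) n w = s"
      unfolding face_sphere[OF n x0 w(1) st(1) le_SucI[OF order_refl]]
    proof (intro ballI impI)
      fix S assume "S \<in> Sub (Suc n)" "n \<notin> S"
      moreover have "S \<noteq> {..Suc n}" "S \<noteq> {..Suc n} - {Suc n}" using \<open>n \<notin> S\<close> nin by blast+
      ultimately show "val w S = (if S = {..Suc n} - {n} then val s {..n} else x0)" by (simp add: w(2) f_def)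
    qed
    moreover have "sface (Kstar X) (Suc n) (Suc n) w = t"
      unfolding face_sphere[OF n x0 w(1) st(2) order_refl]
    proof (intro ballI impI)
      fix S assume "S \<in> Sub (Suc n)" "Suc n \<notin> S"
      moreover have "S \<noteq> {..Suc n}" "S \<noteq> {..Suc n} - {n}" using \<open>Suc n \<notin> S\<close> nin by blast+
      ultimately show "val w S = (if S = {..Suc n} - {Suc n} then val t {..n} else x0)" by (simp add: w(2) f_def)
    qed
    moreover have "sface (Kstar X) (Suc n) i w = base_simplex n x0" if i: "i < n" for i
    proof -
      have il: "i \<le> Suc n" using i by simp
      show ?thesis
        unfolding face_sphere[OF n x0 w(1) const_sphere(1)[OF n x0] il] const_sphere(2)[OF n x0]
      proof (intro ballI impI)
        fix S assume S: "S \<in> Sub (Suc n)" "i \<notin> S"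
        have "i \<in> {..Suc n} - {n}" "i \<in> {..Suc n}" "i \<in> {..Suc n} - {Suc n}" using i by auto
        then have "S \<noteq> {..Suc n}" "S \<noteq> {..Suc n} - {n}" "S \<noteq> {..Suc n} - {Suc n}" using S(2) by blast+
        then show "val w S = (if S = {..Suc n} - {i} then x0 else x0)" using S(1) by (simp add: w(2) f_def)
      qed
    qed
    ultimately show "\<exists>w\<in>cubeset_hom (K (Suc n)) X. sface (Kstar X) (Suc n) n w = s \<and> sface (Kstar X) (Suc n) (Suc n) w = t \<and>
      (\<forall>i<n. sface (Kstar X) (Suc n) i w = base_simplex n x0)" using w(1) by blast
  qed
  then show ?thesis using st e by (simp add: homotopy_rel_def point_rel_def)
qed (auto simp: homotopy_rel_def)

end

section \<open>Products of spheres\<close>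

context
  fixes n :: nat and x0 :: 'a
  assumes n: "1 \<le> n" and x0: "x0 \<in> sections X 0"
begin

text \<open>In the parity cube of \<open>Suc n\<close> the gaps \<open>n - 2\<close> and
  \<open>n - 1\<close> belong to \<open>n - 1\<close>, and the gap \<open>n\<close> to
  \<open>Suc n\<close>. This is almost the wanted square, except that the face where gap
  \<open>n - 2\<close> is false shows the label of \<open>s\<close> instead of being constant. For
  \<open>n \<ge> 2\<close> a second cube is glued on in that direction to restore
  \<open>x0\<close>.\<close>

lemma outer_faces_square:
  assumes w: "w \<in> cubeset_hom (K (Suc n)) X" and s: "sface (Kstar X) (Suc n) (n - 1) w = s" "s \<in> sph n x0"
    and t: "sface (Kstar X) (Suc n) (Suc n) w = t" "t \<in> sph n x0"
    and c: "\<And>i. i < n - 1 \<Longrightarrow> sface (Kstar X) (Suc n) i w = base_simplex n x0"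
  shows "square X n x0 x0 (val t {..n}) (val s {..n}) (val w {..Suc n})"
proof -
  let ?s = "val s {..n}" and ?t = "val t {..n}" and ?w = "val w {..Suc n}"
  define D where "D z = {j. j \<le> Suc n \<and> even j = even (Suc n) \<and> (\<exists>i<Suc n. (i = j \<or> Suc i = j) \<and> \<not> z i)}" for z
  \<comment> \<open>For \<open>n = 1\<close> the truncated \<open>n - 2\<close> equals
    \<open>n - 1 = 0\<close>, so the formula also covers an element 0 with a single gap.\<close>
  define h where "h z = (if \<forall>i<n - 2. z i then if z (n - 2) \<and> z (n - 1) then if z n then ?w else ?t
     else if z n then ?s else x0 else x0)" for z
  have "cub (\<lambda>z. val w ({..Suc n} - D z))" unfolding D_def by (rule parity_cube[OF w]) simp
  moreover have "val w ({..Suc n} - D z) = h z" for z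
  proof (cases "\<forall>i<n - 2. z i")
    case True
    have sub: "j = n - 1 \<or> j = Suc n" if jD: "j \<in> D z" for j
    proof -
      obtain i where i: "i < Suc n" "i = j \<or> Suc i = j" "\<not> z i" "even j = even (Suc n)" using jD unfolding D_def by blast
      have "\<not> i < n - 2" using i(3) True by blast
      then have "j = n - 2 \<or> j = n - 1 \<or> j = n \<or> j = Suc n" using i(1,2) by linarith
      then show ?thesis using i(4) n by (cases "n = 1") auto
    qed
    have S: "Suc n \<in> D z \<longleftrightarrow> \<not> z n" by (auto simp: D_def)
    have N: "n - 1 \<in> D z \<longleftrightarrow> \<not> (z (n - 2) \<and> z (n - 1))"
    proof -
      have par: "even (n - 1) = even (Suc n)" using n by auto
      have "(\<exists>i<Suc n. (i = n - 1 \<or> Suc i = n - 1) \<and> \<not> z i) \<longleftrightarrow> \<not> (z (n - 2) \<and> z (n - 1))"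
      proof (cases "n = 1")
        case False
        then obtain k where "n = Suc (Suc k)" using n by (metis One_nat_def Suc_le_D le_SucE le_antisym not_less_eq_eq)
        then show ?thesis by (auto intro: exI[of _ k] exI[of _ "Suc k"])
      qed auto
      then show ?thesis using par by (auto simp: D_def)
    qed
    have ne: "n - 1 \<noteq> Suc n" by simp
    consider "D z = {}" | "D z = {Suc n}" | "D z = {n - 1}" | "D z = {n - 1, Suc n}" using sub by blast
    then show ?thesis
    proof cases
      case 1
      then show ?thesis using True S N by (simp add: h_def)
    next
      case 2
      then have "z (n - 2) \<and> z (n - 1)" "\<not> z n" using S N ne by auto
      then show ?thesis using True val_top_face[OF n x0 w t(1) _ t(2)] 2 by (simp add: h_def)
    next
      case 3
      then have "\<not> (z (n - 2) \<and> z (n - 1))" "z n" using S N ne by auto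
      moreover have "val w ({..Suc n} - {n - 1}) = ?s" by (rule val_top_face[OF n x0 w s(1) _ s(2)]) simp
      ultimately show ?thesis unfolding 3 using True by (auto simp: h_def)
    next
      case 4
      then have z: "\<not> (z (n - 2) \<and> z (n - 1))" "\<not> z n" using S N ne by auto
      have "{..Suc n} - {n - 1, Suc n} \<in> Sub (Suc n)" by (rule Diff_in_Sub[of n]) (use n in auto)
      moreover have "{..Suc n} - {n - 1, Suc n} \<noteq> {..Suc n} - {n - 1}" 
      proof
        assume "{..Suc n} - {n - 1, Suc n} = {..Suc n} - {n - 1}"
        moreover have "Suc n \<in> {..Suc n} - {n - 1}" using ne by auto
        ultimately show False by blast
      qed
      moreover have "n - 1 \<notin> {..Suc n} - {n - 1, Suc n}" by simp
      ultimately have "val w ({..Suc n} - {n - 1, Suc n}) = x0"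
        using face_sphere[OF n x0 w s(2), of "n - 1"] s(1) by (simp add: le_diff_conv)
      then show ?thesis unfolding 4 using True z by (auto simp: h_def)
    qed
  next
    case False
    then obtain i where i: "i < n - 2" "\<not> z i" by blast
    define j where "j = (if even i = even (Suc n) then i else Suc i)"
    have "i < Suc n" "j \<le> Suc n" "i = j \<or> Suc i = j" "even j = even (Suc n)" using i by (auto simp: j_def)
    then have j: "j \<in> D z" unfolding D_def using i(2) by blast
    have jn: "j < n - 1" using i by (auto simp: j_def)
    have "n \<notin> D z" by (auto simp: D_def)
    then have "val w ({..Suc n} - D z) = x0"
      by (intro val_const_face[OF n x0 w c[OF jn]] Diff_in_Sub[of n]) (use jn j in auto)
    then show ?thesis using False by (auto simp: h_def)
  qed
  ultimately have h: "cub h" by simp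
  show ?thesis
  proof (cases "n = 1")
    case True
    show ?thesis
      unfolding square_def by (rule cub_subst_eq[OF h, where s = "\<lambda>i z. z i"]) (auto simp: h_def True)
  next
    case False
    then obtain k where k: "n = Suc (Suc k)" using n by (metis One_nat_def Suc_le_D le_SucE le_antisym not_less_eq_eq)
    \<comment> \<open>It agrees with \<open>h\<close> where \<open>z k\<close> is false and is
      \<open>x0\<close> where \<open>z k\<close> is true; up to a reflection in direction
      \<open>k\<close> it is the cube that relates \<open>x0\<close> to the label of
      \<open>s\<close>.\<close>
    define g2 where "g2 z = (if (\<forall>i<k. z i) \<and> \<not> z k \<and> z n then ?s else x0)" for z :: "nat \<Rightarrow> bool"
    have hk: "h z = (if \<forall>i<k. z i then if z k \<and> z (Suc k) then if z n then ?w else ?t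
       else if z n then ?s else x0 else x0)" for z by (auto simp: h_def k)
    have g2: "cub g2"
    proof -
      have "card (insert n {..<Suc k}) = n" by (simp add: k)
      then have "cub (\<lambda>z. if \<forall>e\<in>insert n {..<Suc k}. z e then ?s else x0)"
        using eqv_iff[of "insert n {..<Suc k}" n x0 ?s] sphere_eqv[OF n x0 s(2)] by simp
      then show ?thesis
      proof (rule cub_subst_eq[where s = "\<lambda>i z. if i = k then \<not> z i else z i"])
        show "lit (\<lambda>z. if i = k then \<not> z i else z i)" for i by (rule lit_if) simp_all
      qed (auto simp: g2_def k lessThan_Suc)
    qed
    have "cub (\<lambda>z. if z k then h (z(k := True)) else g2 (z(k := True)))"
      by (rule glue[OF h g2]) (auto simp: hk g2_def k)
    moreover have "(\<forall>i<n - 1. z i) \<longleftrightarrow> (\<forall>i<k. z i) \<and> z k" for z by (auto simp: k less_Suc_eq)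
    ultimately show ?thesis
      unfolding square_def by (elim cub_subst_eq[where s = "\<lambda>i z. z i"]) (auto simp: hk g2_def k)
  qed
qed

text \<open>The faces \<open>n - 1\<close> and \<open>Suc n\<close> give a square that ends in the
  label of the whole simplex, and by the inner face \<open>n\<close> this label is related to that
  of \<open>u\<close>. The final swap restores the order of the factors.\<close>

lemma homotopy_prod_square:
  assumes s: "s \<in> sph n x0" and t: "t \<in> sph n x0" and u: "u \<in> sph n x0"
    and p: "homotopy_prod (Kstar X) n (Kstar_vertex X x0) s t u"
  shows "square X n x0 x0 (val s {..n}) (val t {..n}) (val u {..n})"
proof -
  obtain w where w: "w \<in> cubeset_hom (K (Suc n)) X" "sface (Kstar X) (Suc n) (n - 1) w = s"
    "sface (Kstar X) (Suc n) (Suc n) w = t" "sface (Kstar X) (Suc n) n w = u"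
    "\<And>i. i < n - 1 \<Longrightarrow> sface (Kstar X) (Suc n) i w = base_simplex n x0"
    using p unfolding homotopy_prod_def by auto
  have "square X n x0 x0 (val t {..n}) (val s {..n}) (val w {..Suc n})"
    by (rule outer_faces_square[OF w(1,2) s w(3) t w(5)])
  moreover have "eqv X (Suc n) (val w {..Suc n}) (val u {..n})"
    by (rule eqv_sym[OF eqv_inner_face[OF n x0 w(1,4) u w(5)]]) simp_all
  moreover have "eqv X (Suc n) (val r {..n}) (val r {..n})" if "r \<in> sph n x0" for r
    using eqv_refl[OF eqv_in(1)[OF sphere_eqv[OF n x0 that]]] .
  ultimately have "square X n x0 x0 (val t {..n}) (val s {..n}) (val u {..n})"
    using square_cong[OF n x0] s t by blast
  then show ?thesis by (rule square_swap[OF n x0])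
qed

text \<open>A horn lacking the face \<open>n\<close> carries \<open>s\<close> and \<open>t\<close>
  and is trivial elsewhere. The missing face of a filler is the product.\<close>

lemma homotopy_prod_total:
  assumes s: "s \<in> sph n x0" and t: "t \<in> sph n x0"
  shows "\<exists>u\<in>sph n x0. homotopy_prod (Kstar X) n (Kstar_vertex X x0) s t u"
proof -
  define f where "f S = (if S = {..Suc n} - {n - 1} then val s {..n} else if S = {..Suc n} - {Suc n} then val t {..n} else x0)" for S
  have nin: "n \<in> {..Suc n} - {n - 1}" "n \<in> {..Suc n} - {Suc n}" "n - 1 \<in> {..Suc n} - {Suc n}"
    "Suc n \<in> {..Suc n} - {n - 1}" using n by auto
  have fpt: "f S = x0" if "S \<noteq> {..Suc n} - {n - 1}" "S \<noteq> {..Suc n} - {Suc n}" for S using that by (simp add: f_def)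
  have H: "cond X f T P" if T: "T \<subseteq> {..Suc n}" "insert n T \<noteq> {..Suc n}" and P: "indep T P" for T P
  proof -
    consider "T = {..Suc n} - {n - 1}" | "T = {..Suc n} - {Suc n}"
      | "T \<noteq> {..Suc n} - {n - 1}" "T \<noteq> {..Suc n} - {Suc n}" by blast
    then show ?thesis
    proof cases
      case 1
      show ?thesis
      proof (rule cond_top[OF x0 P])
        have "n - 1 \<in> {..Suc n}" by simp
        then show "finite T" "card T = Suc n" unfolding 1 by simp_all
        show "eqv X n x0 (f T)" using sphere_eqv[OF n x0 s] by (simp add: f_def 1)
        show "f S = x0" if "S \<subset> T" "S \<noteq> {}" for S
          by (rule fpt) (use that nin(3) in \<open>auto simp: 1\<close>)
      qed
    next
      case 2
      show ?thesis
      proof (rule cond_top[OF x0 P])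
        show "finite T" "card T = Suc n" unfolding 2 by simp_all
        have "T \<noteq> {..Suc n} - {n - 1}" using nin 2 by blast
        then show "eqv X n x0 (f T)" using sphere_eqv[OF n x0 t] by (simp add: f_def 2)
        show "f S = x0" if "S \<subset> T" "S \<noteq> {}" for S
          by (rule fpt) (use that nin(4) in \<open>auto simp: 2\<close>)
      qed
    next
      case 3
      have out: "S \<noteq> {..Suc n} - {i}" if "S \<subseteq> T" "i \<noteq> n" "T \<noteq> {..Suc n} - {i}" for S i
      proof
        assume "S = {..Suc n} - {i}"
        then have "{..Suc n} - {i} \<subseteq> T" using that(1) by simp
        then have "T = {..Suc n} \<or> T = {..Suc n} - {i}" using T(1) by (cases "i \<in> T") blast+
        moreover have "T \<noteq> {..Suc n}" using T(2) by auto
        ultimately show False using that(3) by blast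
      qed
      show ?thesis
        by (rule cond_const[OF x0 P], rule fpt) (use out[of _ "n - 1"] out[of _ "Suc n"] 3 n in auto)
    qed
  qed
  have "1 \<le> Suc n" "n \<le> Suc n" by simp_all
  from K_labelling_fill[OF this H]
  obtain f' where f': "K_labelling X (Suc n) f'" "\<And>S. S \<subseteq> {..Suc n} \<Longrightarrow> insert n S \<noteq> {..Suc n} \<Longrightarrow> f' S = f S"
    by blast
  obtain w where w: "w \<in> cubeset_hom (K (Suc n)) X" "\<And>S. S \<in> Sub (Suc n) \<Longrightarrow> val w S = f' S"
    using hom_of_labelling[OF f'(1)] by blast
  have wf: "val w S = f S" if "S \<in> Sub (Suc n)" "i \<notin> S" "i \<le> Suc n" "i \<noteq> n" for S i
  proof -
    have "insert n S \<noteq> {..Suc n}" using that by auto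
    then show ?thesis using w(2)[OF that(1)] f'(2)[of S] that(1) by (simp add: Sub_atMost)
  qed
  have nn: "n - 1 \<noteq> n" "n - 1 \<le> Suc n" using n by auto
  have Fs: "sface (Kstar X) (Suc n) (n - 1) w = s"
    unfolding face_sphere[OF n x0 w(1) s nn(2)]
  proof (intro ballI impI)
    fix S assume S: "S \<in> Sub (Suc n)" "n - 1 \<notin> S"
    have "S \<noteq> {..Suc n} - {Suc n}" using S(2) nin(3) by blast
    then show "val w S = (if S = {..Suc n} - {n - 1} then val s {..n} else x0)"
      using wf[OF S nn(2,1)] by (simp add: f_def)
  qed
  have Ft: "sface (Kstar X) (Suc n) (Suc n) w = t"
    unfolding face_sphere[OF n x0 w(1) t order_refl]
  proof (intro ballI impI)
    fix S assume S: "S \<in> Sub (Suc n)" "Suc n \<notin> S"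
    have "S \<noteq> {..Suc n} - {n - 1}" using S(2) nin(4) by blast
    then show "val w S = (if S = {..Suc n} - {Suc n} then val t {..n} else x0)"
      using wf[OF S order_refl] by (simp add: f_def)
  qed
  have Fc: "sface (Kstar X) (Suc n) i w = base_simplex n x0" if i: "i < n - 1" for i
  proof -
    have il: "i \<le> Suc n" "i \<noteq> n" using i by auto
    show ?thesis
      unfolding face_sphere[OF n x0 w(1) const_sphere(1)[OF n x0] il(1)] const_sphere(2)[OF n x0]
    proof (intro ballI impI)
      fix S assume S: "S \<in> Sub (Suc n)" "i \<notin> S"
      have "i \<in> {..Suc n} - {n - 1}" "i \<in> {..Suc n} - {Suc n}" using i by auto
      then have "f S = x0" using S(2) by (intro fpt) blast+
      then show "val w S = (if S = {..Suc n} - {i} then x0 else x0)" using wf[OF S il] by simp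
    qed
  qed
  have "sface (Kstar X) (Suc n) n w \<in> sph n x0"
    unfolding spheres_iff[OF n x0]
  proof (intro conjI ballI impI)
    show "sface (Kstar X) (Suc n) n w \<in> cubeset_hom (K n) X" using sface_in[OF _ w(1), of n] by simp
    fix S assume S: "S \<in> Sub n" "S \<noteq> {..n}"
    have sk: "skip n ` S \<in> Sub (Suc n)" "n \<notin> skip n ` S" using skip_image_Sub[OF S(1)] by auto
    have "skip n ` S \<noteq> {..Suc n} - {n}" using skip_eq_top[of n n S] S(2) by simp
    moreover have "skip n ` S \<subseteq> {..Suc n}" using sk(1) by (simp add: Sub_atMost)
    \<comment> \<open>A proper subset of the face \<open>n\<close> misses a further element, so its
      label was prescribed by the horn.\<close>
    ultimately obtain j where "j \<in> {..Suc n} - {n}" "j \<notin> skip n ` S" using sk(2) by blast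
    then have j: "j \<le> Suc n" "j \<noteq> n" "j \<notin> skip n ` S" by auto
    have "f (skip n ` S) = x0" using sk(2) nin by (intro fpt) blast+
    then show "val (sface (Kstar X) (Suc n) n w) S = x0"
      using sface_skip[of S "Suc n" n w] S(1) wf[OF sk(1) j(3,1,2)] by simp
  qed
  then show ?thesis using w(1) Fs Ft Fc unfolding homotopy_prod_def by auto
qed

lemma homotopy_group_eq:
  "homotopy_group (Kstar X) n (Kstar_vertex X x0) = quotient_monoid (sph n x0)
     (homotopy_rel (Kstar X) n (Kstar_vertex X x0)) (homotopy_prod (Kstar X) n (Kstar_vertex X x0)) (base_simplex n x0)"
  by (simp add: homotopy_group_def quotient_monoid_def)

lemma homotopy_group_iso:
  shows "group (homotopy_group (Kstar X) n (Kstar_vertex X x0))"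
    and "(`) (\<lambda>s. val s {..n}) \<in> iso (homotopy_group (Kstar X) n (Kstar_vertex X x0))
      (quotient_monoid (sphere_points X n x0) (point_rel X n x0) (square X n x0 x0) x0)"
proof -
  interpret product_relation "sphere_points X n x0" "point_rel X n x0" "square X n x0 x0" x0
    by (rule product_relation_points[OF n x0])
  note args = sphere_bij[OF n x0] homotopy_rel_iff[OF n x0] const_sphere[OF n x0] homotopy_prod_square
    homotopy_prod_total
  show "group (homotopy_group (Kstar X) n (Kstar_vertex X x0))"
    unfolding homotopy_group_eq
    by (rule product_relation.group[OF product_relation_transport[where \<theta> = "\<lambda>s. val s {..n}"]])
      (use args in auto)
  show "(`) (\<lambda>s. val s {..n}) \<in> iso (homotopy_group (Kstar X) n (Kstar_vertex X x0)) G"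
    unfolding homotopy_group_eq by (rule iso_transport) (use args in auto)
qed

end

end

section \<open>The comparison isomorphism\<close>

text \<open>Classes are matched by their last labels, through the group on
  \<open>sphere_points\<close>. No representatives are chosen, so naturality becomes a computation
  with \<open>point_rel\<close>.\<close>

definition compare :: "nat \<Rightarrow> 'a cubeset \<Rightarrow> 'a \<Rightarrow> 'a set \<Rightarrow> 'a Kstar_simplex set" where
  "compare n X x0 P =
     {s \<in> spheres (Kstar X) n (Kstar_vertex X x0). val s {..n} \<in> (\<lambda>c. vert X n c (ones n)) ` P}"

context cfcubeset
begin

lemma compare_iso:
  assumes n: "1 \<le> n" and x0: "x0 \<in> sections X 0"
  shows "compare n X x0 \<in> iso (str_group X n x0) (homotopy_group (Kstar X) n (Kstar_vertex X x0))"
proof (rule iso_of_common_image[OF homotopy_group_iso(1)[OF n x0] str_group_iso(2)[OF n x0]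
      homotopy_group_iso(2)[OF n x0] _ _ str_group_iso(1)[OF n x0]])
  let ?sph = "spheres (Kstar X) n (Kstar_vertex X x0)" and ?top = "\<lambda>c. vert X n c (ones n)"
  fix P assume "P \<in> carrier (str_group X n x0)"
  then obtain c where c: "c \<in> str_cubes X n x0" "P = str_rel X n x0 `` {c}"
    by (auto simp: str_group_def quotient_def)
  have topP: "?top ` P = point_rel X n x0 `` {?top c}"
  proof
    show "?top ` P \<subseteq> point_rel X n x0 `` {?top c}" using c str_rel_iff[OF n x0] by auto
    show "point_rel X n x0 `` {?top c} \<subseteq> ?top ` P"
    proof
      fix a assume a: "a \<in> point_rel X n x0 `` {?top c}"
      then have "a \<in> sphere_points X n x0" by (auto simp: point_rel_def sphere_points_def)
      then have "a \<in> ?top ` str_cubes X n x0" using str_cubes_bij[of n x0] by (simp add: bij_betw_def)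
      then obtain d where "d \<in> str_cubes X n x0" "a = ?top d" by blast
      then show "a \<in> ?top ` P" using a c str_rel_iff[OF n x0] by auto
    qed
  qed
  have sub: "?top ` P \<subseteq> (\<lambda>s. val s {..n}) ` ?sph"
    using sphere_bij[OF n x0] unfolding topP bij_betw_def by (auto simp: point_rel_def sphere_points_def)
  have "?top c \<in> sphere_points X n x0" using bij_betwE[OF str_cubes_bij] c(1) by blast
  then have "?top c \<in> (\<lambda>s. val s {..n}) ` ?sph" using sphere_bij[OF n x0] by (simp add: bij_betw_def)
  then obtain s where s: "s \<in> ?sph" "val s {..n} = ?top c" by auto
  have "compare n X x0 P = homotopy_rel (Kstar X) n (Kstar_vertex X x0) `` {s}"
    unfolding compare_def topP using homotopy_rel_iff[OF n x0] s by auto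
  then show "compare n X x0 P \<in> carrier (homotopy_group (Kstar X) n (Kstar_vertex X x0))"
    using s(1) by (auto simp: homotopy_group_def intro: quotientI)
  show "(\<lambda>s. val s {..n}) ` compare n X x0 P = ?top ` P"
  proof
    show "(\<lambda>s. val s {..n}) ` compare n X x0 P \<subseteq> ?top ` P" unfolding compare_def by auto
    show "?top ` P \<subseteq> (\<lambda>s. val s {..n}) ` compare n X x0 P"
    proof
      fix a assume a: "a \<in> ?top ` P"
      then obtain t where "t \<in> ?sph" "a = val t {..n}" using sub by blast
      then show "a \<in> (\<lambda>s. val s {..n}) ` compare n X x0 P" using a unfolding compare_def by blast
    qed
  qed
qed

end

text \<open>Both sides are the set \<open>?Z\<close> of spheres whose top label is related by
  \<open>point_rel\<close> to the image of a last vertex from \<open>P\<close>, because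
  \<open>f\<close> commutes with taking last vertices and with taking top labels.\<close>

lemma compare_natural:
  assumes "concrete_fibrant X" "concrete_fibrant Y" and f: "f \<in> cubeset_hom X Y" and n: "1 \<le> n"
    and x0: "x0 \<in> sections X 0" and P: "P \<subseteq> str_cubes X n x0"
  shows "compare n Y (f 0 x0) (str_map n X Y x0 f P)
    = homotopy_map n (Kstar X) (Kstar Y) (Kstar_vertex X x0) (Kstar_map f) (compare n X x0 P)"
proof -
  interpret X: cfcubeset X using assms(1) by unfold_locales
  interpret Y: cfcubeset Y using assms(2) by unfold_locales
  have y0: "f 0 x0 \<in> sections Y 0" by (rule psh_hom_in[OF f x0])
  let ?Z = "{s \<in> spheres (Kstar Y) n (Kstar_vertex Y (f 0 x0)).
    \<exists>c\<in>P. (f 0 (vert X n c (ones n)), val s {..n}) \<in> point_rel Y n (f 0 x0)}"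
  have fc: "f n c \<in> str_cubes Y n (f 0 x0)" "vert Y n (f n c) (ones n) = f 0 (vert X n c (ones n))" if "c \<in> P" for c
    using P that hom_vert_commute[OF f] psh_hom_in[OF f] ones_in_cube by (auto simp: str_cubes_def subset_iff)
  have "val s {..n} \<in> (\<lambda>c. vert Y n c (ones n)) ` str_map n X Y x0 f P \<longleftrightarrow>
      (\<exists>c\<in>P. (f 0 (vert X n c (ones n)), val s {..n}) \<in> point_rel Y n (f 0 x0))" for s
  proof
    assume "val s {..n} \<in> (\<lambda>c. vert Y n c (ones n)) ` str_map n X Y x0 f P"
    then obtain c d where "c \<in> P" "(f n c, d) \<in> str_rel Y n (f 0 x0)" "val s {..n} = vert Y n d (ones n)"
      by (auto simp: str_map_def)
    then show "\<exists>c\<in>P. (f 0 (vert X n c (ones n)), val s {..n}) \<in> point_rel Y n (f 0 x0)"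
      using Y.str_rel_iff[OF n y0] fc by auto
  next
    assume "\<exists>c\<in>P. (f 0 (vert X n c (ones n)), val s {..n}) \<in> point_rel Y n (f 0 x0)"
    then obtain c where c: "c \<in> P" "(f 0 (vert X n c (ones n)), val s {..n}) \<in> point_rel Y n (f 0 x0)" by blast
    then have "val s {..n} \<in> sphere_points Y n (f 0 x0)" by (auto simp: point_rel_def sphere_points_def)
    then have "val s {..n} \<in> (\<lambda>c. vert Y n c (ones n)) ` str_cubes Y n (f 0 x0)"
      using Y.str_cubes_bij[of n "f 0 x0"] by (simp add: bij_betw_def)
    then obtain d where d: "d \<in> str_cubes Y n (f 0 x0)" "val s {..n} = vert Y n d (ones n)" by blast
    have "(f n c, d) \<in> str_rel Y n (f 0 x0)" using Y.str_rel_iff[OF n y0] fc c d by simp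
    then have "d \<in> str_map n X Y x0 f P" using c(1) by (auto simp: str_map_def)
    then show "val s {..n} \<in> (\<lambda>c. vert Y n c (ones n)) ` str_map n X Y x0 f P" using d(2) by blast
  qed
  then have L: "compare n Y (f 0 x0) (str_map n X Y x0 f P) = ?Z" by (simp add: compare_def)
  have top: "{..n} \<in> Sub n" by (auto simp: Sub_atMost)
  have fs: "Kstar_map f n t \<in> spheres (Kstar Y) n (Kstar_vertex Y (f 0 x0))" "val (Kstar_map f n t) {..n} = f 0 (val t {..n})"
    if "t \<in> spheres (Kstar X) n (Kstar_vertex X x0)" for t
    using that Kstar_map_in[OF f] val_Kstar_map[of _ n f t] top
    by (auto simp: X.spheres_iff[OF n x0] Y.spheres_iff[OF n y0])
  have v: "Kstar_map f 0 (Kstar_vertex X x0) = Kstar_vertex Y (f 0 x0)"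
    by (rule Kstar_map_vertex[OF assms(1-3) x0])
  have "homotopy_map n (Kstar X) (Kstar Y) (Kstar_vertex X x0) (Kstar_map f) (compare n X x0 P) = ?Z"
  proof (intro equalityI subsetI)
    fix s assume "s \<in> homotopy_map n (Kstar X) (Kstar Y) (Kstar_vertex X x0) (Kstar_map f) (compare n X x0 P)"
    then obtain t c where t: "t \<in> spheres (Kstar X) n (Kstar_vertex X x0)" "c \<in> P" "val t {..n} = vert X n c (ones n)"
      "(Kstar_map f n t, s) \<in> homotopy_rel (Kstar Y) n (Kstar_vertex Y (f 0 x0))"
      unfolding homotopy_map_def v compare_def by auto
    then show "s \<in> ?Z" using Y.homotopy_rel_iff[OF n y0] fs(2)[OF t(1)] by auto
  next
    fix s assume "s \<in> ?Z"
    then obtain c where c: "c \<in> P" "(f 0 (vert X n c (ones n)), val s {..n}) \<in> point_rel Y n (f 0 x0)"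
      and s: "s \<in> spheres (Kstar Y) n (Kstar_vertex Y (f 0 x0))" by blast
    have "vert X n c (ones n) \<in> sphere_points X n x0" using bij_betwE[OF X.str_cubes_bij] c(1) P by blast
    then have "vert X n c (ones n) \<in> (\<lambda>t. val t {..n}) ` spheres (Kstar X) n (Kstar_vertex X x0)"
      using X.sphere_bij[OF n x0] by (simp add: bij_betw_def)
    then obtain t where t: "t \<in> spheres (Kstar X) n (Kstar_vertex X x0)" "val t {..n} = vert X n c (ones n)" by auto
    have "(Kstar_map f n t, s) \<in> homotopy_rel (Kstar Y) n (Kstar_vertex Y (f 0 x0))"
      using Y.homotopy_rel_iff[OF n y0] fs[OF t(1)] s c(2) t(2) by simp
    moreover have "t \<in> compare n X x0 P" using t c(1) by (auto simp: compare_def)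
    ultimately show "s \<in> homotopy_map n (Kstar X) (Kstar Y) (Kstar_vertex X x0) (Kstar_map f) (compare n X x0 P)"
      unfolding homotopy_map_def v by blast
  qed
  with L show ?thesis by simp
qed

theorem mainTheorem2:
  shows
    "(\<forall>X :: 'a cubeset. concrete_fibrant X \<longrightarrow> kan_complex (Kstar X)) \<and>
     (\<exists>\<Phi> :: 'a cubeset \<Rightarrow> 'a set \<Rightarrow> 'a Kstar_simplex set.
        (\<forall>X. concrete_fibrant X \<longrightarrow>
           bij_betw (\<Phi> X) (erg_components X) (conn_components (Kstar X)) \<and>
           (\<forall>x\<in>sections X 0.
              \<Phi> X (erg_rel X `` {x}) = conn_rel (Kstar X) `` {Kstar_vertex X x})) \<and>
        (\<forall>X Y f. concrete_fibrant X \<longrightarrow> concrete_fibrant Y \<longrightarrow> f \<in> cubeset_hom X Y \<longrightarrow>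
           (\<forall>P\<in>erg_components X.
              \<Phi> Y (erg_map X Y f P)
                = conn_map (Kstar X) (Kstar Y) (Kstar_map f) (\<Phi> X P)))) \<and>
     (\<forall>n\<ge>1. \<exists>\<Psi> :: 'a cubeset \<Rightarrow> 'a \<Rightarrow> 'a set \<Rightarrow> 'a Kstar_simplex set.
        (\<forall>X. concrete_fibrant X \<longrightarrow> (\<forall>x0\<in>sections X 0.
           group (str_group X n x0) \<and>
           group (homotopy_group (Kstar X) n (Kstar_vertex X x0)) \<and>
           \<Psi> X x0 \<in> iso (str_group X n x0)
                        (homotopy_group (Kstar X) n (Kstar_vertex X x0)))) \<and>
        (\<forall>X Y f. concrete_fibrant X \<longrightarrow> concrete_fibrant Y \<longrightarrow> f \<in> cubeset_hom X Y \<longrightarrow>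
           (\<forall>x0\<in>sections X 0. \<forall>P\<in>carrier (str_group X n x0).
              \<Psi> Y (f 0 x0) (str_map n X Y x0 f P)
                = homotopy_map n (Kstar X) (Kstar Y) (Kstar_vertex X x0) (Kstar_map f)
                    (\<Psi> X x0 P))))"
proof (intro conjI allI impI)
  have cf: "cfcubeset X" if "concrete_fibrant X" for X :: "'a cubeset" using that by unfold_locales
  show "kan_complex (Kstar X)" if "concrete_fibrant X" for X :: "'a cubeset"
    by (rule cfcubeset.kan_complex_Kstar[OF cf[OF that]])
  show "\<exists>\<Phi> :: 'a cubeset \<Rightarrow> 'a set \<Rightarrow> 'a Kstar_simplex set.
        (\<forall>X. concrete_fibrant X \<longrightarrow>
           bij_betw (\<Phi> X) (erg_components X) (conn_components (Kstar X)) \<and>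
           (\<forall>x\<in>sections X 0. \<Phi> X (erg_rel X `` {x}) = conn_rel (Kstar X) `` {Kstar_vertex X x})) \<and>
        (\<forall>X Y f. concrete_fibrant X \<longrightarrow> concrete_fibrant Y \<longrightarrow> f \<in> cubeset_hom X Y \<longrightarrow>
           (\<forall>P\<in>erg_components X. \<Phi> Y (erg_map X Y f P) = conn_map (Kstar X) (Kstar Y) (Kstar_map f) (\<Phi> X P)))"
  proof (intro exI[of _ "\<lambda>X. (`) (Kstar_vertex X)"] conjI allI impI ballI)
    fix X :: "'a cubeset" assume X: "concrete_fibrant X"
    show "bij_betw ((`) (Kstar_vertex X)) (erg_components X) (conn_components (Kstar X))"
      by (rule cfcubeset.components_bij[OF cf[OF X]])
    show "Kstar_vertex X ` (erg_rel X `` {x}) = conn_rel (Kstar X) `` {Kstar_vertex X x}" if "x \<in> sections X 0" for x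
      by (rule cfcubeset.conn_rel_vertex[OF cf[OF X] that, symmetric])
    fix Y f P assume Y: "concrete_fibrant Y" and f: "f \<in> cubeset_hom X Y" and P: "P \<in> erg_components X"
    have "P \<subseteq> sections X 0" using P by (auto simp: erg_components_def quotient_def erg_rel_def)
    then show "Kstar_vertex Y ` erg_map X Y f P = conn_map (Kstar X) (Kstar Y) (Kstar_map f) (Kstar_vertex X ` P)"
      by (rule components_natural[OF X Y f])
  qed
  fix n :: nat assume n: "1 \<le> n"
  show "\<exists>\<Psi> :: 'a cubeset \<Rightarrow> 'a \<Rightarrow> 'a set \<Rightarrow> 'a Kstar_simplex set.
        (\<forall>X. concrete_fibrant X \<longrightarrow> (\<forall>x0\<in>sections X 0.
           group (str_group X n x0) \<and>
           group (homotopy_group (Kstar X) n (Kstar_vertex X x0)) \<and>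
           \<Psi> X x0 \<in> iso (str_group X n x0) (homotopy_group (Kstar X) n (Kstar_vertex X x0)))) \<and>
        (\<forall>X Y f. concrete_fibrant X \<longrightarrow> concrete_fibrant Y \<longrightarrow> f \<in> cubeset_hom X Y \<longrightarrow>
           (\<forall>x0\<in>sections X 0. \<forall>P\<in>carrier (str_group X n x0).
              \<Psi> Y (f 0 x0) (str_map n X Y x0 f P)
                = homotopy_map n (Kstar X) (Kstar Y) (Kstar_vertex X x0) (Kstar_map f) (\<Psi> X x0 P)))"
  proof (intro exI[of _ "compare n"] conjI allI impI ballI)
    fix X :: "'a cubeset" and x0 assume X: "concrete_fibrant X" and x0: "x0 \<in> sections X 0"
    show "group (str_group X n x0)" by (rule cfcubeset.str_group_iso(1)[OF cf[OF X] n x0])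
    show "group (homotopy_group (Kstar X) n (Kstar_vertex X x0))"
      by (rule cfcubeset.homotopy_group_iso(1)[OF cf[OF X] n x0])
    show "compare n X x0 \<in> iso (str_group X n x0) (homotopy_group (Kstar X) n (Kstar_vertex X x0))"
      by (rule cfcubeset.compare_iso[OF cf[OF X] n x0])
  next
    fix X Y :: "'a cubeset" and f x0 P
    assume XY: "concrete_fibrant X" "concrete_fibrant Y" and f: "f \<in> cubeset_hom X Y"
      and x0: "x0 \<in> sections X 0" and P: "P \<in> carrier (str_group X n x0)"
    have "P \<subseteq> str_cubes X n x0" using P by (auto simp: str_group_def quotient_def str_rel_def)
    then show "compare n Y (f 0 x0) (str_map n X Y x0 f P)
        = homotopy_map n (Kstar X) (Kstar Y) (Kstar_vertex X x0) (Kstar_map f) (compare n X x0 P)"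
      by (rule compare_natural[OF XY f n x0])
  qed
qed

end
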